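(* Let $(\mathcal{E}^n\to\mathcal{E}^n/\mathcal{V})\in \mathrm{Quot}_P(\mathcal{E}^n)$ be an $S^1$-fixed point of type $(\alpha_1,\ldots,\alpha_r;\beta_1,\ldots,\beta_r)$. Then the $S^1$-weights, counted with multiplicity, on the tangent space $$T_{(\mathcal{E}^n\to\mathcal{E}^n/\mathcal{V})}\mathrm{Quot}_P(\mathcal{E}^n)\simeq \mathrm{Hom}_{\mathcal{O}_C}(\mathcal{V},\mathcal{E}^n/\mathcal{V})$$ are the disjoint union (with multiplicity) of $\mathrm{Wt}_1$, $\mathrm{Wt}_2$ and $\mathrm{Wt}_3$, where $$\mathrm{Wt}_1=\bigsqcup_{i,j=1}^r\big((\alpha_j-\alpha_i,\alpha_j]\cap\mathbb{Z}\big),\qquad \mathrm{Wt}_2=\bigsqcup_{i,j=1}^r\big([-\beta_j,\beta_i-\beta_j)\cap\mathbb{Z}\big),$$ and $\mathrm{Wt}_3$ consists of $(n-r)$ copies of $$\mathrm{Wt}_3'=\bigsqcup_{i=1}^r\big([-\beta_{i'},\alpha_i]\cap\mathbb{Z}\big),$$ with $i\mapsto i'$ a permutation of $\{1,\ldots,r\}$ (the resulting multiset does not depend on which permutation is used).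
   Context: Let $1\le r\le n$, $d\ge 0$. $C=\mathbb{CP}^1=\mathbb{C}\cup\{\infty\}$ with affine charts $U_0=\mathrm{Spec}\,\mathbb{C}[z]$ and $U_\infty=\mathrm{Spec}\,\mathbb{C}[w]$, $w=1/z$. $\mathcal{E}^n=\mathcal{O}_C\otimes\mathbb{C}^n$. $\mathrm{Quot}_P(\mathcal{E}^n)$ is the Quot-scheme of quotients $\mathcal{E}^n\to\mathcal{E}^n/\mathcal{V}$ with Hilbert polynomial $P(t)=(n-r)t+d+(n-r)$; a point is the same as a coherent subsheaf $\mathcal{V}\subset\mathcal{E}^n$ of rank $r$ with $\deg(\mathcal{E}^n/\mathcal{V})=d$. $S^1=U(1)\subset\mathbb{C}^\times$ acts on $C$ by $z\mapsto tz$, on $\mathcal{E}^n$ by $(z,v)\mapsto(tz,v)$, and on subsheaves through $(t\cdot s)(z)=s(t^{-1}z)$ on local sections. At an $S^1$-fixed point, $S^1$ acts on $\mathcal{V}$ and $\mathcal{E}^n/\mathcal{V}$, and the induced action on the tangent space $\mathrm{Hom}_{\mathcal{O}_C}(\mathcal{V},\mathcal{E}^n/\mathcal{V})$ is $f\mapsto t\circ f\circ t^{-1}$; a vector $f$ has weight $\mu\in\mathbb{Z}$ if $t\cdot f=t^\mu f$. Type of a fixed point: an $S^1$-invariant rank-$r$ subsheaf $\mathcal{V}$ is contained in a unique constant subsheaf $\widehat{\mathcal{V}}=\mathcal{O}_C\otimes W$, $W\subset\mathbb{C}^n$, $\dim W=r$; there are a basis $(u_i)$ of $W$ and integers $0\le\alpha_1\le\cdots\le\alpha_r$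 with $\mathcal{V}|_{U_0}$ associated to $\bigoplus_i\mathbb{C}[z]z^{\alpha_i}u_i$, and a basis $(u'_i)$ of $W$ and integers $0\le\beta_1\le\cdots\le\beta_r$ with $\mathcal{V}|_{U_\infty}$ associated to $\bigoplus_i\mathbb{C}[w]w^{\beta_i}u'_i$; one has $\sum\alpha_i+\sum\beta_i=d$. These integers, which are determined by $\mathcal{V}$, form its type. Disjoint unions of sets of integers are multisets: the multiplicity of an integer is the number of times it appears in the union. *)

theory Defs
  imports
    "HOL-Analysis.Analysis"
    "HOL-Computational_Algebra.Fraction_Field"
    "HOL-Algebra.Module"
    "HOL-Combinatorics.Permutations"
begin

type_synonym ratfun = "complex poly fract"

datatype proj_line = Aff complex | Infty

text \<open>
  Only nonempty open sets are considered: the value of a sheaf of modules on the empty set is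
  forced to be zero, and since the curve is irreducible, finite intersections of nonempty open sets
  are nonempty.  A nonempty open set is affine iff it is not the whole curve.
\<close>
definition zopen :: "proj_line set \<Rightarrow> bool" where
  "zopen U \<longleftrightarrow> U \<noteq> {} \<and> finite (- U)"

definition U_zero :: "proj_line set" where
  "U_zero = - {Infty}"

definition U_infty :: "proj_line set" where
  "U_infty = - {Aff 0}"

definition zvar :: ratfun where
  "zvar = Fraction_Field.Fract [:0, 1:] 1"

definition wvar :: ratfun where
  "wvar = inverse zvar"

abbreviation const_fun :: "complex \<Rightarrow> ratfun" where
  "const_fun c \<equiv> Fraction_Field.Fract [:c:] 1"

definition const_vec :: "complex ^ 'n \<Rightarrow> ratfun ^ 'n" where
  "const_vec u = (\<chi> i. const_fun (u $ i))"

fun regular_at :: "proj_line \<Rightarrow> ratfun \<Rightarrow> bool" where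
  "regular_at (Aff a) f \<longleftrightarrow> (\<exists>p q. poly q a \<noteq> 0 \<and> f = Fraction_Field.Fract p q)"
| "regular_at Infty f \<longleftrightarrow> (\<exists>p q. q \<noteq> 0 \<and> degree p \<le> degree q \<and> f = Fraction_Field.Fract p q)"

definition structure_sheaf :: "proj_line set \<Rightarrow> ratfun set" where
  "structure_sheaf U = {f. \<forall>p\<in>U. regular_at p f}"


section \<open>Coherent subsheaves of a trivial bundle\<close>

text \<open>
  All sheaves below are sheaves of submodules of the constant sheaf of \<open>n\<close>-tuples of rational
  functions, so that restriction maps are inclusions.
\<close>
type_synonym 'n presheaf = "proj_line set \<Rightarrow> (ratfun ^ 'n) set"

definition trivial_sheaf :: "'n::finite presheaf" where
  "trivial_sheaf U = {s. \<forall>i. s $ i \<in> structure_sheaf U}"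

definition subsheaf :: "'n::finite presheaf \<Rightarrow> bool" where
  "subsheaf V \<longleftrightarrow>
     (\<forall>U. zopen U \<longrightarrow>
        V U \<subseteq> trivial_sheaf U \<and> 0 \<in> V U \<and>
        (\<forall>s\<in>V U. \<forall>s'\<in>V U. s + s' \<in> V U) \<and>
        (\<forall>f\<in>structure_sheaf U. \<forall>s\<in>V U. f *s s \<in> V U)) \<and>
     (\<forall>U U'. zopen U \<and> zopen U' \<and> U' \<subseteq> U \<longrightarrow> V U \<subseteq> V U') \<and>
     (\<forall>\<U> s. \<U> \<noteq> {} \<and> (\<forall>U\<in>\<U>. zopen U \<and> s \<in> V U) \<longrightarrow> s \<in> V (\<Union>\<U>))"

definition lin_span :: "ratfun set \<Rightarrow> (ratfun ^ 'n) set \<Rightarrow> (ratfun ^ 'n::finite) set" where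
  "lin_span R S = {\<Sum>x\<in>F. c x *s x | F c. finite F \<and> F \<subseteq> S \<and> c ` F \<subseteq> R}"

text \<open>
  The restriction of \<open>V\<close> to the affine open set \<open>A\<close> is the sheaf associated to the module \<open>M\<close> over
  the coordinate ring of \<open>A\<close>: its sections are those which near each point are fractions \<open>m / g\<close>
  with \<open>g\<close> not vanishing at that point.
\<close>
definition associated_on :: "'n::finite presheaf \<Rightarrow> proj_line set \<Rightarrow> (ratfun ^ 'n) set \<Rightarrow> bool" where
  "associated_on V A M \<longleftrightarrow>
     (\<forall>U. zopen U \<and> U \<subseteq> A \<longrightarrow>
        V U = {s. \<forall>p\<in>U. \<exists>m\<in>M. \<exists>g\<in>structure_sheaf A.
                     g \<noteq> 0 \<and> regular_at p (inverse g) \<and> s = inverse g *s m})"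

definition coherent_subsheaf :: "'n::finite presheaf \<Rightarrow> bool" where
  "coherent_subsheaf V \<longleftrightarrow> subsheaf V \<and>
     (\<forall>p. \<exists>A G. p \<in> A \<and> zopen A \<and> A \<noteq> UNIV \<and> finite G \<and>
        associated_on V A (lin_span (structure_sheaf A) G))"

definition constant_subsheaf :: "(complex ^ 'n) set \<Rightarrow> 'n::finite presheaf" where
  "constant_subsheaf W U = lin_span (structure_sheaf U) (const_vec ` W)"

definition stalk :: "'n::finite presheaf \<Rightarrow> proj_line \<Rightarrow> (ratfun ^ 'n) set" where
  "stalk V p = \<Union> {V U | U. zopen U \<and> p \<in> U}"


section \<open>The quotient sheaf\<close>

text \<open>
  The sheafification of the presheaf quotient of \<open>trivial_sheaf\<close> by \<open>V\<close>: a section over \<open>U\<close> is a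
  family of cosets in the stalks, indexed by the points of \<open>U\<close>, that is locally induced by
  sections of \<open>trivial_sheaf\<close>.
\<close>
type_synonym 'n quot_section = "proj_line \<Rightarrow> (ratfun ^ 'n) set"

definition quot_sections :: "'n::finite presheaf \<Rightarrow> proj_line set \<Rightarrow> 'n quot_section set" where
  "quot_sections V U =
     {\<sigma> \<in> (\<Pi>\<^sub>E p\<in>U. {e +o stalk V p | e. e \<in> stalk trivial_sheaf p}).
        \<forall>p\<in>U. \<exists>U'. zopen U' \<and> p \<in> U' \<and> U' \<subseteq> U \<and>
          (\<exists>e\<in>trivial_sheaf U'. \<forall>q\<in>U'. \<sigma> q = e +o stalk V q)}"

definition quot_zero :: "'n::finite presheaf \<Rightarrow> proj_line set \<Rightarrow> 'n quot_section" where
  "quot_zero V U = (\<lambda>p\<in>U. stalk V p)"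

definition quot_add ::
  "proj_line set \<Rightarrow> 'n::finite quot_section \<Rightarrow> 'n quot_section \<Rightarrow> 'n quot_section" where
  "quot_add U \<sigma> \<tau> = (\<lambda>p\<in>U. \<sigma> p + \<tau> p)"

text \<open>Adding the stalk makes the product with \<open>0\<close> the zero coset instead of \<open>{0}\<close>.\<close>
definition quot_scale ::
  "'n::finite presheaf \<Rightarrow> proj_line set \<Rightarrow> ratfun \<Rightarrow> 'n quot_section \<Rightarrow> 'n quot_section" where
  "quot_scale V U f \<sigma> = (\<lambda>p\<in>U. ((*s) f) ` \<sigma> p + stalk V p)"


section \<open>Finite-dimensional complex vector spaces with explicit carrier\<close>

definition finite_basis :: "(complex, 'v) module \<Rightarrow> 'v set \<Rightarrow> bool" where
  "finite_basis M B \<longleftrightarrow> finite B \<and> B \<subseteq> carrier M \<and>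
     (\<forall>v\<in>carrier M. \<exists>!c. c \<in> B \<rightarrow>\<^sub>E UNIV \<and> v = (\<Oplus>\<^bsub>M\<^esub>b\<in>B. c b \<odot>\<^bsub>M\<^esub> b))"


section \<open>Hilbert polynomial and points of the Quot scheme\<close>

text \<open>
  Global sections of the quotient sheaf tensored with the line bundle of degree \<open>t\<close>, whose sections
  are pairs of functions on the two charts related by the transition function \<open>z ^ t\<close>.
  The ring multiplication and unit of the record play no role.
\<close>
definition twisted_global_sections ::
  "'n::finite presheaf \<Rightarrow> nat \<Rightarrow> (complex, 'n quot_section \<times> 'n quot_section) module" where
  "twisted_global_sections V t =
     \<lparr>carrier = {(\<sigma>, \<tau>). \<sigma> \<in> quot_sections V U_zero \<and> \<tau> \<in> quot_sections V U_infty \<and>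
        restrict \<sigma> (U_zero \<inter> U_infty) = quot_scale V (U_zero \<inter> U_infty) (zvar ^ t) \<tau>},
      mult = undefined, one = undefined,
      zero = (quot_zero V U_zero, quot_zero V U_infty),
      add = (\<lambda>(\<sigma>, \<tau>) (\<sigma>', \<tau>'). (quot_add U_zero \<sigma> \<sigma>', quot_add U_infty \<tau> \<tau>')),
      smult = (\<lambda>c (\<sigma>, \<tau>). (quot_scale V U_zero (const_fun c) \<sigma>,
                           quot_scale V U_infty (const_fun c) \<tau>))\<rparr>"

text \<open>\<open>P\<close> is the Hilbert polynomial of the quotient of \<open>trivial_sheaf\<close> by \<open>V\<close>.\<close>
definition is_hilbert_polynomial :: "'n::finite presheaf \<Rightarrow> int poly \<Rightarrow> bool" where
  "is_hilbert_polynomial V P \<longleftrightarrow>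
     (\<exists>t0. \<forall>t\<ge>t0. \<exists>B. finite_basis (twisted_global_sections V t) B \<and>
        int (card B) = poly P (int t))"

definition quot_points :: "int poly \<Rightarrow> 'n::finite presheaf set" where
  "quot_points P = {V. coherent_subsheaf V \<and> is_hilbert_polynomial V P}"


section \<open>The circle action\<close>

fun act_point :: "complex \<Rightarrow> proj_line \<Rightarrow> proj_line" where
  "act_point t (Aff a) = Aff (t * a)"
| "act_point t Infty = Infty"

text \<open>The function \<open>f(z / t)\<close>.\<close>
definition act_fun :: "complex \<Rightarrow> ratfun \<Rightarrow> ratfun" where
  "act_fun t f = (THE g. \<exists>p q. q \<noteq> 0 \<and> f = Fraction_Field.Fract p q \<and>
     g = Fraction_Field.Fract (pcompose p [:0, inverse t:]) (pcompose q [:0, inverse t:]))"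

definition act_sec :: "complex \<Rightarrow> ratfun ^ 'n \<Rightarrow> ratfun ^ 'n::finite" where
  "act_sec t s = (\<chi> i. act_fun t (s $ i))"

definition circle_fixed :: "'n::finite presheaf \<Rightarrow> bool" where
  "circle_fixed V \<longleftrightarrow>
     (\<forall>t U. cmod t = 1 \<and> zopen U \<longrightarrow> act_sec t ` V U = V (act_point t ` U))"

text \<open>The translate by \<open>t\<close> of a section over the preimage of \<open>U\<close>, a section over \<open>U\<close>.\<close>
definition act_quot ::
  "complex \<Rightarrow> proj_line set \<Rightarrow> 'n::finite quot_section \<Rightarrow> 'n quot_section" where
  "act_quot t U \<sigma> = (\<lambda>p\<in>U. act_sec t ` \<sigma> (act_point (inverse t) p))"

text \<open>The sequences \<open>\<alpha>\<close> and \<open>\<beta>\<close> are indexed by \<open>{1..r}\<close>; other values are irrelevant.\<close>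
definition has_type ::
  "nat \<Rightarrow> 'n::finite presheaf \<Rightarrow> (nat \<Rightarrow> nat) \<Rightarrow> (nat \<Rightarrow> nat) \<Rightarrow> bool" where
  "has_type r V \<alpha> \<beta> \<longleftrightarrow> mono_on {1..r} \<alpha> \<and> mono_on {1..r} \<beta> \<and>
     (\<exists>W u u'. vec.subspace W \<and> vec.dim W = r \<and>
        (\<forall>U. zopen U \<longrightarrow> V U \<subseteq> constant_subsheaf W U) \<and>
        inj_on u {1..r} \<and> vec.independent (u ` {1..r}) \<and> vec.span (u ` {1..r}) = W \<and>
        inj_on u' {1..r} \<and> vec.independent (u' ` {1..r}) \<and> vec.span (u' ` {1..r}) = W \<and>
        associated_on V U_zero
          (lin_span (structure_sheaf U_zero) ((\<lambda>i. zvar ^ \<alpha> i *s const_vec (u i)) ` {1..r})) \<and>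
        associated_on V U_infty
          (lin_span (structure_sheaf U_infty) ((\<lambda>i. wvar ^ \<beta> i *s const_vec (u' i)) ` {1..r})))"


section \<open>The tangent space and its weights\<close>

text \<open>A morphism of sheaves, as a family of maps on sections over nonempty open sets.\<close>
type_synonym 'n quot_hom = "proj_line set \<Rightarrow> ratfun ^ 'n \<Rightarrow> 'n quot_section"

definition sheaf_homs :: "'n::finite presheaf \<Rightarrow> 'n quot_hom set" where
  "sheaf_homs V =
     {\<phi> \<in> (\<Pi>\<^sub>E U\<in>Collect zopen. V U \<rightarrow>\<^sub>E quot_sections V U).
        (\<forall>U. zopen U \<longrightarrow>
           (\<forall>s\<in>V U. \<forall>s'\<in>V U. \<phi> U (s + s') = quot_add U (\<phi> U s) (\<phi> U s')) \<and>
           (\<forall>f\<in>structure_sheaf U. \<forall>s\<in>V U. \<phi> U (f *s s) = quot_scale V U f (\<phi> U s))) \<and>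
        (\<forall>U U'. zopen U \<and> zopen U' \<and> U' \<subseteq> U \<longrightarrow>
           (\<forall>s\<in>V U. \<phi> U' s = restrict (\<phi> U s) U'))}"

definition tangent_space :: "'n::finite presheaf \<Rightarrow> (complex, 'n quot_hom) module" where
  "tangent_space V =
     \<lparr>carrier = sheaf_homs V, mult = undefined, one = undefined,
      zero = (\<lambda>U\<in>Collect zopen. \<lambda>s\<in>V U. quot_zero V U),
      add = (\<lambda>\<phi> \<psi>. \<lambda>U\<in>Collect zopen. \<lambda>s\<in>V U. quot_add U (\<phi> U s) (\<psi> U s)),
      smult = (\<lambda>c \<phi>. \<lambda>U\<in>Collect zopen. \<lambda>s\<in>V U. quot_scale V U (const_fun c) (\<phi> U s))\<rparr>"

text \<open>The conjugate of \<open>\<phi>\<close> by \<open>t\<close>.\<close>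
definition act_hom :: "'n::finite presheaf \<Rightarrow> complex \<Rightarrow> 'n quot_hom \<Rightarrow> 'n quot_hom" where
  "act_hom V t \<phi> = (\<lambda>U\<in>Collect zopen. \<lambda>s\<in>V U.
     act_quot t U (\<phi> (act_point (inverse t) ` U) (act_sec (inverse t) s)))"

definition weight_vector :: "'n::finite presheaf \<Rightarrow> int \<Rightarrow> 'n quot_hom \<Rightarrow> bool" where
  "weight_vector V \<mu> \<phi> \<longleftrightarrow> \<phi> \<in> carrier (tangent_space V) \<and>
     (\<forall>t. cmod t = 1 \<longrightarrow> act_hom V t \<phi> = (t powi \<mu>) \<odot>\<^bsub>tangent_space V\<^esub> \<phi>)"

text \<open>The weights counted with multiplicity are the weights of a basis of weight vectors.\<close>
definition tangent_weights :: "'n::finite presheaf \<Rightarrow> int multiset \<Rightarrow> bool" where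
  "tangent_weights V M \<longleftrightarrow>
     (\<exists>B wt. finite_basis (tangent_space V) B \<and> (\<forall>\<phi>\<in>B. weight_vector V (wt \<phi>) \<phi>) \<and>
        M = image_mset wt (mset_set B))"

definition Wt1 :: "nat \<Rightarrow> (nat \<Rightarrow> nat) \<Rightarrow> int multiset" where
  "Wt1 r \<alpha> = (\<Sum>i\<in>{1..r}. \<Sum>j\<in>{1..r}. mset_set {int (\<alpha> j) - int (\<alpha> i) <.. int (\<alpha> j)})"

definition Wt2 :: "nat \<Rightarrow> (nat \<Rightarrow> nat) \<Rightarrow> int multiset" where
  "Wt2 r \<beta> = (\<Sum>i\<in>{1..r}. \<Sum>j\<in>{1..r}. mset_set {- int (\<beta> j) ..< int (\<beta> i) - int (\<beta> j)})"

definition Wt3' :: "nat \<Rightarrow> (nat \<Rightarrow> nat) \<Rightarrow> (nat \<Rightarrow> nat) \<Rightarrow> (nat \<Rightarrow> nat) \<Rightarrow> int multiset" where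
  "Wt3' r \<alpha> \<beta> \<pi> = (\<Sum>i\<in>{1..r}. mset_set {- int (\<beta> (\<pi> i)) .. int (\<alpha> i)})"

end

theory Submission
  imports Defs "HOL-Computational_Algebra.Fundamental_Theorem_Algebra"
begin

text \<open>
  Let \<open>K\<close> be the field of rational functions and \<open>W\<close> the space spanned by the \<open>u i\<close> and also by the
  \<open>u' i\<close>.  Choosing a complement of \<open>W\<close> in the space of constant vectors splits the quotient of the
  trivial bundle by \<open>V\<close> into a trivial bundle of rank \<open>n - r\<close> and the quotient of the constant
  sheaf of \<open>W\<close> by \<open>V\<close>, a torsion sheaf supported at the two fixed points \<open>0\<close> and \<open>\<infinity>\<close>.  Accordingly
  the tangent space has three parts.

  \<^item> Local morphisms at \<open>0\<close> to the torsion part: \<open>z^(\<alpha> i) u i\<close> goes to \<open>z^k u j\<close> with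
    \<open>0 \<le> k < \<alpha> j\<close>, of weight \<open>\<alpha> i - k\<close>.  They give \<open>Wt1\<close>.

  \<^item> Local morphisms at \<open>\<infinity>\<close>: \<open>w^(\<beta> i) u' i\<close> goes to \<open>w^k u' j\<close> with \<open>0 \<le> k < \<beta> j\<close>, of weight
    \<open>k - \<beta> i\<close>, because \<open>w\<close> has the opposite weight.  They give \<open>Wt2\<close>.

  \<^item> For each of the \<open>n - r\<close> complementary directions a global section of the dual of \<open>V\<close>, which is
    a Laurent polynomial in \<open>z\<close> whose coefficients are linear forms on \<open>W\<close>.  Regularity at \<open>0\<close> only
    constrains the coefficients of negative powers of \<open>z\<close>, and regularity at \<open>\<infinity>\<close> only those of
    positive powers.  Hence the dual basis of \<open>u\<close> can be used for the powers \<open>z^(- k)\<close> with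
    \<open>0 \<le> k \<le> \<alpha> i\<close>, of weight \<open>k\<close>, and the dual basis of \<open>u'\<close> for the powers \<open>z^k\<close> with
    \<open>1 \<le> k \<le> \<beta> i\<close>, of weight \<open>- k\<close>.  In this way no basis of \<open>W\<close> adapted to both charts at once has
    to be found.  These are the weights of \<open>Wt3'\<close>: each interval \<open>[- \<beta> (\<pi> i), \<alpha> i]\<close> is cut into its
    negative and its nonnegative half, and the halves do not remember how \<open>\<pi>\<close> paired them.

  To compute with morphisms, each of these is represented by a family of \<open>K\<close>-linear maps \<open>L p\<close> of
  the space of \<open>n\<close>-tuples, one for each point \<open>p\<close>, with \<open>L p s\<close> taken modulo the stalk of \<open>V\<close> at \<open>p\<close>
  (\<open>local_hom\<close>).  Questions about bases of the tangent space become congruences modulo stalks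
  (\<open>tangent_basis\<close>), and the stalks are known explicitly in a frame of a chart (\<open>stalk_iff\<close>).  That
  the listed morphisms are independent and span is then a statement about Taylor and Laurent
  coefficients (\<open>basis_independent\<close>, \<open>ex_pole_coefficients\<close>, \<open>basis_spans\<close>).
\<close>

section \<open>Regular rational functions\<close>

definition cst :: "complex \<Rightarrow> ratfun" where
  "cst c = Fraction_Field.Fract [:c:] 1"

lemma cst_0 [simp]: "cst 0 = 0"
  by (simp add: cst_def fract_collapse)

lemma cst_1 [simp]: "cst 1 = 1"
  by (simp add: cst_def One_fract_def one_pCons)

lemma cst_add: "cst (a + b) = cst a + cst b"
  by (simp add: cst_def)

lemma cst_mult: "cst (a * b) = cst a * cst b"
  by (simp add: cst_def mult.commute)

lemma cst_minus: "cst (- a) = - cst a"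
  by (simp add: cst_def)

lemma cst_diff: "cst (a - b) = cst a - cst b"
  by (simp add: cst_def)

lemma cst_sum: "cst (sum f A) = (\<Sum>x\<in>A. cst (f x))"
  by (induction A rule: infinite_finite_induct) (simp_all add: cst_add)

lemma cst_eq_0_iff [simp]: "cst a = 0 \<longleftrightarrow> a = 0"
  by (simp add: cst_def Zero_fract_def eq_fract)

lemma cst_inverse: "cst (inverse a) = inverse (cst a)"
proof (cases "a = 0")
  case False
  have "cst (inverse a) * cst a = 1"
    using False by (simp flip: cst_mult)
  then show ?thesis
    by (metis inverse_unique mult.commute)
qed simp

lemma zvar_nonzero [simp]: "zvar \<noteq> 0"
  by (simp add: zvar_def Zero_fract_def eq_fract)

lemma wvar_nonzero [simp]: "wvar \<noteq> 0"
  by (simp add: wvar_def)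

lemma regular_cst [simp]: "regular_at p (cst c)"
proof (cases p)
  case (Aff a)
  have "poly (1 :: complex poly) a \<noteq> 0" "cst c = Fraction_Field.Fract [:c:] 1"
    by (simp_all add: cst_def)
  then show ?thesis
    using Aff by (auto simp del: poly_1)
next
  case Infty
  have "(1 :: complex poly) \<noteq> 0" "degree [:c:] \<le> degree (1 :: complex poly)"
    "cst c = Fraction_Field.Fract [:c:] 1"
    by (simp_all add: cst_def)
  then show ?thesis
    unfolding Infty regular_at.simps by blast
qed

lemma regular_0 [simp]: "regular_at p 0" and regular_1 [simp]: "regular_at p 1"
  using regular_cst[of p 0] regular_cst[of p 1] by simp_all

lemma regular_add: "regular_at p f \<Longrightarrow> regular_at p g \<Longrightarrow> regular_at p (f + g)"
proof (cases p)
  case (Aff a)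
  assume "regular_at p f" "regular_at p g"
  then obtain b c b' c' where "poly c a \<noteq> 0" "f = Fraction_Field.Fract b c"
    "poly c' a \<noteq> 0" "g = Fraction_Field.Fract b' c'"
    using Aff by auto
  moreover from this have "c \<noteq> 0" "c' \<noteq> 0"
    by auto
  ultimately have "poly (c * c') a \<noteq> 0"
    "f + g = Fraction_Field.Fract (b * c' + b' * c) (c * c')"
    by simp_all
  then show ?thesis
    unfolding Aff regular_at.simps by blast
next
  case Infty
  assume "regular_at p f" "regular_at p g"
  then obtain b c b' c' where *: "c \<noteq> 0" "f = Fraction_Field.Fract b c" "degree b \<le> degree c"
    "c' \<noteq> 0" "g = Fraction_Field.Fract b' c'" "degree b' \<le> degree c'"
    using Infty by auto
  have "degree (b * c') \<le> degree (c * c')" "degree (b' * c) \<le> degree (c * c')"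
    using * degree_mult_le[of b c'] degree_mult_le[of b' c] by (simp_all add: degree_mult_eq)
  then have "degree (b * c' + b' * c) \<le> degree (c * c')"
    by (rule degree_add_le)
  moreover have "c * c' \<noteq> 0" "f + g = Fraction_Field.Fract (b * c' + b' * c) (c * c')"
    using * by simp_all
  ultimately show ?thesis
    unfolding Infty regular_at.simps by blast
qed

lemma regular_mult: "regular_at p f \<Longrightarrow> regular_at p g \<Longrightarrow> regular_at p (f * g)"
proof (cases p)
  case (Aff a)
  assume "regular_at p f" "regular_at p g"
  then obtain b c b' c' where "poly c a \<noteq> 0" "f = Fraction_Field.Fract b c"
    "poly c' a \<noteq> 0" "g = Fraction_Field.Fract b' c'"
    using Aff by auto
  then have "poly (c * c') a \<noteq> 0" "f * g = Fraction_Field.Fract (b * b') (c * c')"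
    by simp_all
  then show ?thesis
    unfolding Aff regular_at.simps by blast
next
  case Infty
  assume "regular_at p f" "regular_at p g"
  then obtain b c b' c' where *: "c \<noteq> 0" "f = Fraction_Field.Fract b c" "degree b \<le> degree c"
    "c' \<noteq> 0" "g = Fraction_Field.Fract b' c'" "degree b' \<le> degree c'"
    using Infty by auto
  have "degree (b * b') \<le> degree (c * c')"
    using * degree_mult_le[of b b'] by (simp add: degree_mult_eq)
  moreover have "c * c' \<noteq> 0" "f * g = Fraction_Field.Fract (b * b') (c * c')"
    using * by simp_all
  ultimately show ?thesis
    unfolding Infty regular_at.simps by blast
qed

lemma regular_minus: "regular_at p f \<Longrightarrow> regular_at p (- f)"
  using regular_mult[OF regular_cst[of p "-1"], of f] by (simp add: cst_minus)

lemma regular_diff: "regular_at p f \<Longrightarrow> regular_at p g \<Longrightarrow> regular_at p (f - g)"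
  using regular_add[of p f "- g"] regular_minus by simp

lemma regular_sum: "(\<And>x. x \<in> A \<Longrightarrow> regular_at p (f x)) \<Longrightarrow> regular_at p (sum f A)"
  by (induction A rule: infinite_finite_induct) (auto intro: regular_add)

lemma regular_power: "regular_at p f \<Longrightarrow> regular_at p (f ^ k)"
  by (induction k) (auto intro: regular_mult)

lemma regular_zvar_Aff: "regular_at (Aff a) zvar"
  unfolding regular_at.simps zvar_def by (intro exI[of _ "[:0, 1:]"] exI[of _ 1]) simp

lemma regular_wvar_Aff: "a \<noteq> 0 \<Longrightarrow> regular_at (Aff a) wvar"
  unfolding regular_at.simps zvar_def wvar_def
  by (intro exI[of _ "[:0, 1:]"] exI[of _ 1]) simp

lemma regular_wvar_Infty: "regular_at Infty wvar"
  unfolding regular_at.simps zvar_def wvar_def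
  by (intro exI[of _ "[:0, 1:]"] exI[of _ 1]) simp

lemma not_regular_wvar_0: "\<not> regular_at (Aff 0) wvar"
proof
  assume "regular_at (Aff 0) wvar"
  then obtain p q where pq: "poly q 0 \<noteq> 0" "wvar = Fraction_Field.Fract p q"
    by auto
  then have "q \<noteq> 0"
    by auto
  with pq have "q = p * [:0, 1:]"
    by (simp add: wvar_def zvar_def eq_fract)
  with pq(1) show False
    by simp
qed

lemma not_regular_zvar_Infty: "\<not> regular_at Infty zvar"
proof
  assume "regular_at Infty zvar"
  then obtain p q where pq: "q \<noteq> 0" "degree p \<le> degree q" "zvar = Fraction_Field.Fract p q"
    by auto
  then have "[:0, 1:] * q = p"
    by (simp add: zvar_def eq_fract)
  with pq show False
    by (auto simp: degree_mult_eq)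
qed

lemma finite_poles: "finite {p. \<not> regular_at p f}"
proof -
  obtain a b where f: "f = Fraction_Field.Fract a b" "b \<noteq> 0"
    by (cases f)
  have "{p. \<not> regular_at p f} \<subseteq> insert Infty (Aff ` {x. poly b x = 0})"
  proof
    fix p assume "p \<in> {p. \<not> regular_at p f}"
    then show "p \<in> insert Infty (Aff ` {x. poly b x = 0})"
      using f(1) by (cases p) auto
  qed
  then show ?thesis
    using poly_roots_finite[OF f(2)] finite_subset by blast
qed

text \<open>
  The last condition says that the residue field at \<open>p\<close> is the field of constants.  It makes Taylor
  expansion possible, while the second one, that \<open>\<theta>\<close> is not a unit, makes the coefficients unique.
\<close>
definition uniformizer :: "proj_line \<Rightarrow> ratfun \<Rightarrow> bool" where
  "uniformizer p \<theta> \<longleftrightarrow> regular_at p \<theta> \<and> \<not> regular_at p (inverse \<theta>) \<and>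
     (\<forall>f. regular_at p f \<longrightarrow> (\<exists>c g. regular_at p g \<and> f = cst c + \<theta> * g))"

lemma uniformizer_zvar: "uniformizer (Aff 0) zvar"
  unfolding uniformizer_def
proof (intro conjI allI impI)
  show "\<not> regular_at (Aff 0) (inverse zvar)"
    using not_regular_wvar_0 by (simp only: wvar_def not_False_eq_True)
  fix f assume "regular_at (Aff 0) f"
  then obtain p q where pq: "poly q 0 \<noteq> 0" "f = Fraction_Field.Fract p q"
    by auto
  then have "q \<noteq> 0"
    by auto
  define c where "c = poly p 0 / poly q 0"
  have "poly (p - Polynomial.smult c q) 0 = 0"
    using pq(1) by (simp add: c_def)
  then obtain h where h: "p - Polynomial.smult c q = [:0, 1:] * h"
    unfolding poly_eq_0_iff_dvd by auto
  have "f = cst c + zvar * Fraction_Field.Fract h q"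
    using h \<open>q \<noteq> 0\<close> pq(2) by (simp add: cst_def zvar_def eq_fract algebra_simps)
  moreover have "regular_at (Aff 0) (Fraction_Field.Fract h q)"
    using pq(1) by auto
  ultimately show "\<exists>c g. regular_at (Aff 0) g \<and> f = cst c + zvar * g"
    by blast
qed (rule regular_zvar_Aff)

lemma uniformizer_wvar: "uniformizer Infty wvar"
  unfolding uniformizer_def
proof (intro conjI allI impI)
  show "\<not> regular_at Infty (inverse wvar)"
    using not_regular_zvar_Infty by (simp only: wvar_def inverse_inverse_eq not_False_eq_True)
  fix f assume "regular_at Infty f"
  then obtain p q where pq: "q \<noteq> 0" "degree p \<le> degree q" "f = Fraction_Field.Fract p q"
    by auto
  define c where "c = coeff p (degree q) / lead_coeff q"
  define h where "h = p - Polynomial.smult c q"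
  have "degree h \<le> degree q"
    unfolding h_def using pq(2) by (intro degree_diff_le) auto
  have "coeff h (degree q) = 0"
    using pq(1) by (simp add: h_def c_def)
  have "degree ([:0, 1:] * h) \<le> degree q"
  proof (cases "h = 0")
    case False
    with \<open>coeff h (degree q) = 0\<close> have "degree h \<noteq> degree q"
      using leading_coeff_0_iff[of h] by metis
    then show ?thesis
      using \<open>degree h \<le> degree q\<close> False by (simp add: degree_mult_eq)
  qed simp
  then have "regular_at Infty (Fraction_Field.Fract ([:0, 1:] * h) q)"
    using pq(1) unfolding regular_at.simps by blast
  moreover have "f = cst c + wvar * Fraction_Field.Fract ([:0, 1:] * h) q"
    using pq(1,3) unfolding h_def
    by (simp add: cst_def wvar_def zvar_def eq_fract algebra_simps)
  ultimately show "\<exists>c g. regular_at Infty g \<and> f = cst c + wvar * g"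
    by blast
qed (rule regular_wvar_Infty)

lemma uniformizer_nonzero: "uniformizer p \<theta> \<Longrightarrow> \<theta> \<noteq> 0"
  by (auto simp: uniformizer_def)

lemma taylor_expansion:
  assumes "uniformizer p \<theta>" and "regular_at p f"
  shows "\<exists>c g. regular_at p g \<and> f = (\<Sum>k<m. cst (c k) * \<theta> ^ k) + \<theta> ^ m * g"
proof (induction m)
  case 0
  then show ?case
    using assms by auto
next
  case (Suc m)
  then obtain c g where cg: "regular_at p g" "f = (\<Sum>k<m. cst (c k) * \<theta> ^ k) + \<theta> ^ m * g"
    by blast
  obtain c0 g0 where "regular_at p g0" "g = cst c0 + \<theta> * g0"
    using assms(1) cg(1) unfolding uniformizer_def by blast
  then have "regular_at p g0 \<and>
      f = (\<Sum>k<Suc m. cst ((c(m := c0)) k) * \<theta> ^ k) + \<theta> ^ Suc m * g0"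
    unfolding cg(2) by (simp add: algebra_simps)
  then show ?case
    by blast
qed

lemma taylor_coefficients:
  assumes u: "uniformizer p \<theta>" and "regular_at p f"
  shows "\<exists>c. regular_at p (\<theta> powi (- int m) * (f - (\<Sum>k<m. cst (c k) * \<theta> ^ k)))"
proof -
  obtain c g where "regular_at p g" "f = (\<Sum>k<m. cst (c k) * \<theta> ^ k) + \<theta> ^ m * g"
    using taylor_expansion[OF assms, of m] by blast
  moreover from this have "\<theta> powi (- int m) * (f - (\<Sum>k<m. cst (c k) * \<theta> ^ k)) = g"
    using uniformizer_nonzero[OF u] by (simp add: power_int_minus)
  ultimately have "regular_at p (\<theta> powi (- int m) * (f - (\<Sum>k<m. cst (c k) * \<theta> ^ k)))"
    by (simp only:)
  then show ?thesis
    by blast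
qed

lemma uniformizer_powi_regular:
  assumes "uniformizer p \<theta>" and "0 \<le> k"
  shows "regular_at p (\<theta> powi k)"
  using assms by (auto simp: power_int_def uniformizer_def intro: regular_power)

text \<open>
  If the most negative exponent with a nonzero coefficient were below zero, multiplying by a power
  of the uniformizer would leave its inverse as the only term that is not regular.
\<close>
lemma laurent_sum_regular:
  assumes u: "uniformizer p \<theta>" and "finite S"
    and reg: "regular_at p (\<Sum>k\<in>S. cst (c k) * \<theta> powi k)" and "k \<in> S" "k < 0"
  shows "c k = 0"
proof (rule ccontr)
  assume "c k \<noteq> 0"
  define T where "T = {k \<in> S. c k \<noteq> 0}"
  have T: "finite T" "T \<noteq> {}" "k \<in> T"
    using assms \<open>c k \<noteq> 0\<close> by (auto simp: T_def)
  define m where "m = Min T"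
  have m: "m \<in> T" "m \<le> k" "\<And>l. l \<in> T \<Longrightarrow> m \<le> l"
    using T by (simp_all add: m_def)
  note nz = uniformizer_nonzero[OF u]
  have sum_T: "(\<Sum>k\<in>S. cst (c k) * \<theta> powi k) = (\<Sum>k\<in>T. cst (c k) * \<theta> powi k)"
    by (rule sum.mono_neutral_right) (auto simp: T_def \<open>finite S\<close>)
  have "regular_at p (\<theta> powi (- m - 1) * (\<Sum>k\<in>T. cst (c k) * \<theta> powi k))"
    using reg m(2) \<open>k < 0\<close> unfolding sum_T
    by (intro regular_mult uniformizer_powi_regular[OF u]) auto
  also have "\<theta> powi (- m - 1) * (\<Sum>k\<in>T. cst (c k) * \<theta> powi k)
      = (\<Sum>k\<in>T. cst (c k) * \<theta> powi (k - m - 1))"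
    unfolding sum_distrib_left
    by (intro sum.cong refl) (simp add: nz algebra_simps flip: power_int_add)
  also have "\<dots> = cst (c m) * inverse \<theta> + (\<Sum>k\<in>T - {m}. cst (c k) * \<theta> powi (k - m - 1))"
    using T(1) m(1) by (simp add: sum.remove[of T m] power_int_minus)
  finally have 1: "regular_at p \<dots>" .
  have 2: "regular_at p (\<Sum>k\<in>T - {m}. cst (c k) * \<theta> powi (k - m - 1))"
  proof (intro regular_sum regular_mult regular_cst uniformizer_powi_regular[OF u])
    fix l assume "l \<in> T - {m}"
    then show "0 \<le> l - m - 1"
      using m(3)[of l] by auto
  qed
  have "regular_at p (cst (inverse (c m)) * (cst (c m) * inverse \<theta>))"
    using regular_mult[OF regular_cst regular_diff[OF 1 2]] by simp
  moreover have "c m \<noteq> 0"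
    using m(1) by (simp add: T_def)
  then have "cst (inverse (c m)) * (cst (c m) * inverse \<theta>) = inverse \<theta>"
    by (simp add: cst_inverse mult.assoc[symmetric])
  ultimately have "regular_at p (inverse \<theta>)"
    by metis
  then show False
    using u by (simp add: uniformizer_def)
qed

text \<open>
  The condition that a pole at \<open>p\<close> has order at most \<open>m\<close>, read off from the coefficients.
\<close>
lemma laurent_sum_regular_shift:
  assumes u: "uniformizer p \<theta>" and "finite S"
    and reg: "regular_at p (\<theta> powi m * (\<Sum>k\<in>S. cst (c k) * \<theta> powi k))"
    and "k \<in> S" "k + m < 0"
  shows "c k = 0"
proof -
  note nz = uniformizer_nonzero[OF u]
  have "\<theta> powi m * (\<Sum>k\<in>S. cst (c k) * \<theta> powi k)
      = (\<Sum>k\<in>(\<lambda>k. k + m) ` S. cst (c (k - m)) * \<theta> powi k)"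
    unfolding sum_distrib_left
    by (subst sum.reindex) (auto intro!: sum.cong simp: nz power_int_add)
  then show ?thesis
    using laurent_sum_regular[OF u, of "(\<lambda>k. k + m) ` S" "\<lambda>k. c (k - m)" "k + m"] assms by auto
qed

lemma laurent_sum_eq_0:
  assumes u: "uniformizer p \<theta>" and "finite S"
    and "(\<Sum>k\<in>S. cst (c k) * \<theta> powi k) = 0" and "k \<in> S"
  shows "c k = 0"
  using laurent_sum_regular_shift[OF u \<open>finite S\<close>, of "- k - 1" c k] assms by simp

lemma taylor_polynomial_unique:
  assumes u: "uniformizer p \<theta>" and reg: "regular_at p (\<theta> powi (- int m) * (\<Sum>k<m. cst (c k) * \<theta> ^ k))"
    and "k < m"
  shows "c k = 0"
proof -
  have "(\<Sum>k<m. cst (c k) * \<theta> ^ k) = (\<Sum>k\<in>int ` {..<m}. cst (c (nat k)) * \<theta> powi k)"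
    by (simp add: sum.reindex)
  then show ?thesis
    using laurent_sum_regular_shift[OF u, of "int ` {..<m}" "- int m" "\<lambda>k. c (nat k)" "int k"] reg \<open>k < m\<close> by auto
qed

lemma zvar_power_Fract: "zvar ^ k = Fraction_Field.Fract (monom 1 k) 1"
  by (induction k) (simp_all add: zvar_def One_fract_def monom_Suc)

lemma Fract_poly_eq_sum: "Fraction_Field.Fract p 1 = (\<Sum>k\<le>degree p. cst (coeff p k) * zvar ^ k)"
proof -
  have fract_add_1: "Fraction_Field.Fract (a + b) 1 = Fraction_Field.Fract a 1 + Fraction_Field.Fract b 1"
    for a b :: "complex poly"
    by simp
  have sum: "Fraction_Field.Fract (sum f A) 1 = (\<Sum>x\<in>A. Fraction_Field.Fract (f x) (1 :: complex poly))"
    for f and A :: "nat set"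
    by (induction A rule: infinite_finite_induct) (simp_all add: fract_collapse fract_add_1 del: add_fract)
  have "Fraction_Field.Fract p 1 = Fraction_Field.Fract (\<Sum>k\<le>degree p. monom (coeff p k) k) 1"
    by (simp add: poly_as_sum_of_monoms)
  also have "\<dots> = (\<Sum>k\<le>degree p. cst (coeff p k) * zvar ^ k)"
    unfolding sum by (intro sum.cong refl) (simp add: cst_def zvar_power_Fract smult_monom)
  finally show ?thesis .
qed

text \<open>
  A zero of the denominator at a nonzero point is also a zero of the numerator and cancels, so
  that finally only the zeros of the denominator at the origin are left.
\<close>
lemma poles_only_at_0_polynomial:
  assumes "q \<noteq> 0" and "\<And>a. a \<noteq> 0 \<Longrightarrow> regular_at (Aff a) (Fraction_Field.Fract p q)"
  shows "\<exists>M P. zvar ^ M * Fraction_Field.Fract p q = Fraction_Field.Fract P 1"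
  using assms
proof (induction "degree q" arbitrary: p q)
  case 0
  then obtain c where c: "q = [:c:]" "c \<noteq> 0"
    by (metis degree_eq_zeroE pCons_0_0)
  have "zvar ^ 0 * Fraction_Field.Fract p q = Fraction_Field.Fract (Polynomial.smult (inverse c) p) 1"
    using c by (simp add: eq_fract)
  then show ?case
    by blast
next
  case (Suc n)
  then have "\<not> constant (poly q)"
    by (metis Zero_not_Suc Fundamental_Theorem_Algebra.constant_degree)
  then obtain a where a: "poly q a = 0"
    using fundamental_theorem_of_algebra by blast
  then obtain q1 where q1: "q = [:- a, 1:] * q1"
    by (metis dvdE poly_eq_0_iff_dvd)
  have "q1 \<noteq> 0"
    using Suc.prems(1) q1 by auto
  moreover from this have "degree q = Suc (degree q1)"
    unfolding q1 by (subst degree_mult_eq) auto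
  ultimately have q1': "q1 \<noteq> 0" "n = degree q1"
    using Suc.hyps(2) by simp_all
  show ?case
  proof (cases "a = 0")
    case True
    have eq: "zvar * Fraction_Field.Fract p q = Fraction_Field.Fract p q1"
      using q1 q1' True by (simp add: zvar_def eq_fract)
    have "regular_at (Aff b) (Fraction_Field.Fract p q1)" if "b \<noteq> 0" for b
      unfolding eq[symmetric] by (intro regular_mult regular_zvar_Aff Suc.prems(2) that)
    then obtain M P where "zvar ^ M * Fraction_Field.Fract p q1 = Fraction_Field.Fract P 1"
      using Suc.hyps(1)[OF q1'(2) q1'(1)] by blast
    then have "zvar ^ Suc M * Fraction_Field.Fract p q = Fraction_Field.Fract P 1"
      unfolding eq[symmetric] by (simp add: mult_ac)
    then show ?thesis
      by blast
  next
    case False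
    then obtain p' q' where pq': "poly q' a \<noteq> 0" "Fraction_Field.Fract p q = Fraction_Field.Fract p' q'"
      using Suc.prems(2)[OF False] unfolding regular_at.simps by blast
    then have "q' \<noteq> 0"
      by auto
    then have "p * q' = p' * q"
      using pq'(2) Suc.prems(1) by (simp add: eq_fract)
    then have "poly p a * poly q' a = poly p' a * poly q a"
      by (metis poly_mult)
    then have "poly p a = 0"
      using a pq'(1) by simp
    then obtain p1 where p1: "p = [:- a, 1:] * p1"
      by (metis dvdE poly_eq_0_iff_dvd)
    have eq: "Fraction_Field.Fract p q = Fraction_Field.Fract p1 q1"
      unfolding p1 q1 by (rule mult_fract_cancel) simp
    show ?thesis
      unfolding eq using Suc.hyps(1)[OF q1'(2) q1'(1)] Suc.prems(2) eq by simp
  qed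
qed

text \<open>
  The expansion holds over every finite set that contains the support of \<open>c\<close>, so that finitely many
  functions can be expanded over one common set of exponents.
\<close>
lemma laurent_expansion:
  assumes "\<And>a. a \<noteq> 0 \<Longrightarrow> regular_at (Aff a) f"
  shows "\<exists>c. finite {k. c k \<noteq> 0} \<and>
    (\<forall>S. finite S \<and> {k. c k \<noteq> 0} \<subseteq> S \<longrightarrow> f = (\<Sum>k\<in>S. cst (c k) * zvar powi k))"
proof -
  obtain p q where "f = Fraction_Field.Fract p q" "q \<noteq> 0"
    by (cases f)
  then obtain M P where MP: "zvar ^ M * f = Fraction_Field.Fract P 1"
    using assms poles_only_at_0_polynomial by blast
  define c where "c k = (if k + int M \<ge> 0 then coeff P (nat (k + int M)) else 0)" for k
  have sub: "{k. c k \<noteq> 0} \<subseteq> (\<lambda>k. int k - int M) ` {..degree P}"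
  proof
    fix k assume "k \<in> {k. c k \<noteq> 0}"
    then have "k + int M \<ge> 0" "nat (k + int M) \<le> degree P"
      by (auto simp: c_def le_degree split: if_splits)
    then show "k \<in> (\<lambda>k. int k - int M) ` {..degree P}"
      by (intro image_eqI[of _ _ "nat (k + int M)"]) auto
  qed
  have "f = zvar powi (- int M) * (zvar ^ M * f)"
    by (simp add: power_int_minus)
  also have "\<dots> = (\<Sum>k\<le>degree P. cst (coeff P k) * zvar powi (int k - int M))"
    unfolding MP Fract_poly_eq_sum sum_distrib_left
    by (intro sum.cong refl) (simp add: power_int_diff power_int_minus field_simps)
  also have "\<dots> = (\<Sum>k\<in>(\<lambda>k. int k - int M) ` {..degree P}. cst (c k) * zvar powi k)"
    by (subst sum.reindex) (auto simp: inj_on_def c_def)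
  finally have f: "f = \<dots>" .
  have "f = (\<Sum>k\<in>S. cst (c k) * zvar powi k)" if "finite S" "{k. c k \<noteq> 0} \<subseteq> S" for S
  proof -
    have "f = (\<Sum>k\<in>{k. c k \<noteq> 0}. cst (c k) * zvar powi k)"
      unfolding f using sub by (intro sum.mono_neutral_right) auto
    also have "\<dots> = (\<Sum>k\<in>S. cst (c k) * zvar powi k)"
      using that by (intro sum.mono_neutral_left) auto
    finally show ?thesis .
  qed
  moreover have "finite {k. c k \<noteq> 0}"
    using sub finite_subset by blast
  ultimately show ?thesis
    by blast
qed


declare regular_at.simps [simp del]


section \<open>The circle action on rational functions\<close>

text \<open>
  The description in the definition does not depend on the chosen fraction, because substituting
  \<open>z / t\<close> is a ring homomorphism that keeps nonzero polynomials nonzero.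
\<close>
lemma act_fun_Fract:
  assumes "t \<noteq> 0" and "q \<noteq> 0"
  shows "act_fun t (Fraction_Field.Fract p q) =
    Fraction_Field.Fract (pcompose p [:0, inverse t:]) (pcompose q [:0, inverse t:])"
proof -
  have nz: "pcompose b [:0, inverse t:] \<noteq> 0" if "b \<noteq> 0" for b
    using that \<open>t \<noteq> 0\<close> by (simp add: pcompose_eq_0_iff)
  show ?thesis
    unfolding act_fun_def
  proof (rule the_equality)
    fix g
    assume "\<exists>p' q'. q' \<noteq> 0 \<and> Fraction_Field.Fract p q = Fraction_Field.Fract p' q' \<and>
      g = Fraction_Field.Fract (pcompose p' [:0, inverse t:]) (pcompose q' [:0, inverse t:])"
    then obtain p' q' where *: "q' \<noteq> 0" "p * q' = p' * q"
      and g: "g = Fraction_Field.Fract (pcompose p' [:0, inverse t:]) (pcompose q' [:0, inverse t:])"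
      using \<open>q \<noteq> 0\<close> by (auto simp: eq_fract)
    have "pcompose p' [:0, inverse t:] * pcompose q [:0, inverse t:]
        = pcompose p [:0, inverse t:] * pcompose q' [:0, inverse t:]"
      using *(2) by (simp flip: pcompose_mult)
    then show "g = Fraction_Field.Fract (pcompose p [:0, inverse t:]) (pcompose q [:0, inverse t:])"
      unfolding g using nz[OF *(1)] nz[OF \<open>q \<noteq> 0\<close>] by (simp add: eq_fract)
  qed (use \<open>q \<noteq> 0\<close> in blast)
qed

lemma act_fun_add: "t \<noteq> 0 \<Longrightarrow> act_fun t (f + g) = act_fun t f + act_fun t g"
  by (cases f; cases g) (simp add: act_fun_Fract pcompose_eq_0_iff pcompose_add pcompose_mult)

lemma act_fun_mult: "t \<noteq> 0 \<Longrightarrow> act_fun t (f * g) = act_fun t f * act_fun t g"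
  by (cases f; cases g) (simp add: act_fun_Fract pcompose_mult)

lemma act_fun_cst: "t \<noteq> 0 \<Longrightarrow> act_fun t (cst c) = cst c"
  by (simp add: cst_def act_fun_Fract pcompose_1)

lemma act_fun_0: "t \<noteq> 0 \<Longrightarrow> act_fun t 0 = 0" and act_fun_1: "t \<noteq> 0 \<Longrightarrow> act_fun t 1 = 1"
  using act_fun_cst[of t 0] act_fun_cst[of t 1] by simp_all

lemma act_fun_sum: "t \<noteq> 0 \<Longrightarrow> act_fun t (sum f A) = (\<Sum>x\<in>A. act_fun t (f x))"
  by (induction A rule: infinite_finite_induct) (simp_all add: act_fun_add act_fun_0)

lemma act_fun_inverse: "t \<noteq> 0 \<Longrightarrow> act_fun t (inverse f) = inverse (act_fun t f)"
  by (metis act_fun_0 act_fun_1 act_fun_mult inverse_unique inverse_zero right_inverse)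

lemma act_fun_zvar: "t \<noteq> 0 \<Longrightarrow> act_fun t zvar = cst (inverse t) * zvar"
  by (simp add: zvar_def cst_def act_fun_Fract pcompose_pCons pcompose_1)

lemma act_fun_zvar_powi:
  assumes "t \<noteq> 0"
  shows "act_fun t (zvar powi k) = cst (t powi (- k)) * zvar powi k"
proof -
  have pow: "act_fun t (zvar ^ m) = cst (inverse t ^ m) * zvar ^ m" for m
    using assms by (induction m) (simp_all add: act_fun_1 act_fun_mult act_fun_zvar cst_mult)
  show ?thesis
  proof (cases "k \<ge> 0")
    case True
    then show ?thesis
      using pow[of "nat k"] by (simp add: power_int_def power_inverse)
  next
    case False
    then show ?thesis
      using pow[of "nat (- k)"] assms
      by (simp add: power_int_def act_fun_inverse power_inverse cst_inverse)
  qed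
qed

lemma act_fun_act_fun_inverse:
  assumes "t \<noteq> 0"
  shows "act_fun t (act_fun (inverse t) f) = f"
proof -
  have "pcompose (pcompose p [:0, t:]) [:0, inverse t:] = p" for p
    using assms by (simp add: pcompose_pCons flip: pcompose_assoc)
  then show ?thesis
    using assms by (cases f) (simp add: act_fun_Fract pcompose_eq_0_iff)
qed


section \<open>Stalks, cosets and morphisms given stalkwise\<close>

lemma infinite_proj_line: "infinite (UNIV :: proj_line set)"
proof
  assume "finite (UNIV :: proj_line set)"
  then have "finite (range Aff)"
    by (rule finite_subset[rotated]) simp
  then have "finite (UNIV :: complex set)"
    by (rule finite_imageD) (simp add: inj_on_def)
  then show False
    by (simp add: infinite_UNIV_char_0)
qed

lemma zopen_iff_cofinite: "zopen U \<longleftrightarrow> finite (- U)"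
  using infinite_proj_line by (auto simp: zopen_def)

lemma zopen_Int: "zopen U \<Longrightarrow> zopen U' \<Longrightarrow> zopen (U \<inter> U')"
  by (simp add: zopen_iff_cofinite)

lemma zopen_nonempty: "zopen U \<Longrightarrow> \<exists>p. p \<in> U"
  by (auto simp: zopen_def)

definition regular_vec :: "proj_line \<Rightarrow> ratfun ^ 'n \<Rightarrow> bool" where
  "regular_vec p s \<longleftrightarrow> (\<forall>i. regular_at p (s $ i))"

lemma zopen_regular_at: "zopen {p. regular_at p f}"
  using finite_poles[of f] by (simp add: zopen_iff_cofinite Collect_neg_eq)

lemma zopen_regular_vec: "zopen {p. regular_vec p (s :: ratfun ^ 'n::finite)}"
proof -
  have "- {p. regular_vec p s} = (\<Union>i. {p. \<not> regular_at p (s $ i)})"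
    by (auto simp: regular_vec_def)
  then show ?thesis
    using finite_poles by (simp add: zopen_iff_cofinite)
qed

lemma regular_vec_add: "regular_vec p s \<Longrightarrow> regular_vec p s' \<Longrightarrow> regular_vec p (s + s')"
  by (simp add: regular_vec_def regular_add)

lemma regular_vec_scale: "regular_at p f \<Longrightarrow> regular_vec p s \<Longrightarrow> regular_vec p (f *s s)"
  by (simp add: regular_vec_def regular_mult)

lemma regular_vec_0 [simp]: "regular_vec p 0"
  by (simp add: regular_vec_def)

lemma regular_vec_sum: "(\<And>x. x \<in> A \<Longrightarrow> regular_vec p (f x)) \<Longrightarrow> regular_vec p (sum f A)"
  by (induction A rule: infinite_finite_induct) (auto intro: regular_vec_add)

lemma regular_vec_const_vec [simp]: "regular_vec p (const_vec u)"
  using regular_cst by (simp add: regular_vec_def const_vec_def cst_def)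

lemma mem_trivial_sheaf: "s \<in> trivial_sheaf U \<longleftrightarrow> (\<forall>p\<in>U. regular_vec p s)"
  by (auto simp: trivial_sheaf_def structure_sheaf_def regular_vec_def)

lemma stalk_trivial_sheaf: "stalk trivial_sheaf p = {s. regular_vec p s}"
proof (intro equalityI subsetI)
  fix s :: "ratfun ^ 'n" assume "s \<in> {s. regular_vec p s}"
  then have "s \<in> trivial_sheaf {p. regular_vec p s}" "p \<in> {p. regular_vec p s}"
    by (simp_all add: mem_trivial_sheaf)
  then show "s \<in> stalk trivial_sheaf p"
    unfolding stalk_def using zopen_regular_vec[of s] by blast
next
  fix s :: "ratfun ^ 'n" assume "s \<in> stalk trivial_sheaf p"
  then obtain U where "p \<in> U" "s \<in> trivial_sheaf U"
    unfolding stalk_def by blast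
  then show "s \<in> {s. regular_vec p s}"
    by (simp add: mem_trivial_sheaf)
qed

definition local_hom :: "'n::finite presheaf \<Rightarrow> (proj_line \<Rightarrow> ratfun ^ 'n \<Rightarrow> ratfun ^ 'n) \<Rightarrow> 'n quot_hom"
  where "local_hom V L = (\<lambda>U\<in>Collect zopen. \<lambda>s\<in>V U. \<lambda>p\<in>U. L p s +o stalk V p)"

text \<open>
  The last condition makes \<open>local_hom V L\<close> map sections to sections: near \<open>p\<close> the image of \<open>s\<close> is
  induced by the single vector \<open>L p s\<close> as soon as the finitely many exceptional points and the
  poles are removed.  Unlike local constancy of \<open>L\<close>, it allows a different value at one point.
\<close>
definition local_family :: "'n::finite presheaf \<Rightarrow> (proj_line \<Rightarrow> ratfun ^ 'n \<Rightarrow> ratfun ^ 'n) \<Rightarrow> bool"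
  where "local_family V L \<longleftrightarrow>
    (\<forall>p s s'. L p (s + s') = L p s + L p s') \<and>
    (\<forall>p f s. L p (f *s s) = f *s L p s) \<and>
    (\<forall>p. \<forall>s\<in>stalk V p. regular_vec p (L p s) \<and> finite {q. L q s - L p s \<notin> stalk V q})"

locale rational_subsheaf =
  fixes V :: "'n::finite presheaf"
  assumes subsheaf: "subsheaf V"
begin

lemma sections_regular: "zopen U \<Longrightarrow> s \<in> V U \<Longrightarrow> p \<in> U \<Longrightarrow> regular_vec p s"
  using subsheaf by (fastforce simp: subsheaf_def mem_trivial_sheaf)

lemma sections_0: "zopen U \<Longrightarrow> 0 \<in> V U"
  using subsheaf by (simp add: subsheaf_def)

lemma sections_add: "zopen U \<Longrightarrow> s \<in> V U \<Longrightarrow> s' \<in> V U \<Longrightarrow> s + s' \<in> V U"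
  using subsheaf by (simp add: subsheaf_def)

lemma sections_scale: "zopen U \<Longrightarrow> f \<in> structure_sheaf U \<Longrightarrow> s \<in> V U \<Longrightarrow> f *s s \<in> V U"
  using subsheaf by (simp add: subsheaf_def)

lemma sections_sum: "zopen U \<Longrightarrow> (\<And>x. x \<in> A \<Longrightarrow> f x \<in> V U) \<Longrightarrow> sum f A \<in> V U"
  by (induction A rule: infinite_finite_induct) (auto intro: sections_add sections_0)

lemma sections_restrict: "zopen U \<Longrightarrow> zopen U' \<Longrightarrow> U' \<subseteq> U \<Longrightarrow> s \<in> V U \<Longrightarrow> s \<in> V U'"
  using subsheaf unfolding subsheaf_def by blast

lemma stalkI: "zopen U \<Longrightarrow> p \<in> U \<Longrightarrow> s \<in> V U \<Longrightarrow> s \<in> stalk V p"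
  by (auto simp: stalk_def)

lemma stalkE:
  assumes "s \<in> stalk V p"
  obtains U where "zopen U" "p \<in> U" "s \<in> V U"
  using assms by (auto simp: stalk_def)

lemma stalk_regular: "s \<in> stalk V p \<Longrightarrow> regular_vec p s"
  by (meson sections_regular stalkE)

lemma stalk_0: "0 \<in> stalk V p"
  using sections_0[of UNIV] by (intro stalkI[of UNIV]) (auto simp: zopen_iff_cofinite)

lemma stalk_add:
  assumes "s \<in> stalk V p" "s' \<in> stalk V p"
  shows "s + s' \<in> stalk V p"
proof -
  obtain U U' where *: "zopen U" "p \<in> U" "s \<in> V U" "zopen U'" "p \<in> U'" "s' \<in> V U'"
    using assms by (elim stalkE)
  then have "s \<in> V (U \<inter> U')" "s' \<in> V (U \<inter> U')"
    by (meson inf_le1 inf_le2 sections_restrict zopen_Int)+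
  then show ?thesis
    using * by (intro stalkI[of "U \<inter> U'"] sections_add zopen_Int) auto
qed

lemma stalk_scale:
  assumes "regular_at p f" "s \<in> stalk V p"
  shows "f *s s \<in> stalk V p"
proof -
  obtain U where *: "zopen U" "p \<in> U" "s \<in> V U"
    using assms by (elim stalkE)
  define U' where "U' = U \<inter> {p. regular_at p f}"
  have "zopen U'" "p \<in> U'"
    using * assms by (auto simp: U'_def intro: zopen_Int zopen_regular_at)
  moreover have "f *s s \<in> V U'"
    using sections_restrict[OF *(1) \<open>zopen U'\<close>] * \<open>zopen U'\<close>
    by (intro sections_scale) (auto simp: structure_sheaf_def U'_def)
  ultimately show ?thesis
    by (rule stalkI)
qed

lemma stalk_minus: "s \<in> stalk V p \<Longrightarrow> - s \<in> stalk V p"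
  using stalk_scale[of p "-1" s] regular_minus[of p 1] by (simp add: vec_eq_iff)

lemma stalk_diff: "s \<in> stalk V p \<Longrightarrow> s' \<in> stalk V p \<Longrightarrow> s - s' \<in> stalk V p"
  using stalk_add[of s p "- s'"] stalk_minus by simp

lemma stalk_sum: "(\<And>x. x \<in> A \<Longrightarrow> f x \<in> stalk V p) \<Longrightarrow> sum f A \<in> stalk V p"
  by (induction A rule: infinite_finite_induct) (auto intro: stalk_add stalk_0)

lemma coset_eq_iff: "a +o stalk V p = b +o stalk V p \<longleftrightarrow> a - b \<in> stalk V p"
proof
  assume "a +o stalk V p = b +o stalk V p"
  moreover have "a \<in> a +o stalk V p"
    using stalk_0 by (simp add: set_minus_plus[symmetric])
  ultimately show "a - b \<in> stalk V p"
    by (simp add: set_minus_plus)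
next
  assume ab: "a - b \<in> stalk V p"
  have "x - a \<in> stalk V p \<longleftrightarrow> x - b \<in> stalk V p" for x
    using stalk_add[OF _ ab, of "x - a"] stalk_diff[OF _ ab, of "x - b"] by auto
  then show "a +o stalk V p = b +o stalk V p"
    by (auto simp: set_minus_plus[symmetric])
qed

lemma coset_add: "(a +o stalk V p) + (b +o stalk V p) = (a + b) +o stalk V p"
proof -
  have "stalk V p + stalk V p = stalk V p"
    using stalk_0 stalk_add by (auto elim!: set_plus_elim intro: set_zero_plus2[THEN subsetD])
  then show ?thesis
    by (simp add: set_plus_rearrange)
qed

text \<open>
  When \<open>f\<close> is a unit the image is already the whole coset; in general, and in particular for
  \<open>f = 0\<close>, it is the added stalk that fills it up.
\<close>
lemma coset_scale:
  assumes "regular_at p f"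
  shows "(*s) f ` (a +o stalk V p) + stalk V p = (f *s a) +o stalk V p"
proof (intro equalityI subsetI)
  fix x assume "x \<in> (*s) f ` (a +o stalk V p) + stalk V p"
  then obtain s s' where "s \<in> stalk V p" "s' \<in> stalk V p" "x = f *s (a + s) + s'"
    by (auto elim!: set_plus_elim simp: elt_set_plus_def)
  then show "x \<in> (f *s a) +o stalk V p"
    using stalk_add[OF stalk_scale[OF assms]]
    by (auto simp: set_minus_plus[symmetric] vector_add_ldistrib)
next
  fix x assume "x \<in> (f *s a) +o stalk V p"
  then obtain s where "s \<in> stalk V p" "x = f *s a + s"
    by (auto simp: elt_set_plus_def)
  moreover have "f *s a \<in> (*s) f ` (a +o stalk V p)"
    using stalk_0 by (auto simp: elt_set_plus_def intro!: image_eqI[of _ _ a])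
  ultimately show "x \<in> (*s) f ` (a +o stalk V p) + stalk V p"
    by auto
qed

lemma local_hom_apply:
  "zopen U \<Longrightarrow> s \<in> V U \<Longrightarrow> p \<in> U \<Longrightarrow> local_hom V L U s p = L p s +o stalk V p"
  by (simp add: local_hom_def)

lemma local_hom_eq_iff:
  "local_hom V L = local_hom V L' \<longleftrightarrow> (\<forall>p. \<forall>s\<in>stalk V p. L p s - L' p s \<in> stalk V p)"
proof
  assume eq: "local_hom V L = local_hom V L'"
  show "\<forall>p. \<forall>s\<in>stalk V p. L p s - L' p s \<in> stalk V p"
  proof (intro allI ballI)
    fix p s assume "s \<in> stalk V p"
    then obtain U where "zopen U" "p \<in> U" "s \<in> V U"
      by (rule stalkE)
    then have "L p s +o stalk V p = L' p s +o stalk V p"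
      using local_hom_apply eq by metis
    then show "L p s - L' p s \<in> stalk V p"
      by (simp add: coset_eq_iff)
  qed
next
  assume "\<forall>p. \<forall>s\<in>stalk V p. L p s - L' p s \<in> stalk V p"
  then have "L p s +o stalk V p = L' p s +o stalk V p" if "zopen U" "p \<in> U" "s \<in> V U" for U s p
    using stalkI[OF that] by (simp add: coset_eq_iff)
  then show "local_hom V L = local_hom V L'"
    by (auto simp: local_hom_def intro!: restrict_ext)
qed

lemma tangent_add:
  "local_hom V L \<oplus>\<^bsub>tangent_space V\<^esub> local_hom V L' = local_hom V (\<lambda>p s. L p s + L' p s)"
  by (auto simp: tangent_space_def local_hom_def quot_add_def coset_add intro!: restrict_ext)

lemma tangent_smult:
  "c \<odot>\<^bsub>tangent_space V\<^esub> local_hom V L = local_hom V (\<lambda>p s. cst c *s L p s)"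
  by (auto simp: tangent_space_def local_hom_def quot_scale_def coset_scale
      simp flip: cst_def intro!: restrict_ext)

lemma tangent_zero: "\<zero>\<^bsub>tangent_space V\<^esub> = local_hom V (\<lambda>p s. 0)"
  by (auto simp: tangent_space_def local_hom_def quot_zero_def intro!: restrict_ext)

lemma local_hom_mem:
  assumes L: "local_family V L"
  shows "local_hom V L \<in> carrier (tangent_space V)"
proof -
  have add: "L p (s + s') = L p s + L p s'" and scale: "L p (f *s s) = f *s L p s" for p s s' f
    using L by (auto simp: local_family_def)
  have sec: "(\<lambda>p\<in>U. L p s +o stalk V p) \<in> quot_sections V U" if "zopen U" "s \<in> V U" for U s
    unfolding quot_sections_def
  proof (safe intro!: restrict_PiE_iff[THEN iffD2])
    fix p assume "p \<in> U"
    then have s: "s \<in> stalk V p"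
      using that stalkI by blast
    with L have reg: "regular_vec p (L p s)" and fin: "finite {q. L q s - L p s \<notin> stalk V q}"
      by (auto simp: local_family_def)
    show "\<exists>e. L p s +o stalk V p = e +o stalk V p \<and> e \<in> stalk trivial_sheaf p"
      using reg by (auto simp: stalk_trivial_sheaf)
    (* On this neighbourhood of p the single vector L p s induces the whole section. *)
    define U' where "U' = U \<inter> {q. L q s - L p s \<in> stalk V q} \<inter> {q. regular_vec q (L p s)}"
    have "zopen U'"
      unfolding U'_def using fin \<open>zopen U\<close>
      by (intro zopen_Int zopen_regular_vec) (auto simp: zopen_iff_cofinite Collect_neg_eq)
    moreover have "p \<in> U'" "U' \<subseteq> U"
      using \<open>p \<in> U\<close> reg stalk_0 by (auto simp: U'_def)
    moreover have "L p s \<in> trivial_sheaf U'"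
      by (auto simp: mem_trivial_sheaf U'_def)
    moreover have "(\<lambda>p\<in>U. L p s +o stalk V p) q = L p s +o stalk V q" if "q \<in> U'" for q
      using that by (simp add: U'_def coset_eq_iff)
    ultimately show "\<exists>U'. zopen U' \<and> p \<in> U' \<and> U' \<subseteq> U \<and>
        (\<exists>e\<in>trivial_sheaf U'. \<forall>q\<in>U'. (\<lambda>p\<in>U. L p s +o stalk V p) q = e +o stalk V q)"
      by blast
  qed
  have "local_hom V L \<in> sheaf_homs V"
    unfolding sheaf_homs_def
  proof (intro CollectI conjI allI impI ballI)
    show "local_hom V L \<in> (\<Pi>\<^sub>E U\<in>Collect zopen. V U \<rightarrow>\<^sub>E quot_sections V U)"
      using sec by (auto simp: local_hom_def)
    show "local_hom V L U (s + s') = quot_add U (local_hom V L U s) (local_hom V L U s')"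
      if "zopen U" "s \<in> V U" "s' \<in> V U" for U s s'
      using that by (auto simp: local_hom_def quot_add_def sections_add add coset_add
          intro!: restrict_ext)
    show "local_hom V L U (f *s s) = quot_scale V U f (local_hom V L U s)"
      if "zopen U" "f \<in> structure_sheaf U" "s \<in> V U" for U f s
      using that by (auto simp: local_hom_def quot_scale_def sections_scale scale coset_scale
          structure_sheaf_def intro!: restrict_ext)
    show "local_hom V L U' s = restrict (local_hom V L U s) U'"
      if "zopen U \<and> zopen U' \<and> U' \<subseteq> U" "s \<in> V U" for U U' s
      using that sections_restrict[of U U' s] by (auto simp: local_hom_def fun_eq_iff restrict_def)
  qed
  then show ?thesis
    by (simp add: tangent_space_def)
qed

lemma hom_eq_local_hom:
  assumes \<phi>: "\<phi> \<in> sheaf_homs V"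
    and eq: "\<And>U s q. zopen U \<Longrightarrow> s \<in> V U \<Longrightarrow> q \<in> U \<Longrightarrow> \<phi> U s q = L q s +o stalk V q"
  shows "\<phi> = local_hom V L"
proof (intro ext)
  fix U s q
  have PiE: "\<phi> \<in> (\<Pi>\<^sub>E U\<in>Collect zopen. V U \<rightarrow>\<^sub>E quot_sections V U)"
    using \<phi> by (simp add: sheaf_homs_def)
  consider "\<not> zopen U" | "zopen U" "s \<notin> V U" | "zopen U" "s \<in> V U" "q \<notin> U" | "zopen U" "s \<in> V U" "q \<in> U"
    by blast
  then show "\<phi> U s q = local_hom V L U s q"
  proof cases
    case 1
    then show ?thesis
      using PiE_arb[OF PiE] by (simp add: local_hom_def)
  next
    case 2
    then have "\<phi> U \<in> V U \<rightarrow>\<^sub>E quot_sections V U"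
      using PiE by auto
    then show ?thesis
      using PiE_arb 2 by (fastforce simp: local_hom_def)
  next
    case 3
    then have "\<phi> U s \<in> quot_sections V U"
      using PiE by auto
    then have "\<phi> U s \<in> (\<Pi>\<^sub>E p\<in>U. {e +o stalk V p | e. e \<in> stalk trivial_sheaf p})"
      unfolding quot_sections_def by blast
    from PiE_arb[OF this \<open>q \<notin> U\<close>] show ?thesis
      using 3 by (simp add: local_hom_def)
  next
    case 4
    then show ?thesis
      by (simp add: eq local_hom_apply)
  qed
qed

lemma local_family_lincomb:
  assumes "finite I" and "\<And>x. x \<in> I \<Longrightarrow> local_family V (L x)"
  shows "local_family V (\<lambda>p s. \<Sum>x\<in>I. cst (c x) *s L x p s)"
  unfolding local_family_def
proof (intro conjI allI ballI)
  fix p s s' f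
  show "(\<Sum>x\<in>I. cst (c x) *s L x p (s + s')) =
      (\<Sum>x\<in>I. cst (c x) *s L x p s) + (\<Sum>x\<in>I. cst (c x) *s L x p s')"
    using assms(2) by (simp add: local_family_def vector_add_ldistrib sum.distrib)
  show "(\<Sum>x\<in>I. cst (c x) *s L x p (f *s s)) = f *s (\<Sum>x\<in>I. cst (c x) *s L x p s)"
    using assms(2) by (simp add: local_family_def vec.scale_sum_right vector_smult_assoc mult.commute)
next
  fix p s assume s: "s \<in> stalk V p"
  show "regular_vec p (\<Sum>x\<in>I. cst (c x) *s L x p s)"
    using assms(2) s by (auto simp: local_family_def intro!: regular_vec_sum regular_vec_scale)
  have "(\<Sum>x\<in>I. cst (c x) *s L x q s) - (\<Sum>x\<in>I. cst (c x) *s L x p s) \<in> stalk V q"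
    if that: "\<And>x. x \<in> I \<Longrightarrow> L x q s - L x p s \<in> stalk V q" for q
  proof -
    have "(\<Sum>x\<in>I. cst (c x) *s L x q s) - (\<Sum>x\<in>I. cst (c x) *s L x p s)
        = (\<Sum>x\<in>I. cst (c x) *s (L x q s - L x p s))"
      by (simp only: sum_subtractf vec.scale_right_diff_distrib)
    also have "\<dots> \<in> stalk V q"
      by (intro stalk_sum stalk_scale regular_cst that)
    finally show ?thesis .
  qed
  then have "{q. (\<Sum>x\<in>I. cst (c x) *s L x q s) - (\<Sum>x\<in>I. cst (c x) *s L x p s) \<notin> stalk V q}
      \<subseteq> (\<Union>x\<in>I. {q. L x q s - L x p s \<notin> stalk V q})"
    by blast
  moreover have "finite (\<Union>x\<in>I. {q. L x q s - L x p s \<notin> stalk V q})"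
    using assms s by (auto simp: local_family_def)
  ultimately show "finite {q. (\<Sum>x\<in>I. cst (c x) *s L x q s) - (\<Sum>x\<in>I. cst (c x) *s L x p s) \<notin> stalk V q}"
    by (rule finite_subset)
qed

text \<open>
  Once every element of the tangent space is given by a local family, the algebraic structure of
  the tangent space is read off from the vectors \<open>L x p s\<close>.  In particular its addition is that of a
  commutative monoid, without which finite sums in it could not be evaluated.
\<close>
lemma tangent_basis:
  fixes L :: "'i \<Rightarrow> proj_line \<Rightarrow> ratfun ^ 'n \<Rightarrow> ratfun ^ 'n"
  assumes "finite I" and L: "\<And>x. x \<in> I \<Longrightarrow> local_family V (L x)"
    and indep: "\<And>c x. (\<And>p s. s \<in> stalk V p \<Longrightarrow> (\<Sum>x\<in>I. cst (c x) *s L x p s) \<in> stalk V p) \<Longrightarrow> x \<in> I \<Longrightarrow> c x = 0"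
    and span: "\<And>\<phi>. \<phi> \<in> sheaf_homs V \<Longrightarrow> \<exists>c. \<phi> = local_hom V (\<lambda>p s. \<Sum>x\<in>I. cst (c x) *s L x p s)"
  shows inj_on_tangent_basis: "inj_on (\<lambda>x. local_hom V (L x)) I"
    and finite_basis_tangent_basis: "finite_basis (tangent_space V) ((\<lambda>x. local_hom V (L x)) ` I)"
proof -
  define h where "h x = local_hom V (L x)" for x
  define lc where "lc c = (\<lambda>p s. \<Sum>x\<in>I. cst (c x) *s L x p s)" for c :: "'i \<Rightarrow> complex"
  have lc_diff: "lc c p s - lc c' p s = (\<Sum>x\<in>I. cst (c x - c' x) *s L x p s)" for c c' p s
    by (simp add: lc_def cst_diff vector_sub_rdistrib sum_subtractf)
  have lc_inj: "c x = c' x" if "local_hom V (lc c) = local_hom V (lc c')" "x \<in> I" for c c' x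
    using indep[of "\<lambda>x. c x - c' x" x] that unfolding local_hom_eq_iff lc_diff by auto
  have lc_unit: "lc (\<lambda>y. of_bool (y = x)) = L x" if "x \<in> I" for x
    using that \<open>finite I\<close>
    by (auto simp: lc_def fun_eq_iff of_bool_def if_distrib[of cst] if_distrib[of "\<lambda>a. a *s _"] cong: if_cong)
  have inj: "inj_on h I"
  proof (rule inj_onI)
    fix x y assume "x \<in> I" "y \<in> I" "h x = h y"
    then show "x = y"
      using lc_inj[of "\<lambda>z. of_bool (z = x)" "\<lambda>z. of_bool (z = y)" x]
      by (auto simp: lc_unit h_def)
  qed
  interpret abelian_monoid "tangent_space V"
  proof (rule abelian_monoidI)
    have carrier: "\<exists>L. local_family V L \<and> \<phi> = local_hom V L" if "\<phi> \<in> carrier (tangent_space V)" for \<phi>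
    proof -
      have "\<phi> \<in> sheaf_homs V"
        using that by (simp add: tangent_space_def)
      then obtain c where "\<phi> = local_hom V (\<lambda>p s. \<Sum>x\<in>I. cst (c x) *s L x p s)"
        using span by blast
      then show ?thesis
        using local_family_lincomb[of I L c] \<open>finite I\<close> L by blast
    qed
    have fam_add: "local_family V (\<lambda>p s. L p s + L' p s)" if "local_family V L" "local_family V L'" for L L'
      using local_family_lincomb[of "{False, True}" "\<lambda>b. if b then L else L'" "\<lambda>_. 1"] that
      by (simp add: add.commute)
    show "\<phi> \<oplus>\<^bsub>tangent_space V\<^esub> \<psi> \<in> carrier (tangent_space V)"
      if "\<phi> \<in> carrier (tangent_space V)" "\<psi> \<in> carrier (tangent_space V)" for \<phi> \<psi>
      using carrier[OF that(1)] carrier[OF that(2)]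
      by (auto simp: tangent_add intro!: local_hom_mem fam_add)
    show "\<zero>\<^bsub>tangent_space V\<^esub> \<in> carrier (tangent_space V)"
      unfolding tangent_zero by (rule local_hom_mem) (simp add: local_family_def stalk_0)
    show "(\<phi> \<oplus>\<^bsub>tangent_space V\<^esub> \<psi>) \<oplus>\<^bsub>tangent_space V\<^esub> \<xi> = \<phi> \<oplus>\<^bsub>tangent_space V\<^esub> (\<psi> \<oplus>\<^bsub>tangent_space V\<^esub> \<xi>)"
      if "\<phi> \<in> carrier (tangent_space V)" "\<psi> \<in> carrier (tangent_space V)" "\<xi> \<in> carrier (tangent_space V)"
      for \<phi> \<psi> \<xi>
      using carrier[OF that(1)] carrier[OF that(2)] carrier[OF that(3)]
      by (auto simp: tangent_add add.assoc)
    show "\<phi> \<oplus>\<^bsub>tangent_space V\<^esub> \<psi> = \<psi> \<oplus>\<^bsub>tangent_space V\<^esub> \<phi>"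
      if "\<phi> \<in> carrier (tangent_space V)" "\<psi> \<in> carrier (tangent_space V)" for \<phi> \<psi>
      using carrier[OF that(1)] carrier[OF that(2)] by (auto simp: tangent_add add.commute)
    show "\<zero>\<^bsub>tangent_space V\<^esub> \<oplus>\<^bsub>tangent_space V\<^esub> \<phi> = \<phi>" if "\<phi> \<in> carrier (tangent_space V)" for \<phi>
      using carrier[OF that] by (auto simp: tangent_add tangent_zero)
  qed
  have h_mem: "c x \<odot>\<^bsub>tangent_space V\<^esub> h x \<in> carrier (tangent_space V)" if "x \<in> I" for c :: "'i \<Rightarrow> complex" and x
    unfolding h_def tangent_smult
    using local_family_lincomb[of "{x}" L "\<lambda>_. c x"] L[OF that] by (auto intro: local_hom_mem)
  have finsum: "(\<Oplus>\<^bsub>tangent_space V\<^esub>x\<in>F. c x \<odot>\<^bsub>tangent_space V\<^esub> h x)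
      = local_hom V (\<lambda>p s. \<Sum>x\<in>F. cst (c x) *s L x p s)" if "F \<subseteq> I" for F c
  proof -
    have "finite F"
      using that \<open>finite I\<close> finite_subset by blast
    then show ?thesis
      using that
    proof induction
      case empty
      then show ?case
        by (simp add: tangent_zero)
    next
      case (insert x F)
      then have "(\<lambda>x. c x \<odot>\<^bsub>tangent_space V\<^esub> h x) \<in> F \<rightarrow> carrier (tangent_space V)"
        "c x \<odot>\<^bsub>tangent_space V\<^esub> h x \<in> carrier (tangent_space V)"
        using h_mem by auto
      then show ?case
        using insert by (simp add: tangent_smult tangent_add h_def)
    qed
  qed
  have finsum_image: "(\<Oplus>\<^bsub>tangent_space V\<^esub>b\<in>h ` I. c b \<odot>\<^bsub>tangent_space V\<^esub> b)
      = local_hom V (lc (\<lambda>x. c (h x)))" for c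
    using finsum[OF subset_refl, of "\<lambda>x. c (h x)"] h_mem inj
    by (subst finsum_reindex) (auto simp: lc_def)
  have "\<exists>!c. c \<in> h ` I \<rightarrow>\<^sub>E UNIV \<and> \<phi> = (\<Oplus>\<^bsub>tangent_space V\<^esub>b\<in>h ` I. c b \<odot>\<^bsub>tangent_space V\<^esub> b)"
    if "\<phi> \<in> carrier (tangent_space V)" for \<phi>
  proof (rule ex_ex1I)
    have "\<phi> \<in> sheaf_homs V"
      using that by (simp add: tangent_space_def)
    then obtain c where c: "\<phi> = local_hom V (lc c)"
      using span unfolding lc_def by blast
    have "lc (\<lambda>x. (\<lambda>b\<in>h ` I. c (inv_into I h b)) (h x)) = lc c"
      using inj by (auto simp: lc_def fun_eq_iff intro!: sum.cong)
    with c show "\<exists>c. c \<in> h ` I \<rightarrow>\<^sub>E UNIV \<and> \<phi> = (\<Oplus>\<^bsub>tangent_space V\<^esub>b\<in>h ` I. c b \<odot>\<^bsub>tangent_space V\<^esub> b)"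
      unfolding finsum_image by (intro exI[of _ "\<lambda>b\<in>h ` I. c (inv_into I h b)"]) auto
  next
    fix c c'
    assume 1: "c \<in> h ` I \<rightarrow>\<^sub>E UNIV \<and> \<phi> = (\<Oplus>\<^bsub>tangent_space V\<^esub>b\<in>h ` I. c b \<odot>\<^bsub>tangent_space V\<^esub> b)"
      and 2: "c' \<in> h ` I \<rightarrow>\<^sub>E UNIV \<and> \<phi> = (\<Oplus>\<^bsub>tangent_space V\<^esub>b\<in>h ` I. c' b \<odot>\<^bsub>tangent_space V\<^esub> b)"
    have "local_hom V (lc (\<lambda>x. c (h x))) = local_hom V (lc (\<lambda>x. c' (h x)))"
      using 1 2 by (simp only: finsum_image[symmetric])
    then have "c (h x) = c' (h x)" if "x \<in> I" for x
      using lc_inj[of "\<lambda>x. c (h x)" "\<lambda>x. c' (h x)"] that by blast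
    then show "c = c'"
      using conjunct1[OF 1] conjunct1[OF 2] by (intro PiE_ext[of c "h ` I" "\<lambda>_. UNIV" c']) auto
  qed
  moreover have "h ` I \<subseteq> carrier (tangent_space V)"
    using L by (auto simp: h_def intro: local_hom_mem)
  ultimately show "finite_basis (tangent_space V) ((\<lambda>x. local_hom V (L x)) ` I)"
    using \<open>finite I\<close> unfolding finite_basis_def h_def by simp
  show "inj_on (\<lambda>x. local_hom V (L x)) I"
    using inj by (simp add: h_def[abs_def])
qed

end

section \<open>Dual frames and charts\<close>

definition lin_form :: "complex ^ 'n \<Rightarrow> ratfun ^ 'n \<Rightarrow> ratfun" where
  "lin_form l s = (\<Sum>a\<in>UNIV. cst (l $ a) * s $ a)"

lemma lin_form_add: "lin_form l (s + s') = lin_form l s + lin_form l s'"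
  by (simp add: lin_form_def algebra_simps sum.distrib)

lemma lin_form_diff: "lin_form l (s - s') = lin_form l s - lin_form l s'"
  by (simp add: lin_form_def algebra_simps sum_subtractf)

lemma lin_form_0 [simp]: "lin_form l 0 = 0"
  by (simp add: lin_form_def)

lemma lin_form_scale: "lin_form l (f *s s) = f * lin_form l s"
  by (simp add: lin_form_def sum_distrib_left mult_ac)

lemma lin_form_sum: "lin_form l (sum f A) = (\<Sum>x\<in>A. lin_form l (f x))"
  by (induction A rule: infinite_finite_induct) (simp_all add: lin_form_add)

lemma lin_form_const_vec: "lin_form l (const_vec v) = cst (\<Sum>a\<in>UNIV. l $ a * v $ a)"
  by (simp add: lin_form_def const_vec_def cst_sum cst_mult flip: cst_def)

lemma regular_lin_form: "regular_vec p s \<Longrightarrow> regular_at p (lin_form l s)"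
  by (auto simp: lin_form_def regular_vec_def intro!: regular_sum regular_mult)

text \<open>
  The indices are the numbers from \<open>1\<close> to \<open>CARD('n)\<close> rather than the elements of \<open>'n\<close>, so that the
  first \<open>r\<close> of them can be reserved for the vectors spanning \<open>V\<close> generically.
\<close>
definition dual_frame :: "(nat \<Rightarrow> complex ^ 'n) \<Rightarrow> (nat \<Rightarrow> complex ^ 'n) \<Rightarrow> bool" where
  "dual_frame e l \<longleftrightarrow>
     (\<forall>i\<in>{1..CARD('n)}. \<forall>k\<in>{1..CARD('n)}. (\<Sum>a\<in>UNIV. l i $ a * e k $ a) = of_bool (i = k)) \<and>
     (\<forall>v. v = (\<Sum>i\<in>{1..CARD('n)}. (\<Sum>a\<in>UNIV. l i $ a * v $ a) *s e i))"

lemma ex_dual_frame: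
  fixes e :: "nat \<Rightarrow> complex ^ 'n::finite"
  assumes inj: "inj_on e {1..CARD('n)}" and indep: "vec.independent (e ` {1..CARD('n)})"
  shows "\<exists>l. dual_frame e l"
proof -
  define B where "B = e ` {1..CARD('n)}"
  have B: "finite B" "vec.independent B" "card B = CARD('n)"
    using assms by (simp_all add: B_def card_image)
  have span: "v \<in> vec.span B" for v
    using vec.card_ge_dim_independent[of B UNIV] B by (auto simp: vec_dim_card simp del: vec.dim_UNIV)
  define l where "l i = (\<chi> a. vec.representation B (axis a 1) (e i))" for i
  have l: "(\<Sum>a\<in>UNIV. l i $ a * v $ a) = vec.representation B v (e i)" for i v
  proof -
    have "vec.representation B v (e i) = vec.representation B (\<Sum>a\<in>UNIV. v $ a *s axis a 1) (e i)"
      by (simp add: basis_expansion)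
    also have "\<dots> = (\<Sum>a\<in>UNIV. v $ a * vec.representation B (axis a 1) (e i))"
      using B span by (simp add: vec.representation_sum vec.representation_scale)
    finally show ?thesis
      by (simp add: l_def mult.commute)
  qed
  have "dual_frame e l"
    unfolding dual_frame_def l
  proof (intro conjI ballI allI)
    fix i k assume ik: "i \<in> {1..CARD('n)}" "k \<in> {1..CARD('n)}"
    then have "e k \<in> B" "e i = e k \<longleftrightarrow> i = k"
      using inj_on_eq_iff[OF inj ik] by (auto simp: B_def)
    then show "vec.representation B (e k) (e i) = of_bool (i = k)"
      using vec.representation_basis[OF B(2), of "e k"] by (auto simp: eq_commute[of "e k"])
  next
    fix v
    have "v = (\<Sum>b\<in>B. vec.representation B v b *s b)"
      using vec.sum_representation_eq[OF B(2) span B(1) subset_refl] by simp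
    also have "\<dots> = (\<Sum>i\<in>{1..CARD('n)}. vec.representation B v (e i) *s e i)"
      unfolding B_def using inj by (simp add: sum.reindex)
    finally show "v = \<dots>" .
  qed
  then show ?thesis
    by blast
qed

lemma dual_frame_lin_form:
  fixes e l :: "nat \<Rightarrow> complex ^ 'n::finite"
  assumes "dual_frame e l" "i \<in> {1..CARD('n)}" "k \<in> {1..CARD('n)}"
  shows "lin_form (l i) (const_vec (e k)) = of_bool (i = k)"
  using assms by (auto simp: lin_form_const_vec dual_frame_def)

text \<open>
  The expansion of the constant unit vectors is a matrix identity over the complex numbers, and this
  identity also expands vectors of rational functions.
\<close>
lemma dual_frame_expansion:
  fixes e l :: "nat \<Rightarrow> complex ^ 'n::finite"
  assumes "dual_frame e l"
  shows "s = (\<Sum>i\<in>{1..CARD('n)}. lin_form (l i) s *s const_vec (e i))"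
proof -
  have ax: "(\<Sum>i\<in>{1..CARD('n)}. l i $ a * e i $ b) = of_bool (a = b)" for a b
  proof -
    have "axis a 1 = (\<Sum>i\<in>{1..CARD('n)}. (\<Sum>b\<in>UNIV. l i $ b * axis a 1 $ b) *s e i)"
      using assms unfolding dual_frame_def by blast
    also have "\<dots> = (\<Sum>i\<in>{1..CARD('n)}. l i $ a *s e i)"
      by (simp add: axis_def if_distrib cong: if_cong)
    finally have "axis a 1 $ b = (\<Sum>i\<in>{1..CARD('n)}. l i $ a *s e i) $ b"
      by simp
    then show ?thesis
      by (cases "a = b") (simp_all add: axis_def)
  qed
  have "(\<Sum>i\<in>{1..CARD('n)}. lin_form (l i) s *s const_vec (e i)) $ b = s $ b" for b
  proof -
    have "(\<Sum>i\<in>{1..CARD('n)}. lin_form (l i) s *s const_vec (e i)) $ b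
        = (\<Sum>i\<in>{1..CARD('n)}. \<Sum>a\<in>UNIV. s $ a * cst (l i $ a * e i $ b))"
      by (simp add: sum_component lin_form_def const_vec_def sum_distrib_left cst_mult mult_ac flip: cst_def)
    also have "\<dots> = (\<Sum>a\<in>UNIV. s $ a * cst (\<Sum>i\<in>{1..CARD('n)}. l i $ a * e i $ b))"
      by (subst sum.swap) (simp add: cst_sum sum_distrib_left)
    also have "\<dots> = s $ b"
      unfolding ax by (simp add: of_bool_def if_distrib cong: if_cong)
    finally show ?thesis .
  qed
  then show ?thesis
    by (simp add: vec_eq_iff)
qed

lemma lin_span_imageE:
  assumes m: "m \<in> lin_span R (b ` I)" and "finite I" "0 \<in> R"
  obtains c where "\<And>i. i \<in> I \<Longrightarrow> c i \<in> R" "m = (\<Sum>i\<in>I. c i *s b i)"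
proof -
  obtain F c where F: "finite F" "F \<subseteq> b ` I" "c ` F \<subseteq> R" "m = (\<Sum>x\<in>F. c x *s x)"
    using m by (auto simp: lin_span_def)
  define g where "g = inv_into I b"
  have g: "g x \<in> I" "b (g x) = x" if "x \<in> F" for x
    using that F(2) by (auto simp: g_def inv_into_into f_inv_into_f)
  then have "inj_on g F"
    by (metis inj_onI)
  define c' where "c' i = (if i \<in> g ` F then c (b i) else 0)" for i
  have "(\<Sum>i\<in>I. c' i *s b i) = (\<Sum>i\<in>g ` F. c' i *s b i)"
    using \<open>finite I\<close> g by (intro sum.mono_neutral_right) (auto simp: c'_def)
  also have "\<dots> = m"
    using g by (simp add: sum.reindex[OF \<open>inj_on g F\<close>] c'_def F(4))
  finally have "m = (\<Sum>i\<in>I. c' i *s b i)" ..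
  moreover have "c' i \<in> R" if "i \<in> I" for i
    using that F(3) g \<open>0 \<in> R\<close> by (auto simp: c'_def)
  ultimately show ?thesis
    using that by blast
qed

context rational_subsheaf
begin

lemma hom_coset:
  assumes "\<phi> \<in> sheaf_homs V" "zopen U" "s \<in> V U" "q \<in> U"
  obtains e where "regular_vec q e" "\<phi> U s q = e +o stalk V q"
proof -
  have "\<phi> U s \<in> quot_sections V U"
    using assms by (auto simp: sheaf_homs_def PiE_def Pi_def)
  then have "\<phi> U s q \<in> {e +o stalk V q | e. e \<in> stalk trivial_sheaf q}"
    using \<open>q \<in> U\<close> unfolding quot_sections_def by blast
  then show ?thesis
    using that by (auto simp: stalk_trivial_sheaf)
qed

lemma hom_restrict:
  assumes "\<phi> \<in> sheaf_homs V" "zopen U" "zopen U'" "U' \<subseteq> U" "s \<in> V U" "q \<in> U'"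
  shows "\<phi> U' s q = \<phi> U s q"
proof -
  have "\<phi> U' s = restrict (\<phi> U s) U'"
    using assms unfolding sheaf_homs_def by blast
  then show ?thesis
    using assms by simp
qed

lemma hom_add:
  assumes "\<phi> \<in> sheaf_homs V" "zopen U" "s \<in> V U" "s' \<in> V U" "q \<in> U"
  shows "\<phi> U (s + s') q = \<phi> U s q + \<phi> U s' q"
proof -
  have "\<phi> U (s + s') = quot_add U (\<phi> U s) (\<phi> U s')"
    using assms unfolding sheaf_homs_def by blast
  then show ?thesis
    using assms by (simp add: quot_add_def)
qed

lemma hom_scale:
  assumes "\<phi> \<in> sheaf_homs V" "zopen U" "f \<in> structure_sheaf U" "s \<in> V U" "q \<in> U"
    and "\<phi> U s q = e +o stalk V q"
  shows "\<phi> U (f *s s) q = (f *s e) +o stalk V q"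
proof -
  have "\<phi> U (f *s s) = quot_scale V U f (\<phi> U s)"
    using assms unfolding sheaf_homs_def by blast
  then show ?thesis
    using assms by (simp add: quot_scale_def coset_scale structure_sheaf_def)
qed

lemma hom_lincomb:
  assumes \<phi>: "\<phi> \<in> sheaf_homs V" and U: "zopen U" "q \<in> U" and "finite F"
    and "\<And>i. i \<in> F \<Longrightarrow> f i \<in> structure_sheaf U" "\<And>i. i \<in> F \<Longrightarrow> b i \<in> V U"
    and "\<And>i. i \<in> F \<Longrightarrow> \<phi> U (b i) q = e i +o stalk V q"
  shows "\<phi> U (\<Sum>i\<in>F. f i *s b i) q = (\<Sum>i\<in>F. f i *s e i) +o stalk V q"
  using assms(4-7)
proof (induction F)
  case empty
  obtain e where "\<phi> U 0 q = e +o stalk V q"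
    using hom_coset[OF \<phi> U(1) sections_0[OF U(1)] U(2)] by blast
  from hom_scale[OF \<phi> U(1) _ sections_0[OF U(1)] U(2) this, of 0] show ?case
    by (simp add: structure_sheaf_def)
next
  case (insert i F)
  have "\<phi> U (f i *s b i + (\<Sum>i\<in>F. f i *s b i)) q
      = \<phi> U (f i *s b i) q + \<phi> U (\<Sum>i\<in>F. f i *s b i) q"
    using insert by (intro hom_add[OF \<phi> U(1)] sections_scale sections_sum U) auto
  also have "\<phi> U (f i *s b i) q = (f i *s e i) +o stalk V q"
    using insert by (intro hom_scale[OF \<phi> U(1)] U) auto
  finally show ?case
    using insert by (simp add: coset_add)
qed

text \<open>Any two local representatives are compared on the intersection of their domains.\<close>
lemma quot_section_lin_form:
  assumes kill: "\<And>q s. s \<in> stalk V q \<Longrightarrow> lin_form l s = 0"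
    and \<sigma>: "\<sigma> \<in> quot_sections V U" and "zopen U"
  obtains f where "\<And>q e. q \<in> U \<Longrightarrow> \<sigma> q = e +o stalk V q \<Longrightarrow> lin_form l e = f"
proof -
  have eq: "lin_form l e = lin_form l e'" if "e +o stalk V q = e' +o stalk V q" for e e' q
    using that kill[of "e - e'" q] by (simp add: coset_eq_iff lin_form_diff)
  have loc: "\<exists>U' e. zopen U' \<and> q \<in> U' \<and> (\<forall>q\<in>U'. \<sigma> q = e +o stalk V q)" if "q \<in> U" for q
    using \<sigma> that unfolding quot_sections_def by blast
  obtain q0 where "q0 \<in> U"
    using zopen_nonempty[OF \<open>zopen U\<close>] by blast
  then obtain U0 e0 where 0: "zopen U0" "\<And>q. q \<in> U0 \<Longrightarrow> \<sigma> q = e0 +o stalk V q"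
    using loc by blast
  have "lin_form l e = lin_form l e0" if "q \<in> U" "\<sigma> q = e +o stalk V q" for q e
  proof -
    obtain U1 e1 where 1: "zopen U1" "q \<in> U1" "\<And>q. q \<in> U1 \<Longrightarrow> \<sigma> q = e1 +o stalk V q"
      using loc[OF \<open>q \<in> U\<close>] by blast
    obtain q1 where "q1 \<in> U0" "q1 \<in> U1"
      using zopen_nonempty[OF zopen_Int[OF 0(1) 1(1)]] by blast
    then have "lin_form l e1 = lin_form l e0"
      using 0(2) 1(3) eq by metis
    moreover have "lin_form l e = lin_form l e1"
      using that 1(2,3) eq by metis
    ultimately show ?thesis
      by simp
  qed
  then show ?thesis
    using that by blast
qed

end

text \<open>
  An affine chart \<open>A\<close> around \<open>p\<close> on which \<open>V\<close> is free: the generators are the first \<open>r\<close> vectors of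
  a constant frame of the trivial bundle, multiplied by powers of a uniformizer at \<open>p\<close> that is
  invertible on the rest of \<open>A\<close>.
\<close>
locale chart = rational_subsheaf V for V :: "'n::finite presheaf" +
  fixes A :: "proj_line set" and p :: proj_line and \<theta> :: ratfun and r :: nat
    and a :: "nat \<Rightarrow> nat" and e l :: "nat \<Rightarrow> complex ^ 'n"
  assumes zopen_A: "zopen A" and p_mem: "p \<in> A"
    and uniformizer: "uniformizer p \<theta>"
    and regular_A: "q \<in> A \<Longrightarrow> regular_at q \<theta>"
    and regular_inverse: "q \<in> A \<Longrightarrow> q \<noteq> p \<Longrightarrow> regular_at q (inverse \<theta>)"
    and assoc: "associated_on V A (lin_span (structure_sheaf A) ((\<lambda>i. \<theta> ^ a i *s const_vec (e i)) ` {1..r}))"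
    and frame: "dual_frame e l" and r_le: "r \<le> CARD('n)"
begin

definition gen :: "nat \<Rightarrow> ratfun ^ 'n" where
  "gen i = \<theta> ^ a i *s const_vec (e i)"

lemma theta_nonzero [simp]: "\<theta> \<noteq> 0"
  by (rule uniformizer_nonzero[OF uniformizer])

lemma lin_form_frame: "i \<in> {1..CARD('n)} \<Longrightarrow> k \<in> {1..CARD('n)} \<Longrightarrow>
    lin_form (l i) (const_vec (e k)) = of_bool (i = k)"
  using dual_frame_lin_form[OF frame] .

lemma lin_form_gen: "i \<in> {1..CARD('n)} \<Longrightarrow> k \<in> {1..r} \<Longrightarrow>
    lin_form (l i) (gen k) = (if i = k then \<theta> ^ a i else 0)"
  using r_le by (auto simp: gen_def lin_form_scale lin_form_frame)

lemma regular_powi: "q \<in> A \<Longrightarrow> q \<noteq> p \<Longrightarrow> regular_at q (\<theta> powi k)"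
  by (auto simp: power_int_def regular_A regular_inverse intro: regular_power)

lemma regular_powi_nonneg: "q \<in> A \<Longrightarrow> k \<ge> 0 \<Longrightarrow> regular_at q (\<theta> powi k)"
  by (auto simp: power_int_def regular_A intro: regular_power)

lemma gen_mem:
  assumes i: "i \<in> {1..r}"
  shows "gen i \<in> V A"
proof -
  let ?M = "lin_span (structure_sheaf A) ((\<lambda>i. \<theta> ^ a i *s const_vec (e i)) ` {1..r})"
  have "(\<Sum>x\<in>{gen i}. 1 *s x) \<in> ?M"
    unfolding lin_span_def using i
    by (intro CollectI exI[of _ "{gen i}"] exI[of _ "\<lambda>_. 1"]) (auto simp: gen_def structure_sheaf_def)
  then have "gen i \<in> ?M"
    by simp
  moreover have "1 \<in> structure_sheaf A" "\<And>q. regular_at q (inverse 1)" "gen i = inverse 1 *s gen i"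
    by (simp_all add: structure_sheaf_def)
  ultimately have "\<forall>q\<in>A. \<exists>m\<in>?M. \<exists>g\<in>structure_sheaf A.
      g \<noteq> 0 \<and> regular_at q (inverse g) \<and> gen i = inverse g *s m"
    using one_neq_zero by blast
  then show ?thesis
    using assoc zopen_A unfolding associated_on_def by blast
qed

lemma const_vec_mem:
  assumes i: "i \<in> {1..r}"
  shows "const_vec (e i) \<in> V (A - {p})"
proof -
  have op: "zopen (A - {p})"
    using zopen_A by (simp add: zopen_iff_cofinite Compl_Diff_eq)
  have "\<theta> powi (- int (a i)) *s gen i \<in> V (A - {p})"
    using sections_restrict[OF zopen_A op _ gen_mem[OF i]]
    by (intro sections_scale op) (auto simp: structure_sheaf_def regular_powi)
  then show ?thesis
    by (simp add: gen_def vector_smult_assoc power_int_minus)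
qed

lemma const_vec_stalk: "i \<in> {1..r} \<Longrightarrow> q \<in> A \<Longrightarrow> q \<noteq> p \<Longrightarrow> const_vec (e i) \<in> stalk V q"
  using zopen_A by (intro stalkI[OF _ _ const_vec_mem]) (auto simp: zopen_iff_cofinite Compl_Diff_eq)

lemma gen_stalk: "i \<in> {1..r} \<Longrightarrow> q \<in> A \<Longrightarrow> gen i \<in> stalk V q"
  using gen_mem zopen_A stalkI by blast

lemma expansion:
  assumes "\<And>j. j \<in> {r+1..CARD('n)} \<Longrightarrow> lin_form (l j) s = 0"
  shows "s = (\<Sum>i\<in>{1..r}. lin_form (l i) s *s const_vec (e i))"
proof -
  have "s = (\<Sum>i\<in>{1..CARD('n)}. lin_form (l i) s *s const_vec (e i))"
    by (rule dual_frame_expansion[OF frame])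
  also have "\<dots> = (\<Sum>i\<in>{1..r}. lin_form (l i) s *s const_vec (e i))"
    using r_le assms by (intro sum.mono_neutral_right) auto
  finally show ?thesis .
qed

lemma expansion_gen:
  assumes "\<And>j. j \<in> {r+1..CARD('n)} \<Longrightarrow> lin_form (l j) s = 0"
  shows "s = (\<Sum>i\<in>{1..r}. (\<theta> powi (- int (a i)) * lin_form (l i) s) *s gen i)"
proof -
  have "(\<theta> powi (- int (a i)) * lin_form (l i) s) *s gen i = lin_form (l i) s *s const_vec (e i)" for i
    by (simp add: gen_def vector_smult_assoc power_int_minus)
  then show ?thesis
    using expansion[OF assms] by simp
qed

text \<open>
  Being in the stalk is decided by coordinates in the frame: the local sections are fractions of
  combinations of the generators, and the generators are multiples of distinct frame vectors.
\<close>
lemma stalk_iff: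
  assumes q: "q \<in> A"
  shows "s \<in> stalk V q \<longleftrightarrow>
    (\<forall>i\<in>{1..r}. regular_at q (\<theta> powi (- int (a i)) * lin_form (l i) s)) \<and>
    (\<forall>j\<in>{r+1..CARD('n)}. lin_form (l j) s = 0)"
proof
  assume "s \<in> stalk V q"
  then obtain U where U: "zopen U" "q \<in> U" "s \<in> V U"
    by (rule stalkE)
  then have UA: "zopen (U \<inter> A)" "q \<in> U \<inter> A" "s \<in> V (U \<inter> A)"
    using q zopen_A sections_restrict[OF U(1) zopen_Int[OF U(1) zopen_A] _ U(3)] by (auto intro: zopen_Int)
  then obtain m g where mg: "m \<in> lin_span (structure_sheaf A) ((\<lambda>i. \<theta> ^ a i *s const_vec (e i)) ` {1..r})"
    "regular_at q (inverse g)" "s = inverse g *s m"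
    using assoc unfolding associated_on_def by blast
  obtain c where c: "\<And>i. i \<in> {1..r} \<Longrightarrow> c i \<in> structure_sheaf A"
    "m = (\<Sum>i\<in>{1..r}. c i *s (\<theta> ^ a i *s const_vec (e i)))"
    by (rule lin_span_imageE[OF mg(1)]) (auto simp: structure_sheaf_def)
  have form: "lin_form (l i) s = (if i \<le> r then inverse g * (c i * \<theta> ^ a i) else 0)"
    if "i \<in> {1..CARD('n)}" for i
  proof -
    have "lin_form (l i) m = (\<Sum>k\<in>{1..r}. c k * (if i = k then \<theta> ^ a i else 0))"
      unfolding c(2) lin_form_sum lin_form_scale[of _ "c _"] gen_def[symmetric]
      using that by (intro sum.cong) (simp_all add: lin_form_gen)
    also have "\<dots> = (if i \<le> r then c i * \<theta> ^ a i else 0)"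
      using that by (simp add: if_distrib cong: if_cong)
    finally show ?thesis
      by (simp add: mg(3) lin_form_scale)
  qed
  show "(\<forall>i\<in>{1..r}. regular_at q (\<theta> powi (- int (a i)) * lin_form (l i) s)) \<and>
    (\<forall>j\<in>{r+1..CARD('n)}. lin_form (l j) s = 0)"
  proof (intro conjI ballI)
    fix i assume i: "i \<in> {1..r}"
    have "\<theta> powi (- int (a i)) * lin_form (l i) s = inverse g * c i"
      using i r_le form[of i] by (simp add: power_int_minus)
    then show "regular_at q (\<theta> powi (- int (a i)) * lin_form (l i) s)"
      using c(1)[OF i] mg(2) q by (simp add: structure_sheaf_def regular_mult)
  qed (simp add: form)
next
  assume *: "(\<forall>i\<in>{1..r}. regular_at q (\<theta> powi (- int (a i)) * lin_form (l i) s)) \<and>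
    (\<forall>j\<in>{r+1..CARD('n)}. lin_form (l j) s = 0)"
  then have "(\<Sum>i\<in>{1..r}. (\<theta> powi (- int (a i)) * lin_form (l i) s) *s gen i) \<in> stalk V q"
    using q by (intro stalk_sum stalk_scale gen_stalk) auto
  moreover have "s = (\<Sum>i\<in>{1..r}. (\<theta> powi (- int (a i)) * lin_form (l i) s) *s gen i)"
    using * by (intro expansion_gen) blast
  ultimately show "s \<in> stalk V q"
    by simp
qed

lemma stalk_iff_off_p:
  assumes "q \<in> A" "q \<noteq> p"
  shows "s \<in> stalk V q \<longleftrightarrow> regular_vec q s \<and> (\<forall>j\<in>{r+1..CARD('n)}. lin_form (l j) s = 0)"
  using stalk_iff[OF assms(1), of s] stalk_regular[of s q] regular_lin_form[of q s] regular_powi[OF assms]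
  by (auto intro: regular_mult)

lemma lin_form_section_eq_0:
  assumes "zopen U" "s \<in> V U" "j \<in> {r+1..CARD('n)}"
  shows "lin_form (l j) s = 0"
proof -
  obtain q where "q \<in> U" "q \<in> A"
    using zopen_nonempty[OF zopen_Int[OF assms(1) zopen_A]] by blast
  then show ?thesis
    using stalk_iff[of q s] stalkI[of U q s] assms by blast
qed

lemma lin_form_stalk_eq_0: "s \<in> stalk V q \<Longrightarrow> j \<in> {r+1..CARD('n)} \<Longrightarrow> lin_form (l j) s = 0"
  by (meson lin_form_section_eq_0 stalkE)

text \<open>
  A morphism is determined near \<open>q\<close> by the images of the generators: after shrinking \<open>U\<close> the
  coefficients of \<open>s\<close> with respect to the generators are regular.
\<close>
lemma hom_eval:
  assumes \<phi>: "\<phi> \<in> sheaf_homs V" and U: "zopen U" "s \<in> V U" "q \<in> U" and q: "q \<in> A"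
    and b: "\<And>i. i \<in> {1..r} \<Longrightarrow> \<phi> A (gen i) q = b i +o stalk V q"
  shows "\<phi> U s q = (\<Sum>i\<in>{1..r}. (\<theta> powi (- int (a i)) * lin_form (l i) s) *s b i) +o stalk V q"
proof -
  define f where "f i = \<theta> powi (- int (a i)) * lin_form (l i) s" for i
  define U' where "U' = U \<inter> A \<inter> {q. \<forall>i\<in>{1..r}. regular_at q (f i)}"
  have "- {q. \<forall>i\<in>{1..r}. regular_at q (f i)} = (\<Union>i\<in>{1..r}. {q. \<not> regular_at q (f i)})"
    by auto
  then have "zopen {q. \<forall>i\<in>{1..r}. regular_at q (f i)}"
    using finite_poles by (simp add: zopen_iff_cofinite)
  then have U': "zopen U'" "U' \<subseteq> U" "U' \<subseteq> A"
    unfolding U'_def using U zopen_A by (auto intro!: zopen_Int)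
  have "q \<in> U'"
    using stalk_iff[OF q, of s] stalkI[OF U(1,3,2)] U q unfolding U'_def f_def by blast
  have gen: "gen i \<in> V U'" "\<phi> U' (gen i) q = b i +o stalk V q" if "i \<in> {1..r}" for i
    using sections_restrict[OF zopen_A U'(1,3) gen_mem[OF that]]
      hom_restrict[OF \<phi> zopen_A U'(1,3) gen_mem[OF that] \<open>q \<in> U'\<close>] b[OF that] by simp_all
  have s_eq: "s = (\<Sum>i\<in>{1..r}. f i *s gen i)"
    unfolding f_def by (rule expansion_gen) (rule lin_form_section_eq_0[OF U(1,2)])
  have "\<phi> U' (\<Sum>i\<in>{1..r}. f i *s gen i) q = (\<Sum>i\<in>{1..r}. f i *s b i) +o stalk V q"
    using gen by (intro hom_lincomb[OF \<phi> U'(1) \<open>q \<in> U'\<close>]) (auto simp: structure_sheaf_def U'_def)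
  then have "\<phi> U' s q = (\<Sum>i\<in>{1..r}. f i *s b i) +o stalk V q"
    by (simp only: s_eq[symmetric])
  then show ?thesis
    using hom_restrict[OF \<phi> U(1) U'(1,2) U(2) \<open>q \<in> U'\<close>] by (simp add: f_def)
qed

text \<open>
  A form that vanishes on \<open>V\<close> turns a morphism to the quotient sheaf into a morphism to the
  structure sheaf, which is linear over the field of rational functions at the generic point.
\<close>
lemma hom_lin_form:
  assumes \<phi>: "\<phi> \<in> sheaf_homs V" and kill: "\<And>q s. s \<in> stalk V q \<Longrightarrow> lin_form l0 s = 0"
  obtains F where "\<And>U s q b. zopen U \<Longrightarrow> s \<in> V U \<Longrightarrow> q \<in> U \<Longrightarrow> \<phi> U s q = b +o stalk V q \<Longrightarrow>
      lin_form l0 b = (\<Sum>i\<in>{1..r}. lin_form (l i) s * F i)"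
    and "\<And>i q. i \<in> {1..r} \<Longrightarrow> q \<in> A \<Longrightarrow> q \<noteq> p \<Longrightarrow> regular_at q (F i)"
    and "\<And>i. i \<in> {1..r} \<Longrightarrow> regular_at p (\<theta> ^ a i * F i)"
proof -
  have "\<exists>f. \<forall>q\<in>U. \<forall>b. \<phi> U s q = b +o stalk V q \<longrightarrow> lin_form l0 b = f" if "zopen U" "s \<in> V U" for U s
  proof -
    have "\<phi> U s \<in> quot_sections V U"
      using \<phi> that by (auto simp: sheaf_homs_def PiE_def Pi_def)
    then show ?thesis
      using quot_section_lin_form[of l0 "\<phi> U s" U] kill \<open>zopen U\<close> by metis
  qed
  then obtain f where f: "\<And>U s q b. zopen U \<Longrightarrow> s \<in> V U \<Longrightarrow> q \<in> U \<Longrightarrow> \<phi> U s q = b +o stalk V q \<Longrightarrow>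
      lin_form l0 b = f U s"
    by metis
  define F where "F i = \<theta> powi (- int (a i)) * f A (gen i)" for i
  have lin: "lin_form l0 b = (\<Sum>i\<in>{1..r}. lin_form (l i) s * F i)"
    if U: "zopen U" "s \<in> V U" and q: "q \<in> U" "\<phi> U s q = b +o stalk V q" for U s q b
  proof -
    obtain q1 where q1: "q1 \<in> U" "q1 \<in> A"
      using zopen_nonempty[OF zopen_Int[OF U(1) zopen_A]] by blast
    have "\<exists>b. \<phi> A (gen i) q1 = b +o stalk V q1" if "i \<in> {1..r}" for i
      using hom_coset[OF \<phi> zopen_A gen_mem[OF that] q1(2)] by metis
    then obtain b1 where b1: "\<And>i. i \<in> {1..r} \<Longrightarrow> \<phi> A (gen i) q1 = b1 i +o stalk V q1"
      by metis
    have "lin_form l0 b = f U s"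
      using f[OF U q] .
    also have "f U s = lin_form l0 (\<Sum>i\<in>{1..r}. (\<theta> powi (- int (a i)) * lin_form (l i) s) *s b1 i)"
      using f[OF U q1(1) hom_eval[OF \<phi> U q1 b1]] by simp
    also have "\<dots> = (\<Sum>i\<in>{1..r}. lin_form (l i) s * F i)"
      unfolding lin_form_sum
    proof (intro sum.cong refl)
      fix i assume i: "i \<in> {1..r}"
      have "lin_form l0 (b1 i) = f A (gen i)"
        by (rule f[OF zopen_A gen_mem[OF i] q1(2) b1[OF i]])
      then show "lin_form l0 ((\<theta> powi (- int (a i)) * lin_form (l i) s) *s b1 i) = lin_form (l i) s * F i"
        by (simp add: F_def lin_form_scale)
    qed
    finally show ?thesis .
  qed
  have reg: "regular_at q (\<Sum>k\<in>{1..r}. lin_form (l k) s * F k)" if "zopen U" "s \<in> V U" "q \<in> U" for U s q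
    using hom_coset[OF \<phi> that] lin[OF that] regular_lin_form by metis
  show thesis
  proof
    fix i assume i: "i \<in> {1..r}"
    have *: "(\<Sum>k\<in>{1..r}. (if k = i then g else 0) * F k) = g * F i" for g
      using i by (simp add: if_distrib[of "\<lambda>x. x * _"] cong: if_cong)
    have "(\<Sum>k\<in>{1..r}. lin_form (l k) (gen i) * F k) = (\<Sum>k\<in>{1..r}. (if k = i then \<theta> ^ a i else 0) * F k)"
      using i r_le by (intro sum.cong) (auto simp: lin_form_gen)
    with reg[OF zopen_A gen_mem[OF i] p_mem] show "regular_at p (\<theta> ^ a i * F i)"
      by (simp only: *)
    fix q assume q: "q \<in> A" "q \<noteq> p"
    have "(\<Sum>k\<in>{1..r}. lin_form (l k) (const_vec (e i)) * F k) = (\<Sum>k\<in>{1..r}. (if k = i then 1 else 0) * F k)"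
      using i r_le by (intro sum.cong) (auto simp: lin_form_frame)
    moreover have "zopen (A - {p})"
      using zopen_A by (simp add: zopen_iff_cofinite Compl_Diff_eq)
    ultimately show "regular_at q (F i)"
      using reg[OF _ const_vec_mem[OF i], of q] q by (simp only: * mult_1 Diff_iff singleton_iff simp_thms)
  qed (fact lin)
qed

end

section \<open>The circle action on morphisms\<close>

lemma act_sec_add: "t \<noteq> 0 \<Longrightarrow> act_sec t (s + s') = act_sec t s + act_sec t s'"
  by (simp add: act_sec_def vec_eq_iff act_fun_add)

lemma act_sec_scale: "t \<noteq> 0 \<Longrightarrow> act_sec t (f *s s) = act_fun t f *s act_sec t s"
  by (simp add: act_sec_def vec_eq_iff act_fun_mult)

lemma act_sec_0: "t \<noteq> 0 \<Longrightarrow> act_sec t 0 = 0"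
  by (simp add: act_sec_def vec_eq_iff act_fun_0)

lemma act_sec_const_vec: "t \<noteq> 0 \<Longrightarrow> act_sec t (const_vec v) = const_vec v"
  by (simp add: act_sec_def vec_eq_iff const_vec_def act_fun_cst flip: cst_def)

lemma act_sec_act_sec_inverse: "t \<noteq> 0 \<Longrightarrow> act_sec t (act_sec (inverse t) s) = s"
  by (simp add: act_sec_def vec_eq_iff act_fun_act_fun_inverse)

lemma lin_form_act_sec: "t \<noteq> 0 \<Longrightarrow> lin_form l (act_sec t s) = act_fun t (lin_form l s)"
  by (simp add: lin_form_def act_sec_def act_fun_sum act_fun_mult act_fun_cst)

lemma act_point_act_point_inverse: "t \<noteq> 0 \<Longrightarrow> act_point t (act_point (inverse t) p) = p"
  by (cases p) auto

lemma zopen_act_point: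
  assumes "t \<noteq> 0" "zopen U"
  shows "zopen (act_point t ` U)"
proof -
  have "- (act_point t ` U) \<subseteq> act_point t ` (- U)"
  proof
    fix p assume "p \<in> - (act_point t ` U)"
    moreover have "p = act_point t (act_point (inverse t) p)"
      using assms by (simp add: act_point_act_point_inverse)
    ultimately show "p \<in> act_point t ` (- U)"
      by blast
  qed
  then show ?thesis
    using assms(2) finite_subset by (auto simp: zopen_iff_cofinite)
qed

context rational_subsheaf
begin

lemma act_sec_stalk:
  assumes "circle_fixed V" "cmod t = 1" "s \<in> stalk V p"
  shows "act_sec t s \<in> stalk V (act_point t p)"
proof -
  obtain U where U: "zopen U" "p \<in> U" "s \<in> V U"
    using assms(3) by (rule stalkE)
  have "t \<noteq> 0"
    using assms(2) by auto
  then show ?thesis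
    using U assms(1,2) zopen_act_point[of t U]
    by (intro stalkI[of "act_point t ` U"]) (auto simp: circle_fixed_def)
qed

text \<open>
  Since \<open>V\<close> is invariant, translation by \<open>t\<close> carries the stalk at \<open>p / t\<close> onto the stalk at \<open>p\<close>, so
  conjugating a morphism amounts to conjugating the maps that represent it.
\<close>
lemma act_hom_local_hom:
  assumes fixed: "circle_fixed V" and t: "cmod t = 1"
  shows "act_hom V t (local_hom V L) =
    local_hom V (\<lambda>p s. act_sec t (L (act_point (inverse t) p) (act_sec (inverse t) s)))"
proof -
  have t0: "t \<noteq> 0" "inverse t \<noteq> 0" "cmod (inverse t) = 1"
    using t by (auto simp: norm_inverse)
  have coset: "act_sec t ` (v +o stalk V (act_point (inverse t) p)) = act_sec t v +o stalk V p" for v p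
  proof (intro equalityI subsetI)
    fix x assume "x \<in> act_sec t ` (v +o stalk V (act_point (inverse t) p))"
    then obtain s where s: "s \<in> stalk V (act_point (inverse t) p)" "x = act_sec t v + act_sec t s"
      using t0 by (auto simp: elt_set_plus_def act_sec_add)
    then show "x \<in> act_sec t v +o stalk V p"
      using act_sec_stalk[OF fixed t s(1)] t0 by (auto simp: act_point_act_point_inverse)
  next
    fix x assume "x \<in> act_sec t v +o stalk V p"
    then obtain s where s: "s \<in> stalk V p" "x = act_sec t v + s"
      by (auto simp: elt_set_plus_def)
    then have "x = act_sec t (v + act_sec (inverse t) s)"
      using t0 by (simp add: act_sec_add act_sec_act_sec_inverse)
    moreover have "v + act_sec (inverse t) s \<in> v +o stalk V (act_point (inverse t) p)"
      using act_sec_stalk[OF fixed t0(3) s(1)] by auto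
    ultimately show "x \<in> act_sec t ` (v +o stalk V (act_point (inverse t) p))"
      by blast
  qed
  have "act_quot t U (local_hom V L (act_point (inverse t) ` U) (act_sec (inverse t) s))
      = (\<lambda>p\<in>U. act_sec t (L (act_point (inverse t) p) (act_sec (inverse t) s)) +o stalk V p)"
    if U: "zopen U" "s \<in> V U" for U s
  proof -
    have "act_sec (inverse t) s \<in> V (act_point (inverse t) ` U)"
      using fixed t0(3) U unfolding circle_fixed_def by blast
    then have "local_hom V L (act_point (inverse t) ` U) (act_sec (inverse t) s) (act_point (inverse t) p)
        = L (act_point (inverse t) p) (act_sec (inverse t) s) +o stalk V (act_point (inverse t) p)"
      if "p \<in> U" for p
      using that by (intro local_hom_apply zopen_act_point U t0) auto
    then show ?thesis
      unfolding act_quot_def by (intro restrict_ext) (simp add: coset)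
  qed
  then show ?thesis
    by (auto simp: act_hom_def local_hom_def intro!: restrict_ext)
qed

end


section \<open>A basis of weight vectors\<close>

text \<open>
  The triples are \<open>(i, j, k)\<close>: a generator \<open>i\<close> of \<open>V\<close> is sent in the direction of the frame vector
  \<open>j\<close>, and \<open>k\<close> fixes the power of the coordinate.  The first two families take values in the torsion
  part of the quotient.  The other two take values in its free part, and have a pole at \<open>0\<close> or at
  \<open>\<infinity>\<close> as maps on constant vectors; the constant ones are counted with the poles at \<open>0\<close>.
\<close>
datatype weight_index =
    At_zero "nat \<times> nat \<times> nat" | At_infty "nat \<times> nat \<times> nat"
  | Pole_zero "nat \<times> nat \<times> nat" | Pole_infty "nat \<times> nat \<times> nat"

text \<open>
  The two charts have frames \<open>e\<close> and \<open>e'\<close> with dual frames \<open>l\<close> and \<open>l'\<close>, which may differ in the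
  first \<open>r\<close> vectors but share the complementary ones.
\<close>
locale fixed_type = rational_subsheaf V +
    zero: chart V U_zero "Aff 0" zvar r \<alpha> e l + infty: chart V U_infty Infty wvar r \<beta> e' l'
  for V :: "'n::finite presheaf" and r \<alpha> \<beta> e l e' l' +
  assumes complement: "j \<in> {r+1..CARD('n)} \<Longrightarrow> e' j = e j" "j \<in> {r+1..CARD('n)} \<Longrightarrow> l' j = l j"
    and fixed: "circle_fixed V"
begin

definition index_set :: "weight_index set" where
  "index_set =
     At_zero ` (SIGMA i:{1..r}. SIGMA j:{1..r}. {..<\<alpha> j}) \<union>
     At_infty ` (SIGMA i:{1..r}. SIGMA j:{1..r}. {..<\<beta> j}) \<union>
     Pole_zero ` (SIGMA i:{1..r}. SIGMA j:{r+1..CARD('n)}. {..\<alpha> i}) \<union>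
     Pole_infty ` (SIGMA i:{1..r}. SIGMA j:{r+1..CARD('n)}. {1..\<beta> i})"

fun expo :: "weight_index \<Rightarrow> int" where
  "expo (At_zero (i, j, k)) = int k - int (\<alpha> i)"
| "expo (At_infty (i, j, k)) = int (\<beta> i) - int k"
| "expo (Pole_zero (i, j, k)) = - int k"
| "expo (Pole_infty (i, j, k)) = int k"

fun covec :: "weight_index \<Rightarrow> complex ^ 'n" where
  "covec (At_zero (i, j, k)) = l i"
| "covec (At_infty (i, j, k)) = l' i"
| "covec (Pole_zero (i, j, k)) = l i"
| "covec (Pole_infty (i, j, k)) = l' i"

fun targ :: "weight_index \<Rightarrow> complex ^ 'n" where
  "targ (At_zero (i, j, k)) = e j"
| "targ (At_infty (i, j, k)) = e' j"
| "targ (Pole_zero (i, j, k)) = e j"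
| "targ (Pole_infty (i, j, k)) = e j"

fun supp :: "weight_index \<Rightarrow> proj_line set" where
  "supp (At_zero _) = {Aff 0}"
| "supp (At_infty _) = {Infty}"
| "supp (Pole_zero _) = UNIV"
| "supp (Pole_infty _) = UNIV"

text \<open>
  All four families have the form of a power of \<open>z\<close> times a constant matrix of rank one, which makes
  them weight vectors; they differ in the powers that are allowed and in the set of points where the
  map is not replaced by zero.
\<close>
definition basic_map :: "weight_index \<Rightarrow> proj_line \<Rightarrow> ratfun ^ 'n \<Rightarrow> ratfun ^ 'n" where
  "basic_map x p s =
     (if p \<in> supp x then (zvar powi expo x * lin_form (covec x) s) *s const_vec (targ x) else 0)"

definition lincomb :: "(weight_index \<Rightarrow> complex) \<Rightarrow> proj_line \<Rightarrow> ratfun ^ 'n \<Rightarrow> ratfun ^ 'n" where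
  "lincomb c p s = (\<Sum>x\<in>index_set. cst (c x) *s basic_map x p s)"

lemma finite_index_set: "finite index_set"
  by (simp add: index_set_def)

lemma sum_index_set:
  fixes f :: "weight_index \<Rightarrow> 'b::comm_monoid_add"
  shows "sum f index_set =
    (\<Sum>i\<in>{1..r}. \<Sum>j\<in>{1..r}. \<Sum>k<\<alpha> j. f (At_zero (i, j, k))) +
    (\<Sum>i\<in>{1..r}. \<Sum>j\<in>{1..r}. \<Sum>k<\<beta> j. f (At_infty (i, j, k))) +
    (\<Sum>i\<in>{1..r}. \<Sum>j\<in>{r+1..CARD('n)}. \<Sum>k\<le>\<alpha> i. f (Pole_zero (i, j, k))) +
    (\<Sum>i\<in>{1..r}. \<Sum>j\<in>{r+1..CARD('n)}. \<Sum>k\<in>{1..\<beta> i}. f (Pole_infty (i, j, k)))"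
proof -
  have triple: "sum g (SIGMA i:A. SIGMA j:B. C i j) = (\<Sum>i\<in>A. \<Sum>j\<in>B. \<Sum>k\<in>C i j. g (i, j, k))"
    if "finite A" "finite B" "\<And>i j. finite (C i j)"
    for g :: "nat \<times> nat \<times> nat \<Rightarrow> 'b" and A B :: "nat set" and C
    using that by (simp add: sum.Sigma)
  show ?thesis
    unfolding index_set_def
    by (subst sum.union_disjoint; (auto; fail)?)+
      (simp add: sum.reindex inj_on_def triple)
qed

lemma powi_wvar: "wvar powi k = zvar powi (- k)"
  by (simp add: wvar_def power_int_inverse power_int_minus)

lemma regular_zvar_powi_nonneg: "q \<noteq> Infty \<Longrightarrow> 0 \<le> k \<Longrightarrow> regular_at q (zvar powi k)"
  by (rule zero.regular_powi_nonneg) (auto simp: U_zero_def)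

lemma regular_zvar_powi_nonpos: "q \<noteq> Aff 0 \<Longrightarrow> k \<le> 0 \<Longrightarrow> regular_at q (zvar powi k)"
  using infty.regular_powi_nonneg[of q "- k"] by (auto simp: U_infty_def powi_wvar)

text \<open>
  The coordinate \<open>i\<close> of a section of \<open>V\<close> vanishes to order \<open>\<alpha> i\<close> at \<open>0\<close> in the frame \<open>e\<close>, and to
  order \<open>\<beta> i\<close> at \<open>\<infinity>\<close> in the frame \<open>e'\<close>.  These zeros cancel the poles of the map.
\<close>
lemma local_family_basic_map:
  assumes x: "x \<in> index_set"
  shows "local_family V (basic_map x)"
proof -
  define f where "f s = zvar powi expo x * lin_form (covec x) s" for s
  have map: "basic_map x p s = (if p \<in> supp x then f s *s const_vec (targ x) else 0)" for p s
    by (simp add: basic_map_def f_def)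
  have f: "f (s + s') = f s + f s'" "f (g *s s) = g * f s" for s s' g
    by (simp_all add: f_def lin_form_add lin_form_scale algebra_simps)
  have reg: "regular_at p (f s)" if s: "s \<in> stalk V p" and p: "p \<in> supp x" for p s
    using x unfolding index_set_def
  proof (elim UnE imageE SigmaE, simp_all only:)
    fix i j k assume *: "x = At_zero (i, j, k)" "i \<in> {1..r}" "k \<in> {..<\<alpha> j}"
    have "f s = zvar ^ k * (zvar powi (- int (\<alpha> i)) * lin_form (l i) s)"
      by (simp add: f_def * power_int_diff power_int_minus field_simps)
    moreover have "p = Aff 0"
      using p * by simp
    ultimately show "regular_at p (f s)"
      using zero.stalk_iff[of p s] s *
      by (auto simp: U_zero_def intro!: regular_mult[OF regular_power[OF regular_zvar_Aff]])
  next
    fix i j k assume *: "x = At_infty (i, j, k)" "i \<in> {1..r}" "k \<in> {..<\<beta> j}"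
    have "f s = wvar ^ k * (wvar powi (- int (\<beta> i)) * lin_form (l' i) s)"
      by (simp add: f_def * power_int_diff wvar_def power_int_minus field_simps)
    moreover have "p = Infty"
      using p * by simp
    ultimately show "regular_at p (f s)"
      using infty.stalk_iff[of p s] s *
      by (auto simp: U_infty_def intro!: regular_mult[OF regular_power[OF regular_wvar_Infty]])
  next
    fix i j k assume *: "x = Pole_zero (i, j, k)" "i \<in> {1..r}" "k \<in> {..\<alpha> i}"
    show "regular_at p (f s)"
    proof (cases "p = Aff 0")
      case False
      then show ?thesis
        using s by (auto simp: f_def * intro!: regular_mult regular_zvar_powi_nonpos
          regular_lin_form stalk_regular)
    next
      case True
      have "f s = zvar powi (int (\<alpha> i) - int k) * (zvar powi (- int (\<alpha> i)) * lin_form (l i) s)"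
        by (simp add: f_def * power_int_diff power_int_minus field_simps)
      moreover have "regular_at p (zvar powi (- int (\<alpha> i)) * lin_form (l i) s)"
        using zero.stalk_iff[of p s] s * True by (auto simp: U_zero_def)
      ultimately show ?thesis
        using * True by (auto intro: regular_mult[OF regular_zvar_powi_nonneg])
    qed
  next
    fix i j k assume *: "x = Pole_infty (i, j, k)" "i \<in> {1..r}" "k \<in> {1..\<beta> i}"
    show "regular_at p (f s)"
    proof (cases "p = Infty")
      case False
      then show ?thesis
        using s by (auto simp: f_def * intro!: regular_mult regular_zvar_powi_nonneg[of _ "int k", simplified]
          regular_lin_form stalk_regular)
    next
      case True
      have "f s = zvar powi (int k - int (\<beta> i)) * (wvar powi (- int (\<beta> i)) * lin_form (l' i) s)"
        by (simp add: f_def * power_int_diff wvar_def power_int_minus field_simps)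
      then show ?thesis
        using infty.stalk_iff[of p s] s * True
        by (auto simp: U_infty_def intro!: regular_mult[OF regular_zvar_powi_nonpos])
    qed
  qed
  have targ: "supp x = UNIV \<or> (\<forall>q. q \<noteq> Aff 0 \<and> q \<noteq> Infty \<longrightarrow> const_vec (targ x) \<in> stalk V q)"
    using x zero.const_vec_stalk infty.const_vec_stalk
    by (auto simp: index_set_def U_zero_def U_infty_def)
  show ?thesis
    unfolding local_family_def
  proof (intro conjI allI ballI)
    fix p s assume s: "s \<in> stalk V p"
    show "regular_vec p (basic_map x p s)"
      using reg[OF s] by (simp add: map regular_vec_scale)
    have "{q. basic_map x q s - basic_map x p s \<notin> stalk V q}
        \<subseteq> {Aff 0, Infty} \<union> {q. \<not> regular_at q (f s)}"
    proof
      fix q assume q: "q \<in> {q. basic_map x q s - basic_map x p s \<notin> stalk V q}"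
      then have neq: "basic_map x q s \<noteq> basic_map x p s"
        using stalk_0 by auto
      then have "supp x \<noteq> UNIV"
        by (auto simp: map)
      then have "basic_map x q s - basic_map x p s \<in> stalk V q"
        if "q \<noteq> Aff 0" "q \<noteq> Infty" "regular_at q (f s)"
        using that targ by (simp add: map stalk_diff stalk_scale stalk_0)
      then show "q \<in> {Aff 0, Infty} \<union> {q. \<not> regular_at q (f s)}"
        using q by blast
    qed
    then show "finite {q. basic_map x q s - basic_map x p s \<notin> stalk V q}"
      by (rule finite_subset) (simp add: finite_poles)
  qed (simp_all add: map f vec.scale_left_distrib vector_smult_assoc)
qed

text \<open>
  The constant form and the constant vector are invariant, so only the power of \<open>z\<close> contributes,
  and \<open>z^m\<close> has weight \<open>- m\<close>.
\<close>
lemma weight_vector_basic_map: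
  assumes x: "x \<in> index_set"
  shows "weight_vector V (- expo x) (local_hom V (basic_map x))"
  unfolding weight_vector_def
proof (intro conjI allI impI)
  show "local_hom V (basic_map x) \<in> carrier (tangent_space V)"
    by (rule local_hom_mem[OF local_family_basic_map[OF x]])
  fix t :: complex assume t: "cmod t = 1"
  then have t0: "t \<noteq> 0" "inverse t \<noteq> 0"
    by auto
  have supp: "act_point (inverse t) p \<in> supp x \<longleftrightarrow> p \<in> supp x" for p
    using t0 by (cases x; cases p) auto
  have "act_sec t (basic_map x (act_point (inverse t) p) (act_sec (inverse t) s)) =
      cst (t powi (- expo x)) *s basic_map x p s" for p s
    using t0
    by (simp add: basic_map_def supp act_sec_0 act_sec_scale act_sec_const_vec act_fun_mult lin_form_act_sec
        act_fun_act_fun_inverse act_fun_zvar_powi vector_smult_assoc mult.assoc)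
  then show "act_hom V t (local_hom V (basic_map x)) = (t powi (- expo x)) \<odot>\<^bsub>tangent_space V\<^esub> local_hom V (basic_map x)"
    unfolding act_hom_local_hom[OF fixed t] tangent_smult by simp
qed

text \<open>
  These two are the coefficients of the linear combination in the complementary direction \<open>j\<close>, with
  respect to the forms \<open>l i\<close> and \<open>l' i\<close> respectively.
\<close>
definition pole_zero_part :: "(weight_index \<Rightarrow> complex) \<Rightarrow> nat \<Rightarrow> nat \<Rightarrow> ratfun" where
  "pole_zero_part c j i = (\<Sum>k\<le>\<alpha> i. cst (c (Pole_zero (i, j, k))) * zvar powi (- int k))"

definition pole_infty_part :: "(weight_index \<Rightarrow> complex) \<Rightarrow> nat \<Rightarrow> nat \<Rightarrow> ratfun" where
  "pole_infty_part c j i = (\<Sum>k\<in>{1..\<beta> i}. cst (c (Pole_infty (i, j, k))) * zvar powi int k)"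

lemma lin_form_frames:
  assumes "i \<in> {1..r}" "m \<in> {1..r}" "j \<in> {r+1..CARD('n)}" "j' \<in> {r+1..CARD('n)}"
  shows "lin_form (l i) (const_vec (e m)) = of_bool (i = m)" "lin_form (l j) (const_vec (e m)) = 0"
    "lin_form (l i) (const_vec (e j)) = 0" "lin_form (l j) (const_vec (e j')) = of_bool (j = j')"
    "lin_form (l' i) (const_vec (e' m)) = of_bool (i = m)" "lin_form (l j) (const_vec (e' m)) = 0"
    "lin_form (l' i) (const_vec (e j)) = 0"
proof -
  have i: "i \<in> {1..CARD('n)}" "m \<in> {1..CARD('n)}" "j \<in> {1..CARD('n)}" "j' \<in> {1..CARD('n)}"
    using assms zero.r_le by auto
  note 0 = zero.lin_form_frame and inf = infty.lin_form_frame
  have neq: "j \<noteq> m" "i \<noteq> j"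
    using assms by auto
  show "lin_form (l i) (const_vec (e m)) = of_bool (i = m)" "lin_form (l j) (const_vec (e m)) = 0"
    "lin_form (l i) (const_vec (e j)) = 0" "lin_form (l j) (const_vec (e j')) = of_bool (j = j')"
    "lin_form (l' i) (const_vec (e' m)) = of_bool (i = m)" "lin_form (l j) (const_vec (e' m)) = 0"
    "lin_form (l' i) (const_vec (e j)) = 0"
    using 0[OF i(1,2)] 0[OF i(3,2)] 0[OF i(1,3)] 0[OF i(3,4)] inf[OF i(1,2)] inf[OF i(3,2)] inf[OF i(1,3)]
      complement[OF assms(3)] neq
    by simp_all
qed

lemma lin_form_lincomb:
  "lin_form f (lincomb c p s) = (\<Sum>x\<in>index_set.
     if p \<in> supp x then cst (c x) * (zvar powi expo x * lin_form (covec x) s) * lin_form f (const_vec (targ x))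
     else 0)"
  unfolding lincomb_def lin_form_sum
  by (intro sum.cong refl) (simp add: basic_map_def lin_form_scale mult.assoc)

lemma sum_sum_delta:
  fixes h :: "nat \<Rightarrow> nat \<Rightarrow> ratfun"
  assumes "finite J" "m \<in> J" "\<And>j. j \<in> J \<Longrightarrow> g j = of_bool (m = j)"
  shows "(\<Sum>j\<in>J. \<Sum>k\<in>K j. h j k * g j) = (\<Sum>k\<in>K m. h m k)"
proof -
  have "(\<Sum>j\<in>J. \<Sum>k\<in>K j. h j k * g j) = (\<Sum>j\<in>J. if j = m then (\<Sum>k\<in>K m. h m k) else 0)"
    using assms(3) by (intro sum.cong refl) auto
  then show ?thesis
    using assms(1,2) by simp
qed

lemma lin_form_lincomb_complement:
  assumes j: "j \<in> {r+1..CARD('n)}"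
  shows "lin_form (l j) (lincomb c p s) =
    (\<Sum>i\<in>{1..r}. lin_form (l i) s * pole_zero_part c j i) +
    (\<Sum>i\<in>{1..r}. lin_form (l' i) s * pole_infty_part c j i)"
proof -
  define G where "G x = (if p \<in> supp x then cst (c x) * (zvar powi expo x * lin_form (covec x) s)
    * lin_form (l j) (const_vec (targ x)) else 0)" for x
  have 1: "(\<Sum>i\<in>{1..r}. \<Sum>j\<in>{1..r}. \<Sum>k<\<alpha> j. G (At_zero (i, j, k))) = 0"
    using j by (intro sum.neutral ballI) (simp add: G_def lin_form_frames)
  have 2: "(\<Sum>i\<in>{1..r}. \<Sum>j\<in>{1..r}. \<Sum>k<\<beta> j. G (At_infty (i, j, k))) = 0"
    using j by (intro sum.neutral ballI) (simp add: G_def lin_form_frames)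
  have 3: "(\<Sum>j'\<in>{r+1..CARD('n)}. \<Sum>k\<le>\<alpha> i. G (Pole_zero (i, j', k))) = lin_form (l i) s * pole_zero_part c j i"
    if "i \<in> {1..r}" for i
  proof -
    have "(\<Sum>j'\<in>{r+1..CARD('n)}. \<Sum>k\<le>\<alpha> i. G (Pole_zero (i, j', k)))
        = (\<Sum>k\<le>\<alpha> i. cst (c (Pole_zero (i, j, k))) * (zvar powi (- int k) * lin_form (l i) s))"
      unfolding G_def supp.simps expo.simps covec.simps targ.simps if_P[OF UNIV_I]
      using that j by (intro sum_sum_delta) (simp_all add: lin_form_frames)
    then show ?thesis
      by (simp add: pole_zero_part_def sum_distrib_left mult_ac)
  qed
  have 4: "(\<Sum>j'\<in>{r+1..CARD('n)}. \<Sum>k\<in>{1..\<beta> i}. G (Pole_infty (i, j', k))) = lin_form (l' i) s * pole_infty_part c j i"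
    if "i \<in> {1..r}" for i
  proof -
    have "(\<Sum>j'\<in>{r+1..CARD('n)}. \<Sum>k\<in>{1..\<beta> i}. G (Pole_infty (i, j', k)))
        = (\<Sum>k\<in>{1..\<beta> i}. cst (c (Pole_infty (i, j, k))) * (zvar powi int k * lin_form (l' i) s))"
      unfolding G_def supp.simps expo.simps covec.simps targ.simps if_P[OF UNIV_I]
      using that j by (intro sum_sum_delta) (simp_all add: lin_form_frames)
    then show ?thesis
      by (simp add: pole_infty_part_def sum_distrib_left mult_ac del: power_int_of_nat)
  qed
  show ?thesis
    unfolding lin_form_lincomb G_def[symmetric] sum_index_set 1 2
    by (simp only: 3 4 add_0_left cong: sum.cong)
qed

lemma lin_form_lincomb_zero:
  assumes m: "m \<in> {1..r}"
  shows "lin_form (l m) (lincomb c (Aff 0) s) =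
    (\<Sum>i\<in>{1..r}. lin_form (l i) s * (\<Sum>k<\<alpha> m. cst (c (At_zero (i, m, k))) * zvar powi (int k - int (\<alpha> i))))"
proof -
  define G where "G x = (if Aff 0 \<in> supp x then cst (c x) * (zvar powi expo x * lin_form (covec x) s)
    * lin_form (l m) (const_vec (targ x)) else 0)" for x
  have 1: "(\<Sum>j\<in>{1..r}. \<Sum>k<\<alpha> j. G (At_zero (i, j, k))) =
      lin_form (l i) s * (\<Sum>k<\<alpha> m. cst (c (At_zero (i, m, k))) * zvar powi (int k - int (\<alpha> i)))"
    if "i \<in> {1..r}" for i
  proof -
    have "(\<Sum>j\<in>{1..r}. \<Sum>k<\<alpha> j. G (At_zero (i, j, k)))
        = (\<Sum>k<\<alpha> m. cst (c (At_zero (i, m, k))) * (zvar powi (int k - int (\<alpha> i)) * lin_form (l i) s))"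
      unfolding G_def supp.simps expo.simps covec.simps targ.simps if_P[OF singletonI]
      using that m zero.r_le by (intro sum_sum_delta) (simp_all add: zero.lin_form_frame)
    then show ?thesis
      by (simp add: sum_distrib_left mult_ac)
  qed
  have 2: "(\<Sum>i\<in>{1..r}. \<Sum>j\<in>{1..r}. \<Sum>k<\<beta> j. G (At_infty (i, j, k))) = 0"
    by (simp add: G_def)
  have 3: "(\<Sum>i\<in>{1..r}. \<Sum>j\<in>{r+1..CARD('n)}. \<Sum>k\<le>\<alpha> i. G (Pole_zero (i, j, k))) = 0"
    using m by (intro sum.neutral ballI) (simp add: G_def lin_form_frames)
  have 4: "(\<Sum>i\<in>{1..r}. \<Sum>j\<in>{r+1..CARD('n)}. \<Sum>k\<in>{1..\<beta> i}. G (Pole_infty (i, j, k))) = 0"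
    using m by (intro sum.neutral ballI) (simp add: G_def lin_form_frames)
  show ?thesis
    unfolding lin_form_lincomb G_def[symmetric] sum_index_set 2 3 4
    by (simp only: 1 add_0_left add_0_right cong: sum.cong)
qed

lemma lin_form_lincomb_infty:
  assumes m: "m \<in> {1..r}"
  shows "lin_form (l' m) (lincomb c Infty s) =
    (\<Sum>i\<in>{1..r}. lin_form (l' i) s * (\<Sum>k<\<beta> m. cst (c (At_infty (i, m, k))) * wvar powi (int k - int (\<beta> i))))"
proof -
  define G where "G x = (if Infty \<in> supp x then cst (c x) * (zvar powi expo x * lin_form (covec x) s)
    * lin_form (l' m) (const_vec (targ x)) else 0)" for x
  have 1: "(\<Sum>j\<in>{1..r}. \<Sum>k<\<beta> j. G (At_infty (i, j, k))) =
      lin_form (l' i) s * (\<Sum>k<\<beta> m. cst (c (At_infty (i, m, k))) * wvar powi (int k - int (\<beta> i)))"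
    if "i \<in> {1..r}" for i
  proof -
    have "(\<Sum>j\<in>{1..r}. \<Sum>k<\<beta> j. G (At_infty (i, j, k)))
        = (\<Sum>k<\<beta> m. cst (c (At_infty (i, m, k))) * (zvar powi (int (\<beta> i) - int k) * lin_form (l' i) s))"
      unfolding G_def supp.simps expo.simps covec.simps targ.simps if_P[OF singletonI]
      using that m infty.r_le by (intro sum_sum_delta) (simp_all add: infty.lin_form_frame)
    then show ?thesis
      by (simp add: sum_distrib_left mult_ac powi_wvar)
  qed
  have 2: "(\<Sum>i\<in>{1..r}. \<Sum>j\<in>{1..r}. \<Sum>k<\<alpha> j. G (At_zero (i, j, k))) = 0"
    by (simp add: G_def)
  have 3: "(\<Sum>i\<in>{1..r}. \<Sum>j\<in>{r+1..CARD('n)}. \<Sum>k\<le>\<alpha> i. G (Pole_zero (i, j, k))) = 0"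
    using m by (intro sum.neutral ballI) (simp add: G_def lin_form_frames)
  have 4: "(\<Sum>i\<in>{1..r}. \<Sum>j\<in>{r+1..CARD('n)}. \<Sum>k\<in>{1..\<beta> i}. G (Pole_infty (i, j, k))) = 0"
    using m by (intro sum.neutral ballI) (simp add: G_def lin_form_frames)
  show ?thesis
    unfolding lin_form_lincomb G_def[symmetric] sum_index_set 2 3 4
    by (simp only: 1 add_0_left add_0_right cong: sum.cong)
qed

lemma lin_form_lincomb_zero_gen:
  assumes "m \<in> {1..r}" "i \<in> {1..r}"
  shows "lin_form (l m) (lincomb c (Aff 0) (zero.gen i)) = (\<Sum>k<\<alpha> m. cst (c (At_zero (i, m, k))) * zvar ^ k)"
proof -
  define g where "g n = (\<Sum>k<\<alpha> m. cst (c (At_zero (n, m, k))) * zvar powi (int k - int (\<alpha> n)))" for n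
  have "lin_form (l m) (lincomb c (Aff 0) (zero.gen i)) = (\<Sum>n\<in>{1..r}. if n = i then zvar ^ \<alpha> i * g i else 0)"
    unfolding lin_form_lincomb_zero[OF assms(1)] g_def[symmetric]
    using assms zero.r_le by (intro sum.cong refl) (simp add: zero.lin_form_gen)
  also have "\<dots> = (\<Sum>k<\<alpha> m. cst (c (At_zero (i, m, k))) * zvar ^ k)"
    using assms(2) by (simp add: g_def sum_distrib_left power_int_diff)
  finally show ?thesis .
qed

lemma lin_form_lincomb_infty_gen:
  assumes "m \<in> {1..r}" "i \<in> {1..r}"
  shows "lin_form (l' m) (lincomb c Infty (infty.gen i)) = (\<Sum>k<\<beta> m. cst (c (At_infty (i, m, k))) * wvar ^ k)"
proof -
  define g where "g n = (\<Sum>k<\<beta> m. cst (c (At_infty (n, m, k))) * wvar powi (int k - int (\<beta> n)))" for n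
  have "lin_form (l' m) (lincomb c Infty (infty.gen i)) = (\<Sum>n\<in>{1..r}. if n = i then wvar ^ \<beta> i * g i else 0)"
    unfolding lin_form_lincomb_infty[OF assms(1)] g_def[symmetric]
    using assms infty.r_le by (intro sum.cong refl) (simp add: infty.lin_form_gen)
  also have "\<dots> = (\<Sum>k<\<beta> m. cst (c (At_infty (i, m, k))) * wvar ^ k)"
    using assms(2) by (simp add: g_def sum_distrib_left power_int_diff)
  finally show ?thesis .
qed

lemma mem_Aff_1: "Aff 1 \<in> U_zero" "Aff 1 \<in> U_infty" "Aff 0 \<in> U_zero" "Infty \<in> U_infty"
  by (simp_all add: U_zero_def U_infty_def)

text \<open>
  Evaluating the complementary coordinates on the frame \<open>e\<close> isolates the part with nonpositive powers
  of \<open>z\<close>: the rest vanishes at \<open>0\<close> whatever the change of frame is.  Once this part is zero, the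
  frame \<open>e'\<close> isolates the positive powers.  What remains is concentrated at the two fixed points,
  where a Taylor polynomial of degree below \<open>\<alpha> m\<close> that is divisible by \<open>z^(\<alpha> m)\<close> vanishes.
\<close>
lemma basis_independent:
  assumes H: "\<And>p s. s \<in> stalk V p \<Longrightarrow> lincomb c p s \<in> stalk V p" and x: "x \<in> index_set"
  shows "c x = 0"
proof -
  have high: "(\<Sum>i\<in>{1..r}. lin_form (l i) s * pole_zero_part c j i) +
    (\<Sum>i\<in>{1..r}. lin_form (l' i) s * pole_infty_part c j i) = 0"
    if "s \<in> stalk V p" "j \<in> {r+1..CARD('n)}" for p s j
    using zero.lin_form_stalk_eq_0[OF H[OF that(1)] that(2)] lin_form_lincomb_complement[OF that(2)] by simp
  have delta: "(\<Sum>n\<in>{1..r}. lin_form (l n) (const_vec (e i)) * g n) = g i"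
    "(\<Sum>n\<in>{1..r}. lin_form (l' n) (const_vec (e' i)) * g n) = g i"
    if "i \<in> {1..r}" for i and g :: "nat \<Rightarrow> ratfun"
  proof -
    have "(\<Sum>n\<in>{1..r}. of_bool (n = i) * g n) = g i"
      using that by (simp add: of_bool_def if_distrib[of "\<lambda>x. x * _"] cong: if_cong)
    moreover have "lin_form (l n) (const_vec (e i)) = of_bool (n = i)"
      "lin_form (l' n) (const_vec (e' i)) = of_bool (n = i)" if "n \<in> {1..r}" for n
      using \<open>i \<in> {1..r}\<close> that zero.r_le by (simp_all add: zero.lin_form_frame infty.lin_form_frame)
    ultimately show "(\<Sum>n\<in>{1..r}. lin_form (l n) (const_vec (e i)) * g n) = g i"
      "(\<Sum>n\<in>{1..r}. lin_form (l' n) (const_vec (e' i)) * g n) = g i"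
      by (simp_all only: cong: sum.cong)
  qed
  (* Dividing by z brings the constant term into the range of negative exponents as well, while the
     terms with exponents k >= 1 stay regular. *)
  have pole_zero: "c (Pole_zero (i, j, k)) = 0"
    if i: "i \<in> {1..r}" and j: "j \<in> {r+1..CARD('n)}" and "k \<le> \<alpha> i" for i j k
  proof -
    let ?f = "\<lambda>n. lin_form (l' n) (const_vec (e i))"
    have "pole_zero_part c j i = - (\<Sum>n\<in>{1..r}. ?f n * pole_infty_part c j n)"
      using high[OF zero.const_vec_stalk[OF i mem_Aff_1(1)] j] delta(1)[OF i] by (simp add: eq_neg_iff_add_eq_0)
    then have eq: "zvar powi (- 1) * pole_zero_part c j i = - (\<Sum>n\<in>{1..r}. ?f n * (zvar powi (- 1) * pole_infty_part c j n))"
      by (simp add: sum_distrib_left mult_ac)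
    have reg: "regular_at (Aff 0) (zvar powi (- 1) * pole_infty_part c j n)" for n
    proof -
      have "zvar powi (- 1) * pole_infty_part c j n
          = (\<Sum>k\<in>{1..\<beta> n}. cst (c (Pole_infty (n, j, k))) * zvar powi (int k - 1))"
        unfolding pole_infty_part_def sum_distrib_left
        by (intro sum.cong refl) (simp add: power_int_diff power_int_minus field_simps)
      also have "regular_at (Aff 0) \<dots>"
        by (intro regular_sum regular_mult regular_cst regular_zvar_powi_nonneg) auto
      finally show ?thesis .
    qed
    have "regular_at (Aff 0) (zvar powi (- 1) * pole_zero_part c j i)"
      unfolding eq by (intro regular_minus regular_sum regular_mult regular_lin_form regular_vec_const_vec reg)
    also have "pole_zero_part c j i = (\<Sum>k\<in>(\<lambda>k. - int k) ` {..\<alpha> i}. cst (c (Pole_zero (i, j, nat (- k)))) * zvar powi k)"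
      unfolding pole_zero_part_def by (subst sum.reindex) (auto simp: inj_on_def)
    finally have "c (Pole_zero (i, j, nat (- (- int k)))) = 0"
      by (rule laurent_sum_regular_shift[OF uniformizer_zvar, rotated]) (use \<open>k \<le> \<alpha> i\<close> in auto)
    then show ?thesis
      by simp
  qed
  have pole_infty: "c (Pole_infty (i, j, k)) = 0"
    if i: "i \<in> {1..r}" and j: "j \<in> {r+1..CARD('n)}" and k: "k \<in> {1..\<beta> i}" for i j k
  proof -
    have "pole_zero_part c j n = 0" if "n \<in> {1..r}" for n
      using that j by (auto simp: pole_zero_part_def pole_zero)
    then have "pole_infty_part c j i = 0"
      using high[OF infty.const_vec_stalk[OF i mem_Aff_1(2)] j] delta(2)[OF i] by simp
    also have "pole_infty_part c j i = (\<Sum>k\<in>int ` {1..\<beta> i}. cst (c (Pole_infty (i, j, nat k))) * zvar powi k)"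
      unfolding pole_infty_part_def by (subst sum.reindex) (auto simp: inj_on_def)
    finally have "c (Pole_infty (i, j, nat (int k))) = 0"
      by (rule laurent_sum_eq_0[OF uniformizer_zvar, rotated]) (use k in auto)
    then show ?thesis
      by simp
  qed
  have at_zero: "c (At_zero (i, j, k)) = 0" if "i \<in> {1..r}" "j \<in> {1..r}" "k < \<alpha> j" for i j k
    using H[OF zero.gen_stalk[OF that(1) mem_Aff_1(3)]] that zero.stalk_iff[OF mem_Aff_1(3)]
    by (intro taylor_polynomial_unique[OF uniformizer_zvar _ that(3)])
      (simp flip: lin_form_lincomb_zero_gen)
  have at_infty: "c (At_infty (i, j, k)) = 0" if "i \<in> {1..r}" "j \<in> {1..r}" "k < \<beta> j" for i j k
    using H[OF infty.gen_stalk[OF that(1) mem_Aff_1(4)]] that infty.stalk_iff[OF mem_Aff_1(4)]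
    by (intro taylor_polynomial_unique[OF uniformizer_wvar _ that(3)])
      (simp flip: lin_form_lincomb_infty_gen)
  show ?thesis
    using x pole_zero pole_infty at_zero at_infty by (auto simp: index_set_def)
qed

lemma local_family_lincomb_basic: "local_family V (lincomb c)"
  unfolding lincomb_def[abs_def]
  by (intro local_family_lincomb finite_index_set local_family_basic_map)

lemma lincomb_sum_scale:
  assumes "finite A"
  shows "lincomb c q (\<Sum>i\<in>A. f i *s b i) = (\<Sum>i\<in>A. f i *s lincomb c q (b i))"
proof -
  have add: "lincomb c q (s + s') = lincomb c q s + lincomb c q s'"
    and scale: "lincomb c q (g *s s) = g *s lincomb c q s" for s s' g
    using local_family_lincomb_basic by (auto simp: local_family_def)
  have zero: "lincomb c q 0 = 0"
    using scale[of 0 0] by simp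
  show ?thesis
    using assms by induction (simp_all add: zero add scale)
qed

lemma lin_form_change_frame:
  assumes "\<And>j. j \<in> {r+1..CARD('n)} \<Longrightarrow> lin_form (l j) s = 0"
  shows "lin_form f s = (\<Sum>i\<in>{1..r}. lin_form (l' i) s * lin_form f (const_vec (e' i)))"
proof -
  have "s = (\<Sum>i\<in>{1..r}. lin_form (l' i) s *s const_vec (e' i))"
    using assms complement by (intro infty.expansion) simp
  then have "lin_form f s = lin_form f (\<Sum>i\<in>{1..r}. lin_form (l' i) s *s const_vec (e' i))"
    by simp
  then show ?thesis
    by (simp add: lin_form_sum lin_form_scale)
qed

text \<open>
  In a complementary direction the morphism is a linear form with values \<open>F i\<close> on the frame \<open>e\<close> and
  \<open>F' i\<close> on the frame \<open>e'\<close>, all of them Laurent polynomials in \<open>z\<close>.  The type bounds the exponents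
  of \<open>F i\<close> from below and those of \<open>F' i\<close> from above.  Splitting the form by the sign of the
  exponents, the nonpositive part is written in the dual of \<open>e\<close> and the positive part in the dual of
  \<open>e'\<close>; since the change of frame is constant it acts on each power of \<open>z\<close> separately.
\<close>
lemma ex_pole_coefficients:
  assumes \<phi>: "\<phi> \<in> sheaf_homs V" and j: "j \<in> {r+1..CARD('n)}"
  shows "\<exists>C D. \<forall>c U s q b p. zopen U \<and> s \<in> V U \<and> q \<in> U \<and> \<phi> U s q = b +o stalk V q \<and>
      (\<forall>i k. c (Pole_zero (i, j, k)) = C i k) \<and> (\<forall>i k. c (Pole_infty (i, j, k)) = D i k) \<longrightarrow>
      lin_form (l j) (lincomb c p s) = lin_form (l j) b"
proof -
  have kill: "lin_form (l j) s = 0" if "s \<in> stalk V q" for s q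
    using zero.lin_form_stalk_eq_0[OF that j] .
  obtain F where F: "\<And>U s q b. zopen U \<Longrightarrow> s \<in> V U \<Longrightarrow> q \<in> U \<Longrightarrow> \<phi> U s q = b +o stalk V q \<Longrightarrow>
        lin_form (l j) b = (\<Sum>i\<in>{1..r}. lin_form (l i) s * F i)"
      "\<And>i q. i \<in> {1..r} \<Longrightarrow> q \<in> U_zero \<Longrightarrow> q \<noteq> Aff 0 \<Longrightarrow> regular_at q (F i)"
      "\<And>i. i \<in> {1..r} \<Longrightarrow> regular_at (Aff 0) (zvar ^ \<alpha> i * F i)"
    by (rule zero.hom_lin_form[OF \<phi>, of "l j"], erule kill, rule that)
  obtain F' where F': "\<And>U s q b. zopen U \<Longrightarrow> s \<in> V U \<Longrightarrow> q \<in> U \<Longrightarrow> \<phi> U s q = b +o stalk V q \<Longrightarrow>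
        lin_form (l j) b = (\<Sum>i\<in>{1..r}. lin_form (l' i) s * F' i)"
      "\<And>i. i \<in> {1..r} \<Longrightarrow> regular_at Infty (wvar ^ \<beta> i * F' i)"
    by (rule infty.hom_lin_form[OF \<phi>, of "l j"], erule kill, rule that)
  define \<gamma> where "\<gamma> i m = (\<Sum>a\<in>UNIV. l m $ a * e' i $ a)" for i m
  have \<gamma>: "lin_form (l m) (const_vec (e' i)) = cst (\<gamma> i m)" for i m
    by (simp add: lin_form_const_vec \<gamma>_def)
  have F'_eq: "F' i = (\<Sum>m\<in>{1..r}. cst (\<gamma> i m) * F m)" if i: "i \<in> {1..r}" for i
  proof -
    (* Any point other than the two fixed points would do. *)
    have U: "zopen (U_infty - {Infty})" "Aff 1 \<in> U_infty - {Infty}"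
      by (auto simp: U_infty_def zopen_iff_cofinite)
    obtain b where b: "\<phi> (U_infty - {Infty}) (const_vec (e' i)) (Aff 1) = b +o stalk V (Aff 1)"
      using hom_coset[OF \<phi> U(1) infty.const_vec_mem[OF i] U(2)] by metis
    have "lin_form (l j) b = (\<Sum>n\<in>{1..r}. if n = i then F' i else 0)"
      unfolding F'(1)[OF U(1) infty.const_vec_mem[OF i] U(2) b]
      using i zero.r_le by (intro sum.cong refl) (simp add: infty.lin_form_frame)
    then show ?thesis
      using F(1)[OF U(1) infty.const_vec_mem[OF i] U(2) b] i by (simp add: \<gamma>)
  qed
  have ex: "\<forall>i\<in>{1..r}. \<exists>c. finite {k. c k \<noteq> 0} \<and>
      (\<forall>S. finite S \<and> {k. c k \<noteq> 0} \<subseteq> S \<longrightarrow> F i = (\<Sum>k\<in>S. cst (c k) * zvar powi k))"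
    using F(2) by (intro ballI laurent_expansion) (simp add: U_zero_def)
  obtain C where C0: "\<forall>i\<in>{1..r}. finite {k. C i k \<noteq> 0} \<and>
      (\<forall>S. finite S \<and> {k. C i k \<noteq> 0} \<subseteq> S \<longrightarrow> F i = (\<Sum>k\<in>S. cst (C i k) * zvar powi k))"
    using bchoice[OF ex] by (elim exE) (rule that)
  then have C: "\<And>i. i \<in> {1..r} \<Longrightarrow> finite {k. C i k \<noteq> 0}"
    "\<And>i S. i \<in> {1..r} \<Longrightarrow> finite S \<Longrightarrow> {k. C i k \<noteq> 0} \<subseteq> S \<Longrightarrow> F i = (\<Sum>k\<in>S. cst (C i k) * zvar powi k)"
    by blast+
  define S where "S = (\<Union>i\<in>{1..r}. {k. C i k \<noteq> 0} \<union> {- int (\<alpha> i)..int (\<beta> i)})"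
  have S: "finite S" "\<And>i. i \<in> {1..r} \<Longrightarrow> {- int (\<alpha> i)..int (\<beta> i)} \<subseteq> S"
    using C(1) by (auto simp: S_def)
  have F_eq: "F i = (\<Sum>k\<in>S. cst (C i k) * zvar powi k)" if "i \<in> {1..r}" for i
    using that S by (intro C(2)) (auto simp: S_def)
  (* The Laurent coefficients of F' i. *)
  define D where "D i k = (\<Sum>m\<in>{1..r}. \<gamma> i m * C m k)" for i k
  have D_sum: "(\<Sum>k\<in>T. cst (D i k) * zvar powi k)
      = (\<Sum>m\<in>{1..r}. cst (\<gamma> i m) * (\<Sum>k\<in>T. cst (C m k) * zvar powi k))" for i T
    unfolding D_def cst_sum cst_mult sum_distrib_right sum_distrib_left
    by (subst sum.swap) (simp add: mult_ac)
  have C_0: "C i k = 0" if "i \<in> {1..r}" "k \<in> S" "k < - int (\<alpha> i)" for i k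
    using F(3)[OF that(1)] that unfolding F_eq[OF that(1)]
    by (intro laurent_sum_regular_shift[OF uniformizer_zvar S(1), of "int (\<alpha> i)"]) auto
  have D_0: "D i k = 0" if "i \<in> {1..r}" "k \<in> S" "k > int (\<beta> i)" for i k
  proof -
    have "F' i = (\<Sum>k\<in>S. cst (D i k) * zvar powi k)"
      unfolding D_sum F'_eq[OF that(1)] using F_eq by (intro sum.cong) auto
    also have "\<dots> = (\<Sum>k\<in>uminus ` S. cst (D i (- k)) * wvar powi k)"
      by (simp add: sum.reindex powi_wvar)
    finally have "regular_at Infty (wvar powi int (\<beta> i) * (\<Sum>k\<in>uminus ` S. cst (D i (- k)) * wvar powi k))"
      using F'(2)[OF that(1)] by simp
    then have "D i (- (- k)) = 0"
      by (rule laurent_sum_regular_shift[OF uniformizer_wvar, rotated]) (use S that in auto)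
    then show ?thesis
      by simp
  qed
  show ?thesis
  proof (rule exI[of _ "\<lambda>i k. C i (- int k)"], rule exI[of _ "\<lambda>i k. D i (int k)"], intro allI impI)
    fix c U s q b p
    assume "zopen U \<and> s \<in> V U \<and> q \<in> U \<and> \<phi> U s q = b +o stalk V q \<and>
      (\<forall>i k. c (Pole_zero (i, j, k)) = C i (- int k)) \<and> (\<forall>i k. c (Pole_infty (i, j, k)) = D i (int k))"
    then have U: "zopen U" "s \<in> V U" "q \<in> U" "\<phi> U s q = b +o stalk V q"
      and c: "\<And>i k. c (Pole_zero (i, j, k)) = C i (- int k)" "\<And>i k. c (Pole_infty (i, j, k)) = D i (int k)"
      by blast+
    have s: "lin_form (l m) s = (\<Sum>i\<in>{1..r}. lin_form (l' i) s * cst (\<gamma> i m))" for m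
      unfolding \<gamma>[symmetric] by (rule lin_form_change_frame[OF zero.lin_form_section_eq_0[OF U(1,2)]])
    define N where "N m = (\<Sum>k\<in>{k\<in>S. k \<le> 0}. cst (C m k) * zvar powi k)" for m
    define P where "P m = (\<Sum>k\<in>{k\<in>S. k > 0}. cst (C m k) * zvar powi k)" for m
    have NP: "F m = N m + P m" if "m \<in> {1..r}" for m
    proof -
      have "{k \<in> S. k \<le> 0} \<union> {k \<in> S. k > 0} = S"
        by auto
      then show ?thesis
        unfolding F_eq[OF that] N_def P_def using S(1)
        by (subst sum.union_disjoint[symmetric]) auto
    qed
    have pz: "pole_zero_part c j i = N i" if "i \<in> {1..r}" for i
    proof -
      have "pole_zero_part c j i = (\<Sum>k\<in>(\<lambda>k. - int k) ` {..\<alpha> i}. cst (C i k) * zvar powi k)"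
        unfolding pole_zero_part_def by (subst sum.reindex) (auto simp: inj_on_def c)
      also have "\<dots> = N i"
        unfolding N_def
      proof (rule sum.mono_neutral_left)
        show "\<forall>k\<in>{k \<in> S. k \<le> 0} - (\<lambda>k. - int k) ` {..\<alpha> i}. cst (C i k) * zvar powi k = 0"
        proof
          fix k assume k: "k \<in> {k \<in> S. k \<le> 0} - (\<lambda>k. - int k) ` {..\<alpha> i}"
          have "k < - int (\<alpha> i)"
          proof (rule ccontr)
            assume "\<not> k < - int (\<alpha> i)"
            with k have "k = - int (nat (- k))" "nat (- k) \<in> {..\<alpha> i}"
              by auto
            with k show False
              by blast
          qed
          with C_0[OF that] k show "cst (C i k) * zvar powi k = 0"
            by simp
        qed
      qed (use S that in \<open>force+\<close>)
      finally show ?thesis .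
    qed
    have pi: "pole_infty_part c j i = (\<Sum>m\<in>{1..r}. cst (\<gamma> i m) * P m)" if "i \<in> {1..r}" for i
    proof -
      have "pole_infty_part c j i = (\<Sum>k\<in>int ` {1..\<beta> i}. cst (D i k) * zvar powi k)"
        unfolding pole_infty_part_def by (subst sum.reindex) (auto simp: inj_on_def c)
      also have "\<dots> = (\<Sum>k\<in>{k\<in>S. k > 0}. cst (D i k) * zvar powi k)"
      proof (rule sum.mono_neutral_left)
        show "\<forall>k\<in>{k \<in> S. k > 0} - int ` {1..\<beta> i}. cst (D i k) * zvar powi k = 0"
        proof
          fix k assume k: "k \<in> {k \<in> S. k > 0} - int ` {1..\<beta> i}"
          have "k > int (\<beta> i)"
          proof (rule ccontr)
            assume "\<not> k > int (\<beta> i)"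
            with k have "k = int (nat k)" "nat k \<in> {1..\<beta> i}"
              by auto
            with k show False
              by blast
          qed
          with D_0[OF that] k show "cst (D i k) * zvar powi k = 0"
            by simp
        qed
      qed (use S that in \<open>force+\<close>)
      finally show ?thesis
        unfolding D_sum P_def .
    qed
    have "(\<Sum>i\<in>{1..r}. lin_form (l' i) s * pole_infty_part c j i)
        = (\<Sum>i\<in>{1..r}. \<Sum>m\<in>{1..r}. lin_form (l' i) s * (cst (\<gamma> i m) * P m))"
      by (simp only: pi sum_distrib_left cong: sum.cong)
    also have "\<dots> = (\<Sum>m\<in>{1..r}. lin_form (l m) s * P m)"
      by (subst sum.swap) (simp only: s sum_distrib_right mult.assoc)
    finally have "lin_form (l j) (lincomb c p s) =
        (\<Sum>m\<in>{1..r}. lin_form (l m) s * N m) + (\<Sum>m\<in>{1..r}. lin_form (l m) s * P m)"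
      unfolding lin_form_lincomb_complement[OF j] by (simp only: pz cong: sum.cong)
    also have "\<dots> = (\<Sum>m\<in>{1..r}. lin_form (l m) s * F m)"
      by (simp only: NP distrib_left sum.distrib cong: sum.cong)
    also have "\<dots> = lin_form (l j) b"
      using F(1)[OF U] by simp
    finally show "lin_form (l j) (lincomb c p s) = lin_form (l j) b" .
  qed
qed

text \<open>
  The complementary coordinates are matched first.  What is left of the morphism takes values in the
  torsion part, so it is visible only at \<open>0\<close> and \<open>\<infinity>\<close>, and there the coefficients are the Taylor
  coefficients of the images of the generators up to the order that is killed by \<open>V\<close>.
\<close>
lemma basis_spans:
  assumes \<phi>: "\<phi> \<in> sheaf_homs V"
  shows "\<exists>c. \<phi> = local_hom V (lincomb c)"
proof -
  have "\<forall>j\<in>{r+1..CARD('n)}. \<exists>C D. \<forall>c U s q b p.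
      zopen U \<and> s \<in> V U \<and> q \<in> U \<and> \<phi> U s q = b +o stalk V q \<and>
      (\<forall>i k. c (Pole_zero (i, j, k)) = C i k) \<and> (\<forall>i k. c (Pole_infty (i, j, k)) = D i k) \<longrightarrow>
      lin_form (l j) (lincomb c p s) = lin_form (l j) b"
    by (intro ballI ex_pole_coefficients[OF \<phi>])
  then obtain C D where CD: "\<forall>j\<in>{r+1..CARD('n)}. \<forall>c U s q b p.
      zopen U \<and> s \<in> V U \<and> q \<in> U \<and> \<phi> U s q = b +o stalk V q \<and>
      (\<forall>i k. c (Pole_zero (i, j, k)) = C j i k) \<and> (\<forall>i k. c (Pole_infty (i, j, k)) = D j i k) \<longrightarrow>
      lin_form (l j) (lincomb c p s) = lin_form (l j) b"
    unfolding bchoice_iff by (elim exE) (rule that)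
  have "\<exists>b. regular_vec (Aff 0) b \<and> \<phi> U_zero (zero.gen i) (Aff 0) = b +o stalk V (Aff 0)" if "i \<in> {1..r}" for i
    using hom_coset[OF \<phi> zero.zopen_A zero.gen_mem[OF that] zero.p_mem] by metis
  then obtain b0 where b0: "\<And>i. i \<in> {1..r} \<Longrightarrow> regular_vec (Aff 0) (b0 i)"
    "\<And>i. i \<in> {1..r} \<Longrightarrow> \<phi> U_zero (zero.gen i) (Aff 0) = b0 i +o stalk V (Aff 0)"
    by metis
  have "\<exists>b. regular_vec Infty b \<and> \<phi> U_infty (infty.gen i) Infty = b +o stalk V Infty" if "i \<in> {1..r}" for i
    using hom_coset[OF \<phi> infty.zopen_A infty.gen_mem[OF that] infty.p_mem] by metis
  then obtain b1 where b1: "\<And>i. i \<in> {1..r} \<Longrightarrow> regular_vec Infty (b1 i)"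
    "\<And>i. i \<in> {1..r} \<Longrightarrow> \<phi> U_infty (infty.gen i) Infty = b1 i +o stalk V Infty"
    by metis
  have "\<exists>c. \<forall>i\<in>{1..r}. \<forall>m. regular_at (Aff 0)
      (zvar powi (- int (\<alpha> m)) * (lin_form (l m) (b0 i) - (\<Sum>k<\<alpha> m. cst (c i m k) * zvar ^ k)))"
    by (rule bchoice, rule ballI, rule choice, rule allI,
        rule taylor_coefficients[OF uniformizer_zvar regular_lin_form[OF b0(1)]])
  then obtain c0 where 0: "\<forall>i\<in>{1..r}. \<forall>m. regular_at (Aff 0)
      (zvar powi (- int (\<alpha> m)) * (lin_form (l m) (b0 i) - (\<Sum>k<\<alpha> m. cst (c0 i m k) * zvar ^ k)))"
    by (elim exE) (rule that)
  have "\<exists>c. \<forall>i\<in>{1..r}. \<forall>m. regular_at Infty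
      (wvar powi (- int (\<beta> m)) * (lin_form (l' m) (b1 i) - (\<Sum>k<\<beta> m. cst (c i m k) * wvar ^ k)))"
    by (rule bchoice, rule ballI, rule choice, rule allI,
        rule taylor_coefficients[OF uniformizer_wvar regular_lin_form[OF b1(1)]])
  then obtain c1 where 1: "\<forall>i\<in>{1..r}. \<forall>m. regular_at Infty
      (wvar powi (- int (\<beta> m)) * (lin_form (l' m) (b1 i) - (\<Sum>k<\<beta> m. cst (c1 i m k) * wvar ^ k)))"
    by (elim exE) (rule that)
  define c where "c x = (case x of At_zero (i, m, k) \<Rightarrow> c0 i m k | At_infty (i, m, k) \<Rightarrow> c1 i m k
      | Pole_zero (i, j, k) \<Rightarrow> C j i k | Pole_infty (i, j, k) \<Rightarrow> D j i k)" for x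
  have high: "lin_form (l j) (lincomb c p s) = lin_form (l j) b"
    if "zopen U" "s \<in> V U" "q \<in> U" "\<phi> U s q = b +o stalk V q" "j \<in> {r+1..CARD('n)}" for U s q b j p
    using CD[rule_format, OF that(5), of U s q b c p] that(1-4) by (simp add: c_def)
  have reg: "regular_vec q (lincomb c q s)" if "s \<in> stalk V q" for q s
    using local_family_lincomb_basic that by (auto simp: local_family_def)
  have at_zero: "\<phi> U_zero (zero.gen i) q = lincomb c q (zero.gen i) +o stalk V q"
    if i: "i \<in> {1..r}" and q: "q \<in> U_zero" for i q
  proof (cases "q = Aff 0")
    case True
    have "lincomb c (Aff 0) (zero.gen i) - b0 i \<in> stalk V (Aff 0)"
      unfolding zero.stalk_iff[OF zero.p_mem]
    proof (intro conjI ballI)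
      fix m assume m: "m \<in> {1..r}"
      have "lin_form (l m) (lincomb c (Aff 0) (zero.gen i) - b0 i)
          = - (lin_form (l m) (b0 i) - (\<Sum>k<\<alpha> m. cst (c0 i m k) * zvar ^ k))"
        using i m by (simp add: lin_form_diff lin_form_lincomb_zero_gen c_def)
      then show "regular_at (Aff 0) (zvar powi (- int (\<alpha> m)) * lin_form (l m) (lincomb c (Aff 0) (zero.gen i) - b0 i))"
        using regular_minus[OF 0[rule_format, OF i, of m]] by (simp only: mult_minus_right)
    next
      fix j assume "j \<in> {r+1..CARD('n)}"
      from high[OF zero.zopen_A zero.gen_mem[OF i] zero.p_mem b0(2)[OF i] this]
      show "lin_form (l j) (lincomb c (Aff 0) (zero.gen i) - b0 i) = 0"
        by (simp add: lin_form_diff)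
    qed
    then show ?thesis
      using b0(2)[OF i] True coset_eq_iff by metis
  next
    case False
    obtain b where b: "regular_vec q b" "\<phi> U_zero (zero.gen i) q = b +o stalk V q"
      using hom_coset[OF \<phi> zero.zopen_A zero.gen_mem[OF i] q] by metis
    have "regular_vec q (lincomb c q (zero.gen i) - b)"
      using reg[OF zero.gen_stalk[OF i q]] b(1) by (simp add: regular_vec_def regular_diff)
    then have "lincomb c q (zero.gen i) - b \<in> stalk V q"
      unfolding zero.stalk_iff_off_p[OF q False]
      using high[OF zero.zopen_A zero.gen_mem[OF i] q b(2)] by (simp add: lin_form_diff)
    then show ?thesis
      using b(2) coset_eq_iff by metis
  qed
  have at_infty: "\<phi> U_infty (infty.gen i) Infty = lincomb c Infty (infty.gen i) +o stalk V Infty"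
    if i: "i \<in> {1..r}" for i
  proof -
    have "lincomb c Infty (infty.gen i) - b1 i \<in> stalk V Infty"
      unfolding infty.stalk_iff[OF infty.p_mem]
    proof (intro conjI ballI)
      fix m assume m: "m \<in> {1..r}"
      have "lin_form (l' m) (lincomb c Infty (infty.gen i) - b1 i)
          = - (lin_form (l' m) (b1 i) - (\<Sum>k<\<beta> m. cst (c1 i m k) * wvar ^ k))"
        using i m by (simp add: lin_form_diff lin_form_lincomb_infty_gen c_def)
      then show "regular_at Infty (wvar powi (- int (\<beta> m)) * lin_form (l' m) (lincomb c Infty (infty.gen i) - b1 i))"
        using regular_minus[OF 1[rule_format, OF i, of m]] by (simp only: mult_minus_right)
    next
      fix j assume j: "j \<in> {r+1..CARD('n)}"
      from high[OF infty.zopen_A infty.gen_mem[OF i] infty.p_mem b1(2)[OF i] this]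
      show "lin_form (l' j) (lincomb c Infty (infty.gen i) - b1 i) = 0"
        using complement(2)[OF j] by (simp add: lin_form_diff)
    qed
    then show ?thesis
      using b1(2)[OF i] coset_eq_iff by metis
  qed
  have "\<phi> = local_hom V (lincomb c)"
  proof (rule hom_eq_local_hom[OF \<phi>])
    fix U s q assume U: "zopen U" "s \<in> V U" "q \<in> U"
    show "\<phi> U s q = lincomb c q s +o stalk V q"
    proof (cases "q = Infty")
      case True
      have "lincomb c Infty s =
          lincomb c Infty (\<Sum>i\<in>{1..r}. (wvar powi (- int (\<beta> i)) * lin_form (l' i) s) *s infty.gen i)"
        by (rule arg_cong[OF infty.expansion_gen[OF infty.lin_form_section_eq_0[OF U(1,2)]]])
      also have "\<dots> = (\<Sum>i\<in>{1..r}. (wvar powi (- int (\<beta> i)) * lin_form (l' i) s) *s lincomb c Infty (infty.gen i))"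
        by (rule lincomb_sum_scale) simp
      finally show ?thesis
        unfolding True using U(3)
        by (simp only: infty.hom_eval[OF \<phi> U(1,2) _ infty.p_mem at_infty] True)
    next
      case False
      then have q: "q \<in> U_zero"
        by (simp add: U_zero_def)
      have "lincomb c q s =
          lincomb c q (\<Sum>i\<in>{1..r}. (zvar powi (- int (\<alpha> i)) * lin_form (l i) s) *s zero.gen i)"
        by (rule arg_cong[OF zero.expansion_gen[OF zero.lin_form_section_eq_0[OF U(1,2)]]])
      also have "\<dots> = (\<Sum>i\<in>{1..r}. (zvar powi (- int (\<alpha> i)) * lin_form (l i) s) *s lincomb c q (zero.gen i))"
        by (rule lincomb_sum_scale) simp
      finally show ?thesis
        by (simp only: zero.hom_eval[OF \<phi> U q at_zero[OF _ q]])
    qed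
  qed
  then show ?thesis
    by blast
qed

lemma tangent_weights_index_set: "tangent_weights V (image_mset (\<lambda>x. - expo x) (mset_set index_set))"
proof -
  define h where "h x = local_hom V (basic_map x)" for x
  have indep: "c x = 0"
    if "\<And>p s. s \<in> stalk V p \<Longrightarrow> (\<Sum>x\<in>index_set. cst (c x) *s basic_map x p s) \<in> stalk V p" "x \<in> index_set"
    for c x
    using basis_independent[of c x] that by (simp add: lincomb_def)
  have span: "\<exists>c. \<phi> = local_hom V (\<lambda>p s. \<Sum>x\<in>index_set. cst (c x) *s basic_map x p s)"
    if "\<phi> \<in> sheaf_homs V" for \<phi>
    using basis_spans[OF that] by (simp add: lincomb_def[abs_def])
  have inj: "inj_on h index_set"
    unfolding h_def[abs_def]
    by (rule inj_on_tangent_basis[OF finite_index_set]) (fact local_family_basic_map indep span)+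
  have basis: "finite_basis (tangent_space V) (h ` index_set)"
    unfolding h_def[abs_def]
    by (rule finite_basis_tangent_basis[OF finite_index_set]) (fact local_family_basic_map indep span)+
  define wt where "wt \<phi> = - expo (inv_into index_set h \<phi>)" for \<phi>
  have wt: "wt (h x) = - expo x" if "x \<in> index_set" for x
    using that inj by (simp add: wt_def)
  have "image_mset wt (mset_set (h ` index_set)) = image_mset (\<lambda>x. wt (h x)) (mset_set index_set)"
    using image_mset_mset_set[OF inj] by (metis (no_types, lifting) multiset.map_comp comp_apply image_mset_cong)
  also have "\<dots> = image_mset (\<lambda>x. - expo x) (mset_set index_set)"
    using wt finite_index_set by (intro image_mset_cong) simp
  finally show ?thesis
    unfolding tangent_weights_def using basis wt weight_vector_basic_map
    by (intro exI[of _ "h ` index_set"] exI[of _ wt]) (auto simp: h_def)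
qed

end

section \<open>Frames adapted to a fixed point\<close>

text \<open>
  A complement of the span of \<open>u\<close> is also one of the span of \<open>u'\<close>.  The dual vectors belonging to
  it agree because both vanish on the common span.
\<close>
lemma ex_common_complement:
  fixes u u' :: "nat \<Rightarrow> complex ^ 'n::finite"
  assumes "r \<le> CARD('n)"
    and u: "inj_on u {1..r}" "vec.independent (u ` {1..r})"
    and span: "vec.span (u' ` {1..r}) = vec.span (u ` {1..r})"
  obtains e e' l l' where "dual_frame e l" "dual_frame e' l'"
    "\<And>i. i \<in> {1..r} \<Longrightarrow> e i = u i" "\<And>i. i \<in> {1..r} \<Longrightarrow> e' i = u' i"
    "\<And>j. j \<in> {r+1..CARD('n)} \<Longrightarrow> e' j = e j" "\<And>j. j \<in> {r+1..CARD('n)} \<Longrightarrow> l' j = l j"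
proof -
  define B where "B = vec.extend_basis (u ` {1..r})"
  define D where "D = B - u ` {1..r}"
  have B: "vec.independent B" "u ` {1..r} \<subseteq> B" "vec.span B = UNIV"
    using u(2) by (simp_all add: B_def vec.independent_extend_basis vec.extend_basis_superset vec.span_extend_basis)
  then have "finite B"
    by (intro vec.finiteI_independent)
  moreover have "card B = CARD('n)"
    using B vec.dim_eq_card[of B UNIV] by (simp add: vec_dim_card del: vec.dim_UNIV)
  ultimately have "finite D" "card D = card {r+1..CARD('n)}"
    using B(2) u(1) by (simp_all add: D_def card_Diff_subset card_image)
  then obtain g where g: "bij_betw g {r+1..CARD('n)} D"
    using finite_same_card_bij[of "{r+1..CARD('n)}" D] by auto
  define e where "e i = (if i \<le> r then u i else g i)" for i
  define e' where "e' i = (if i \<le> r then u' i else g i)" for i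
  have split: "{1..CARD('n)} = {1..r} \<union> {r+1..CARD('n)}"
    using \<open>r \<le> CARD('n)\<close> by auto
  have e_img: "e ` {1..CARD('n)} = B" and e'_img: "e' ` {1..CARD('n)} = u' ` {1..r} \<union> D"
  proof -
    have "e ` {1..r} = u ` {1..r}" "e' ` {1..r} = u' ` {1..r}"
      "e ` {r+1..CARD('n)} = g ` {r+1..CARD('n)}" "e' ` {r+1..CARD('n)} = g ` {r+1..CARD('n)}"
      by (auto simp: e_def e'_def intro!: image_cong)
    then show "e ` {1..CARD('n)} = B" "e' ` {1..CARD('n)} = u' ` {1..r} \<union> D"
      using bij_betw_imp_surj_on[OF g] B(2) unfolding split image_Un by (auto simp: D_def)
  qed
  have inj: "inj_on e {1..CARD('n)}"
    using e_img \<open>card B = CARD('n)\<close> by (intro eq_card_imp_inj_on) auto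
  then obtain l where l: "dual_frame e l"
    using ex_dual_frame B(1) e_img by metis
  have "vec.span (u' ` {1..r} \<union> D) = vec.span (u ` {1..r} \<union> D)"
    by (simp only: vec.span_Un span)
  also have "u ` {1..r} \<union> D = B"
    using B(2) by (auto simp: D_def)
  finally have span': "vec.span (e' ` {1..CARD('n)}) = UNIV"
    using B(3) e'_img by simp
  have "card (e' ` {1..CARD('n)}) \<le> CARD('n)"
    using card_image_le[of "{1..CARD('n)}" e'] by simp
  then have indep': "vec.independent (e' ` {1..CARD('n)})"
    using span' by (intro vec.card_le_dim_spanning[of _ UNIV]) (auto simp: vec_dim_card simp del: vec.dim_UNIV)
  then have "card (e' ` {1..CARD('n)}) = CARD('n)"
    using span' vec.dim_eq_card[of "e' ` {1..CARD('n)}" UNIV] by (simp add: vec_dim_card del: vec.dim_UNIV)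
  then have "inj_on e' {1..CARD('n)}"
    by (intro eq_card_imp_inj_on) auto
  then obtain l' where l': "dual_frame e' l'"
    using ex_dual_frame indep' by metis
  define dot where "dot f v = (\<Sum>a\<in>UNIV. f $ a * v $ a)" for f v :: "complex ^ 'n"
  have dot_scale: "dot f (c *s v) = c * dot f v" and dot_add: "dot f (v + w) = dot f v + dot f w"
    and dot_0: "dot f 0 = 0" for f v w c
    by (simp_all add: dot_def sum_distrib_left algebra_simps sum.distrib)
  have dot_sum: "dot f (sum h A) = (\<Sum>x\<in>A. dot f (h x))" for f h and A :: "nat set"
    by (induction A rule: infinite_finite_induct) (simp_all add: dot_add dot_0)
  have l_eq: "l' j = l j" if j: "j \<in> {r+1..CARD('n)}" for j
  proof -
    have "dot (l' j) (e i) = of_bool (i = j)" if i: "i \<in> {1..CARD('n)}" for i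
    proof (cases "i \<le> r")
      case True
      have "dot (l' j) (u' k) = 0" if "k \<in> {1..r}" for k
      proof -
        have "k \<in> {1..CARD('n)}" "j \<in> {1..CARD('n)}" "j \<noteq> k" "u' k = e' k"
          using that j \<open>r \<le> CARD('n)\<close> by (auto simp: e'_def)
        then show ?thesis
          using l' by (simp add: dual_frame_def dot_def)
      qed
      then have "u' ` {1..r} \<subseteq> {v. dot (l' j) v = 0}"
        by auto
      moreover have "vec.subspace {v. dot (l' j) v = 0}"
        by (simp add: vec.subspace_def dot_0 dot_add dot_scale)
      ultimately have "vec.span (u' ` {1..r}) \<subseteq> {v. dot (l' j) v = 0}"
        by (rule vec.span_minimal)
      moreover have "e i \<in> vec.span (u' ` {1..r})"
        using i True unfolding span by (intro vec.span_base) (auto simp: e_def)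
      ultimately show ?thesis
        using True j by auto
    next
      case False
      then have "e i = e' i" "j \<in> {1..CARD('n)}"
        using j by (simp_all add: e_def e'_def)
      then show ?thesis
        using l' i by (auto simp: dual_frame_def dot_def)
    qed
    then have dot_eq: "dot (l' j) v = dot (l j) v" for v
    proof -
      have "v = (\<Sum>i\<in>{1..CARD('n)}. dot (l i) v *s e i)"
        using l unfolding dual_frame_def dot_def by blast
      then have "dot (l' j) v = dot (l' j) (\<Sum>i\<in>{1..CARD('n)}. dot (l i) v *s e i)"
        by simp
      also have "\<dots> = (\<Sum>i\<in>{1..CARD('n)}. if i = j then dot (l j) v else 0)"
        unfolding dot_sum dot_scale using \<open>\<And>i. i \<in> {1..CARD('n)} \<Longrightarrow> dot (l' j) (e i) = of_bool (i = j)\<close>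
        by (intro sum.cong refl) simp
      finally show ?thesis
        using j by simp
    qed
    have "dot f (axis a 1) = f $ a" for f a
      by (simp add: dot_def axis_def if_distrib cong: if_cong)
    then have "l' j $ a = l j $ a" for a
      using dot_eq[of "axis a 1"] by simp
    then show ?thesis
      by (simp add: vec_eq_iff)
  qed
  show ?thesis
    using l l' l_eq by (intro that[of e l e' l']) (auto simp: e_def e'_def)
qed


section \<open>The multiset of weights\<close>

lemma sum_singleton_mset:
  "finite A \<Longrightarrow> inj_on f A \<Longrightarrow> (\<Sum>x\<in>A. {#f x#}) = mset_set (f ` A)"
  by (induction A rule: finite_induct) auto

lemma image_mset_eq_sum: "image_mset f (mset_set A) = (\<Sum>x\<in>A. {#f x#})"
  by (induction A rule: infinite_finite_induct) auto

lemma sum_const_mset: "finite A \<Longrightarrow> (\<Sum>x\<in>A. M) = repeat_mset (card A) M"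
  by (induction A rule: finite_induct) auto

lemma weights_at_zero: "(\<Sum>k<(a::nat). {#b - int k#}) = mset_set {b - int a<..b}"
proof -
  have "(\<lambda>k. b - int k) ` {..<a} = {b - int a<..b}"
  proof (intro equalityI subsetI)
    fix x assume "x \<in> {b - int a<..b}"
    then show "x \<in> (\<lambda>k. b - int k) ` {..<a}"
      by (intro image_eqI[of _ _ "nat (b - x)"]) auto
  qed auto
  then show ?thesis
    by (subst sum_singleton_mset) (auto simp: inj_on_def)
qed

lemma weights_at_infty: "(\<Sum>k<(a::nat). {#int k - b#}) = mset_set {- b..<int a - b}"
proof -
  have "(\<lambda>k. int k - b) ` {..<a} = {- b..<int a - b}"
  proof (intro equalityI subsetI)
    fix x assume "x \<in> {- b..<int a - b}"
    then show "x \<in> (\<lambda>k. int k - b) ` {..<a}"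
      by (intro image_eqI[of _ _ "nat (b + x)"]) auto
  qed auto
  then show ?thesis
    by (subst sum_singleton_mset) (auto simp: inj_on_def)
qed

lemma weights_pole_zero: "(\<Sum>k\<le>(a::nat). {#int k#}) = mset_set {0..int a}"
  by (subst sum_singleton_mset) (auto simp: inj_on_def atMost_atLeast0 image_int_atLeastAtMost)

lemma weights_pole_infty: "(\<Sum>k\<in>{1..(b::nat)}. {#- int k#}) = mset_set {- int b..<0}"
proof -
  have "(\<lambda>k. - int k) ` {1..b} = {- int b..<0}"
  proof (intro equalityI subsetI)
    fix x assume "x \<in> {- int b..<0}"
    then show "x \<in> (\<lambda>k. - int k) ` {1..b}"
      by (intro image_eqI[of _ _ "nat (- x)"]) auto
  qed auto
  then show ?thesis
    by (subst sum_singleton_mset) (auto simp: inj_on_def)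
qed

text \<open>
  Every interval contains \<open>0\<close>, so it is the disjoint union of a part depending only on \<open>\<alpha> i\<close> and a
  part depending only on \<open>\<beta> (\<pi> i)\<close>.
\<close>
lemma Wt3'_eq:
  assumes "\<pi> permutes {1..r}"
  shows "Wt3' r \<alpha> \<beta> \<pi> = (\<Sum>i\<in>{1..r}. mset_set {0..int (\<alpha> i)}) + (\<Sum>i\<in>{1..r}. mset_set {- int (\<beta> i)..<0})"
proof -
  have "mset_set {- int b..int a} = mset_set {0..int a} + mset_set {- int b..<0}" for a b
  proof -
    have "{- int b..int a} = {0..int a} \<union> {- int b..<0}"
      by auto
    then show ?thesis
      by (simp only:) (subst mset_set_Union; auto)
  qed
  moreover have "(\<Sum>i\<in>{1..r}. mset_set {- int (\<beta> i)..<0}) = (\<Sum>i\<in>{1..r}. mset_set {- int (\<beta> (\<pi> i))..<0})"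
    using sum.permute[OF assms, of "\<lambda>i. mset_set {- int (\<beta> i)..<0}"] by (simp add: comp_def)
  ultimately show ?thesis
    by (simp add: Wt3'_def sum.distrib)
qed

lemma (in fixed_type) weights_index_set:
  assumes "\<pi> permutes {1..r}"
  shows "image_mset (\<lambda>x. - expo x) (mset_set index_set) =
    Wt1 r \<alpha> + Wt2 r \<beta> + repeat_mset (CARD('n) - r) (Wt3' r \<alpha> \<beta> \<pi>)"
proof -
  have "(\<Sum>i\<in>{1..r}. \<Sum>j\<in>{1..r}. \<Sum>k<\<alpha> j. {#- expo (At_zero (i, j, k))#}) = Wt1 r \<alpha>"
    unfolding Wt1_def by (subst sum.swap) (simp add: weights_at_zero)
  moreover have "(\<Sum>i\<in>{1..r}. \<Sum>j\<in>{1..r}. \<Sum>k<\<beta> j. {#- expo (At_infty (i, j, k))#}) = Wt2 r \<beta>"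
    unfolding Wt2_def by (subst sum.swap) (simp add: weights_at_infty)
  moreover have "(\<Sum>i\<in>{1..r}. \<Sum>j\<in>{r+1..CARD('n)}. \<Sum>k\<le>\<alpha> i. {#- expo (Pole_zero (i, j, k))#})
      = repeat_mset (CARD('n) - r) (\<Sum>i\<in>{1..r}. mset_set {0..int (\<alpha> i)})"
    by (subst sum.swap) (simp add: weights_pole_zero sum_const_mset)
  moreover have "(\<Sum>i\<in>{1..r}. \<Sum>j\<in>{r+1..CARD('n)}. \<Sum>k\<in>{1..\<beta> i}. {#- expo (Pole_infty (i, j, k))#})
      = repeat_mset (CARD('n) - r) (\<Sum>i\<in>{1..r}. mset_set {- int (\<beta> i)..<0})"
    by (subst sum.swap) (simp only: expo.simps weights_pole_infty sum_const_mset[OF finite_atLeastAtMost]; simp)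
  ultimately show ?thesis
    unfolding image_mset_eq_sum sum_index_set Wt3'_eq[OF assms]
    by (simp add: ac_simps)
qed

theorem theorem2p2p1:
  fixes V :: "'n::finite presheaf"
    and r d :: nat
    and \<alpha> \<beta> \<pi> :: "nat \<Rightarrow> nat"
  assumes "1 \<le> r" and "r \<le> CARD('n)"
    and "V \<in> quot_points [:int d + int (CARD('n) - r), int (CARD('n) - r):]"
    and "circle_fixed V"
    and "has_type r V \<alpha> \<beta>"
    and "\<pi> permutes {1..r}"
  shows "tangent_weights V
           (Wt1 r \<alpha> + Wt2 r \<beta> + repeat_mset (CARD('n) - r) (Wt3' r \<alpha> \<beta> \<pi>))"
proof -
  obtain W u u' where type: "vec.span (u ` {1..r}) = W" "vec.span (u' ` {1..r}) = W"
      "inj_on u {1..r}" "vec.independent (u ` {1..r})"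
      "associated_on V U_zero (lin_span (structure_sheaf U_zero) ((\<lambda>i. zvar ^ \<alpha> i *s const_vec (u i)) ` {1..r}))"
      "associated_on V U_infty (lin_span (structure_sheaf U_infty) ((\<lambda>i. wvar ^ \<beta> i *s const_vec (u' i)) ` {1..r}))"
    using assms(5) unfolding has_type_def by blast
  have span: "vec.span (u' ` {1..r}) = vec.span (u ` {1..r})"
    using type by simp
  obtain e e' l l' where frames: "dual_frame e l" "dual_frame e' l'"
    and e: "\<And>i. i \<in> {1..r} \<Longrightarrow> e i = u i" "\<And>i. i \<in> {1..r} \<Longrightarrow> e' i = u' i"
    and complement: "\<And>j. j \<in> {r+1..CARD('n)} \<Longrightarrow> e' j = e j" "\<And>j. j \<in> {r+1..CARD('n)} \<Longrightarrow> l' j = l j"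
    by (rule ex_common_complement[OF assms(2) type(3,4) span], rule that)
  have "(\<lambda>i. zvar ^ \<alpha> i *s const_vec (u i)) ` {1..r} = (\<lambda>i. zvar ^ \<alpha> i *s const_vec (e i)) ` {1..r}"
    and "(\<lambda>i. wvar ^ \<beta> i *s const_vec (u' i)) ` {1..r} = (\<lambda>i. wvar ^ \<beta> i *s const_vec (e' i)) ` {1..r}"
    using e by (auto intro!: image_cong)
  note assoc = type(5,6)[unfolded this]
  have reg: "regular_at q wvar" if "q \<in> U_infty" for q
    using that regular_wvar_Aff regular_wvar_Infty by (cases q) (auto simp: U_infty_def)
  interpret fixed_type V r \<alpha> \<beta> e l e' l'
  proof unfold_locales
    show "subsheaf V"
      using assms(3) by (simp add: quot_points_def coherent_subsheaf_def)
    show "zopen U_zero" "zopen U_infty" "Aff 0 \<in> U_zero" "Infty \<in> U_infty"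
      by (auto simp: U_zero_def U_infty_def zopen_iff_cofinite)
    show "regular_at q zvar" if "q \<in> U_zero" for q
      using that by (cases q) (auto simp: U_zero_def regular_zvar_Aff)
    show "regular_at q (inverse zvar)" if "q \<in> U_zero" "q \<noteq> Aff 0" for q
      using that regular_wvar_Aff by (cases q) (auto simp: U_zero_def wvar_def)
    show "regular_at q wvar" if "q \<in> U_infty" for q
      using that by (rule reg)
    show "regular_at q (inverse wvar)" if "q \<in> U_infty" "q \<noteq> Infty" for q
      using that by (cases q) (auto simp: U_infty_def wvar_def regular_zvar_Aff)
  qed (fact assms(2,4) frames complement assoc uniformizer_zvar uniformizer_wvar)+
  show ?thesis
    using tangent_weights_index_set unfolding weights_index_set[OF assms(6)] .
qed

end
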